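(* Assume that $$\|r\|_{\ell^1(\mathbb{Z})} < \frac{\sqrt{6}}{2}.$$ Then for all integers $n, d\geq 1$, $$d_{\mathrm{Wass}}\left(\widetilde{\mathcal{W}}_{n,d}, \mathcal{G}^{r,s}_{n,d}\right)\leq \frac{\|r\|^{3/2}_{\ell^1(\mathbb{Z})}}{3-2\|r\|^2_{\ell^1(\mathbb{Z})}}\sqrt{\frac{32\,n^3}{d}\left(\sum_{|k|\leq d}|s(k)|^{4/3}\right)^{3}},$$ where the sum runs over integers $k$ with $|k|\le d$.
   Context: Let $r,s:\mathbb{Z}\to\mathbb{R}$ be covariance functions (even, positive semidefinite functions on $\mathbb{Z}$) with $r(0)=s(0)=1$, and write $\|r\|_{\ell^1(\mathbb{Z})}=\sum_{k\in\mathbb{Z}}|r(k)|$. Let $\mathfrak{H}$ be a real separable Hilbert space and $\{e_{ij}: i,j\geq 1\}\subset\mathfrak{H}$ a family with $\langle e_{ij}, e_{i'j'}\rangle_{\mathfrak{H}} = r(i-i')\,s(j-j')$. Let $X=\{X(h): h\in\mathfrak{H}\}$ be an isonormal Gaussian process over $\mathfrak{H}$, i.e. a centered Gaussian process with $\mathrm{E}[X(g)X(h)]=\langle g,h\rangle_{\mathfrak{H}}$, and put $X_{ij}=X(e_{ij})$; thus the $X_{ij}$ are jointly Gaussian, centered, with $\mathrm{E}[X_{ij}X_{i'j'}]=r(i-i')s(j-j')$. For $n,d\ge1$, $\widetilde{\mathcal{W}}_{n,d}=(\widetilde{W}_{ij})_{1\leq i,j\leq n}$ is the random symmetric $n\times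 n$ matrix with entries $$\widetilde{W}_{ij}=\frac{1}{\sqrt{d}}\sum_{k=1}^d\left(X_{ik}X_{jk}-r(i-j)\right).$$ $\mathcal{G}^{r,s}_{n,d}=(G_{ij})_{1\le i,j\le n}$ is a random symmetric $n\times n$ matrix whose entries, viewed as a vector $(G_{11},\ldots,G_{1n},G_{21},\ldots,G_{nn})$, form a centered Gaussian vector with the same covariance matrix as $(\widetilde{W}_{11},\ldots,\widetilde{W}_{1n},\widetilde{W}_{21},\ldots,\widetilde{W}_{nn})$. For random matrices $\mathcal{X},\mathcal{Y}$ with values in the space $\mathcal{M}_n(\mathbb{R})$ of real $n\times n$ matrices with $\mathrm{E}\|\mathcal{X}\|_{\mathrm{HS}}+\mathrm{E}\|\mathcal{Y}\|_{\mathrm{HS}}<\infty$ ($\|\cdot\|_{\mathrm{HS}}$ the Hilbert–Schmidt norm), the Wasserstein distance is $$d_{\mathrm{Wass}}(\mathcal{X},\mathcal{Y})=\sup\left\{\mathrm{E}[g(\mathcal{X})]-\mathrm{E}[g(\mathcal{Y})]:\ g:\mathcal{M}_n(\mathbb{R})\to\mathbb{R},\ \|g\|_{\mathrm{Lip}}\leq 1\right\},\qquad \|g\|_{\mathrm{Lip}}=\sup_{A\neq B}\frac{|g(A)-g(B)|}{\|A-B\|_{\mathrm{HS}}}.$$ *)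

theory Defs
  imports "HOL-Probability.Probability"
begin

definition covariance_function :: "(int \<Rightarrow> real) \<Rightarrow> bool" where
  "covariance_function r \<longleftrightarrow>
     (\<forall>k. r (- k) = r k) \<and>
     (\<forall>S c. finite S \<longrightarrow> 0 \<le> (\<Sum>i\<in>S. \<Sum>j\<in>S. c i * c j * r (i - j)))"

text \<open>Only meaningful for absolutely summable sequences: \<open>infsum\<close> is \<open>0\<close> otherwise.\<close>

definition l1_norm :: "(int \<Rightarrow> real) \<Rightarrow> real" where
  "l1_norm r = infsum (\<lambda>k. \<bar>r k\<bar>) UNIV"

text \<open>The law \<open>N(0, \<sigma>\<^sup>2)\<close>, with \<open>\<sigma> = 0\<close> giving the point mass at \<open>0\<close>.\<close>

definition centered_normal :: "real \<Rightarrow> real measure" where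
  "centered_normal \<sigma> =
     (if \<sigma> = 0 then return borel 0 else density lborel (\<lambda>x. ennreal (normal_density 0 \<sigma> x)))"

text \<open>Gaussian processes and Gaussian vectors alike: every finite linear combination is normal,
  degenerate laws included.\<close>

definition centered_gaussian_family :: "'w measure \<Rightarrow> ('t \<Rightarrow> 'w \<Rightarrow> real) \<Rightarrow> bool" where
  "centered_gaussian_family M X \<longleftrightarrow>
     (\<forall>t. X t \<in> borel_measurable M) \<and>
     (\<forall>S c. finite S \<longrightarrow>
        (\<exists>\<sigma>\<ge>0. distr M borel (\<lambda>\<omega>. \<Sum>t\<in>S. c t * X t \<omega>) = centered_normal \<sigma>))"

definition isonormal :: "'w measure \<Rightarrow> ('h::real_inner \<Rightarrow> 'w \<Rightarrow> real) \<Rightarrow> bool" where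
  "isonormal M X \<longleftrightarrow>
     centered_gaussian_family M X \<and>
     (\<forall>g h. integral\<^sup>L M (\<lambda>\<omega>. X g \<omega> * X h \<omega>) = g \<bullet> h)"

definition covariance :: "'w measure \<Rightarrow> ('w \<Rightarrow> real) \<Rightarrow> ('w \<Rightarrow> real) \<Rightarrow> real" where
  "covariance M U V =
     integral\<^sup>L M (\<lambda>\<omega>. (U \<omega> - integral\<^sup>L M U) * (V \<omega> - integral\<^sup>L M V))"

text \<open>Rows and columns are indexed by a finite type; \<open>pos\<close> is the numbering of that type by
  \<open>1, \<dots>, n\<close>, needed because the entries depend on differences of row numbers.\<close>

definition wishart_matrix ::
  "(int \<Rightarrow> real) \<Rightarrow> (nat \<Rightarrow> nat \<Rightarrow> 'w \<Rightarrow> real) \<Rightarrow> ('n::finite \<Rightarrow> nat) \<Rightarrow> nat \<Rightarrow> 'w \<Rightarrow> real^'n^'n" where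
  "wishart_matrix r X pos d \<omega> =
     (\<chi> i j. 1 / sqrt (real d) *
        (\<Sum>k=1..d. X (pos i) k \<omega> * X (pos j) k \<omega> - r (int (pos i) - int (pos j))))"

text \<open>On \<open>real^'n^'n\<close> the library norm, hence the distance in \<open>lipschitz_on\<close>, is the
  Hilbert--Schmidt norm. The supremum is taken in the extended reals, where it always exists. The
  definition is meant for integrable \<open>X\<close> and \<open>Y\<close>, for which all expectations are finite.\<close>

definition wasserstein_dist ::
  "'w measure \<Rightarrow> ('w \<Rightarrow> real^'n^'n) \<Rightarrow> 'v measure \<Rightarrow> ('v \<Rightarrow> real^'n^'n) \<Rightarrow> ereal" where
  "wasserstein_dist M X N Y =
     (SUP g\<in>{g :: real^'n^'n \<Rightarrow> real. 1-lipschitz_on UNIV g}.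
        ereal (integral\<^sup>L M (\<lambda>\<omega>. g (X \<omega>)) - integral\<^sup>L N (\<lambda>\<omega>. g (Y \<omega>))))"

end

theory Submission
  imports Defs "HOL-Real_Asymp.Real_Asymp"
begin

text \<open>Gaussian interpolation with a Stein kernel. Put \<open>W\<close> and \<open>G\<close> independently on the product space
  and let \<open>U = cos t W + sin t G\<close>. Integration by parts in the underlying Gaussian variables, for \<open>W\<close>
  (with Stein kernel \<open>\<Theta>\<close>) and for \<open>G\<close> (with covariance \<open>C\<close>, the mean of \<open>\<Theta>\<close>), turns the
  derivative of \<open>E g(U)\<close> in \<open>t\<close> into \<open>cos t sin t\<close> times the expectation of \<open>C - \<Theta>\<close> paired with the
  Hessian of \<open>g\<close> at \<open>U\<close>. A further integration by parts in \<open>G\<close> trades one derivative of \<open>g\<close> for the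
  factor \<open>A G\<close>, where \<open>A = (C - \<Theta>) C\<^sup>-\<^sup>1\<close>; thus for \<open>1\<close>-Lipschitz \<open>g\<close> the difference of expectations is
  at most the \<open>L\<^sup>2\<close> norm of \<open>A G\<close>. On symmetric matrices \<open>C B\<close> is a multiple of \<open>R B R\<close> with
  \<open>R\<close> the matrix of the \<open>r(i - j)\<close>, which is bounded below by \<open>2 - \<parallel>r\<parallel>\<close>, and the variance of \<open>\<Theta>\<close> is a sum
  of products of \<open>s\<close> along four-cycles, bounded by Young's inequality.\<close>

subsection \<open>The normal distribution on the line\<close>

text \<open>The operator C is singular on the space of all matrices: entries (i,j) and (j,i) of W
  coincide, so C has repeated columns. What saves the argument is that every row of C - \<Theta> is
  a symmetric matrix, and on these C acts as a scalar times the map B to R B R, which is invertible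
  since the absolute row sums of R lie below 2. There is no division by sin t: the derivative along
  the path carries cos t sin t, the reverse integration by parts absorbs the sine, and the remaining
  cosine integrates to 1. No bound on the Hessian survives in the final estimate, so the smooth
  approximants of a Lipschitz function may have Hessians that blow up. With L the norm of r, the
  method gives 4 L / (2 - L)^2 where the claim has 32 L^3 / (3 - 2 L^2)^2; since r(0) = 1 forces L
  >= 1, the former is smaller. Gaussian vectors may be degenerate, so joint densities are avoided:
  laws are compared through characteristic functions, and integration by parts takes place in one
  variable with an independent remainder frozen.\<close>

lemma integrable_std_normal_polynomial_bound:
  fixes f :: "real \<Rightarrow> real"
  assumes [measurable]: "f \<in> borel_measurable borel"
    and bound: "\<And>x. \<bar>f x\<bar> \<le> B * (1 + \<bar>x\<bar>) ^ p"
  shows "integrable lborel (\<lambda>x. std_normal_density x * f x)"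
proof -
  have eq: "(1 + \<bar>x\<bar>) ^ p = (\<Sum>k\<le>p. of_nat (p choose k) * \<bar>x\<bar> ^ k)" for x :: real
    by (subst add.commute) (simp add: binomial_ring)
  have "integrable lborel (\<lambda>x. B * (\<Sum>k\<le>p. of_nat (p choose k) * (std_normal_density x * \<bar>x\<bar> ^ k)))"
    by (intro Bochner_Integration.integrable_sum integrable_mult_right integrable_std_normal_moment_abs)
  moreover have "(\<Sum>k\<le>p. of_nat (p choose k) * (std_normal_density x * \<bar>x\<bar> ^ k))
      = std_normal_density x * (1 + \<bar>x\<bar>) ^ p" for x :: real
    unfolding eq by (simp only: sum_distrib_left mult_ac)
  ultimately have int: "integrable lborel (\<lambda>x. B * (std_normal_density x * (1 + \<bar>x\<bar>) ^ p))"
    by simp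
  show ?thesis
  proof (rule Bochner_Integration.integrable_bound[OF int])
    show "AE x in lborel. norm (std_normal_density x * f x)
        \<le> norm (B * (std_normal_density x * (1 + \<bar>x\<bar>) ^ p))"
    proof (intro AE_I2)
      fix x :: real
      have "std_normal_density x * \<bar>f x\<bar> \<le> std_normal_density x * (B * (1 + \<bar>x\<bar>) ^ p)"
        by (intro mult_left_mono bound) auto
      also have "\<dots> \<le> \<bar>B * (std_normal_density x * (1 + \<bar>x\<bar>) ^ p)\<bar>"
        by (simp add: mult_ac)
      finally show "norm (std_normal_density x * f x)
          \<le> norm (B * (std_normal_density x * (1 + \<bar>x\<bar>) ^ p))"
        by (simp add: abs_mult)
    qed
  qed simp
qed

text \<open>The standard normal density \<phi> has derivative -x \<phi>(x), so the two integrands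
  differ by the derivative of \<phi> f. Its integral over the line vanishes because \<phi> beats
  polynomial growth at both ends.\<close>

lemma std_normal_integration_by_parts:
  fixes f f' :: "real \<Rightarrow> real"
  assumes deriv: "\<And>x. (f has_real_derivative f' x) (at x)"
    and cont: "\<And>x. isCont f' x"
    and bf: "\<And>x. \<bar>f x\<bar> \<le> B * (1 + \<bar>x\<bar>) ^ p"
    and bf': "\<And>x. \<bar>f' x\<bar> \<le> B' * (1 + \<bar>x\<bar>) ^ p'"
  shows "(\<integral>x. x * f x \<partial>std_normal_distribution) = (\<integral>x. f' x \<partial>std_normal_distribution)"
proof -
  have contf: "isCont f x" for x using deriv DERIV_isCont by blast
  have [measurable]: "f \<in> borel_measurable borel" "f' \<in> borel_measurable borel"
    using cont contf by (auto intro!: borel_measurable_continuous_onI simp: continuous_on_eq_continuous_at)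
  have B: "B \<ge> 0" using bf[of 0] by simp
  have int': "integrable lborel (\<lambda>x. std_normal_density x * f' x)"
    by (rule integrable_std_normal_polynomial_bound[OF _ bf']) simp
  have intx: "integrable lborel (\<lambda>x. std_normal_density x * (x * f x))"
  proof (rule integrable_std_normal_polynomial_bound[where B=B and p="Suc p"])
    fix x :: real
    have "\<bar>x\<bar> * \<bar>f x\<bar> \<le> (1 + \<bar>x\<bar>) * (B * (1 + \<bar>x\<bar>) ^ p)"
      by (intro mult_mono bf) auto
    then show "\<bar>x * f x\<bar> \<le> B * (1 + \<bar>x\<bar>) ^ Suc p"
      by (simp add: abs_mult mult_ac)
  qed simp
  let ?F = "\<lambda>x. std_normal_density x * f x"
  let ?F' = "\<lambda>x. std_normal_density x * f' x - std_normal_density x * (x * f x)"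
  have dF: "(?F has_real_derivative ?F' x) (at x)" for x
    unfolding std_normal_density_def
    by (rule derivative_eq_intros deriv refl | simp)+ (simp add: field_simps)
  have lim: "((\<lambda>x. B * (std_normal_density x * (1 + \<bar>x\<bar>) ^ p)) \<longlongrightarrow> 0) at_top"
            "((\<lambda>x. B * (std_normal_density x * (1 + \<bar>x\<bar>) ^ p)) \<longlongrightarrow> 0) at_bot"
    unfolding std_normal_density_def by real_asymp+
  have le: "norm (?F x) \<le> B * (std_normal_density x * (1 + \<bar>x\<bar>) ^ p)" for x
    using mult_left_mono[OF bf[of x], of "std_normal_density x"]
    by (simp add: abs_mult mult_ac)
  have lt: "(?F \<longlongrightarrow> 0) at_top" "(?F \<longlongrightarrow> 0) at_bot"
    by (rule Lim_null_comparison[OF _ lim(1)]; use le in simp)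
       (rule Lim_null_comparison[OF _ lim(2)]; use le in simp)
  have "(LBINT x=-\<infinity>..\<infinity>. ?F' x) = 0 - 0"
  proof (rule interval_integral_FTC_integrable)
    show "(?F has_vector_derivative ?F' x) (at x)" for x
      using dF by (simp add: has_real_derivative_iff_has_vector_derivative)
    show "isCont ?F' x" for x
      unfolding std_normal_density_def by (intro continuous_intros cont contf) auto
    show "set_integrable lborel (einterval (-\<infinity>) \<infinity>) ?F'"
      unfolding set_integrable_def
      using int' intx by simp
    show "((?F \<circ> real_of_ereal) \<longlongrightarrow> 0) (at_right (-\<infinity>))"
      using lt by (simp add: ereal_tendsto_simps)
    show "((?F \<circ> real_of_ereal) \<longlongrightarrow> 0) (at_left \<infinity>)"
      using lt by (simp add: ereal_tendsto_simps)
  qed auto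
  then have "(\<integral>x. ?F' x \<partial>lborel) = 0"
    by (simp add: interval_lebesgue_integral_def set_lebesgue_integral_def)
  then have "(\<integral>x. std_normal_density x * (x * f x) \<partial>lborel) = (\<integral>x. std_normal_density x * f' x \<partial>lborel)"
    using int' intx by simp
  then show ?thesis
    by (simp add: integral_density)
qed

text \<open>Covers the point mass and the genuine normal laws by one formula, so that moments and
  characteristic functions need no case distinction on the variance.\<close>

lemma centered_normal_eq_distr:
  assumes "\<sigma> \<ge> 0"
  shows "centered_normal \<sigma> = distr std_normal_distribution borel (\<lambda>x. \<sigma> * x)"
proof -
  interpret prob_space std_normal_distribution
    by (rule prob_space_normal_density) simp
  show ?thesis
  proof (cases "\<sigma> = 0")
    case True
    then show ?thesis by (simp add: centered_normal_def)
  next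
    case False
    then have s: "\<sigma> > 0" using assms by simp
    have "distributed std_normal_distribution lborel (\<lambda>x. x) (normal_density 0 1)"
      unfolding distributed_def by (auto simp: distr_id2)
    from normal_density_affine[OF this _ False, of 0] s
    have "distributed std_normal_distribution lborel (\<lambda>x. \<sigma> * x) (normal_density 0 \<sigma>)"
      by simp
    then have "distr std_normal_distribution lborel (\<lambda>x. \<sigma> * x) = density lborel (normal_density 0 \<sigma>)"
      by (auto simp: distributed_def)
    moreover have "distr std_normal_distribution lborel (\<lambda>x. \<sigma> * x) = distr std_normal_distribution borel (\<lambda>x. \<sigma> * x)"
      by (rule distr_cong) auto
    ultimately show ?thesis using False by (simp add: centered_normal_def)
  qed
qed

lemma char_centered_normal:
  assumes "\<sigma> \<ge> 0"
  shows "char (centered_normal \<sigma>) t = exp (of_real (- (\<sigma>\<^sup>2 * t\<^sup>2) / 2))"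
proof -
  have "char (centered_normal \<sigma>) t = char std_normal_distribution (t * \<sigma>)"
    unfolding centered_normal_eq_distr[OF assms] char_def
    by (subst integral_distr) (auto simp: mult_ac)
  then show ?thesis
    by (simp add: char_std_normal_distribution power_mult_distrib mult_ac flip: exp_of_real)
qed

subsection \<open>Characteristic functions determine joint laws\<close>

text \<open>Levy's uniqueness theorem for probability measures carries over after division by the
  common total mass, which is the value of the transform at t = 0. The generality is needed for the
  weighted measures that follow.\<close>

lemma finite_measure_eq_of_char_eq:
  fixes \<mu> \<nu> :: "real measure"
  assumes fin: "finite_measure \<mu>" "finite_measure \<nu>"
    and sets [simp, measurable_cong]: "sets \<mu> = sets borel" "sets \<nu> = sets borel"
    and char: "\<And>t. (\<integral>x. iexp (t * x) \<partial>\<mu>) = (\<integral>x. iexp (t * x) \<partial>\<nu>)"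
  shows "\<mu> = \<nu>"
proof -
  interpret \<mu>: finite_measure \<mu> by fact
  interpret \<nu>: finite_measure \<nu> by fact
  have sp [simp]: "space \<mu> = UNIV" "space \<nu> = UNIV"
    using sets[THEN sets_eq_imp_space_eq] by auto
  define m where "m = measure \<mu> UNIV"
  have m: "measure \<nu> UNIV = m"
    using char[of 0] by (simp add: m_def)
  show ?thesis
  proof (cases "m = 0")
    case True
    have "emeasure \<mu> A = emeasure \<nu> A" if "A \<in> sets \<mu>" for A
    proof -
      have "measure \<mu> A \<le> measure \<mu> UNIV" "measure \<nu> A \<le> measure \<nu> UNIV"
        using that by (auto intro!: \<mu>.finite_measure_mono \<nu>.finite_measure_mono)
      then have "measure \<mu> A = 0" "measure \<nu> A = 0"
        using True m by (auto simp: m_def measure_le_0_iff)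
      then show ?thesis by (simp add: \<mu>.emeasure_eq_measure \<nu>.emeasure_eq_measure)
    qed
    then show ?thesis by (intro measure_eqI) auto
  next
    case False
    then have mpos: "m > 0" by (simp add: m_def zero_less_measure_iff)
    let ?S = "\<lambda>\<rho>. density \<rho> (\<lambda>_. ennreal (1 / m))"
    have em: "emeasure (?S \<rho>) A = ennreal (1/m) * emeasure \<rho> A" if "A \<in> sets \<rho>" for \<rho> :: "real measure" and A
      using that by (simp add: emeasure_density_const)
    have prob: "prob_space (?S \<mu>)" "prob_space (?S \<nu>)"
      using mpos m
      by (auto intro!: prob_spaceI simp: em emeasure_density_const \<mu>.emeasure_eq_measure \<nu>.emeasure_eq_measure m_def
          simp flip: ennreal_mult)
    have "?S \<mu> = ?S \<nu>"
    proof (rule Levy_uniqueness)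
      show "real_distribution (?S \<mu>)" "real_distribution (?S \<nu>)"
        using prob by (auto simp: real_distribution_def real_distribution_axioms_def)
      show "char (?S \<mu>) = char (?S \<nu>)"
        using mpos char by (auto intro!: ext simp: char_def integral_density)
    qed
    then have *: "ennreal (1/m) * emeasure \<mu> A = ennreal (1/m) * emeasure \<nu> A" if "A \<in> sets borel" for A
      using em[of A \<mu>] em[of A \<nu>] that by simp
    show ?thesis
    proof (intro measure_eqI)
      fix A assume "A \<in> sets \<mu>"
      then have A: "A \<in> sets borel" by simp
      show "emeasure \<mu> A = emeasure \<nu> A"
        using *[OF A] mpos by (simp add: ennreal_mult_cancel_left)
    qed simp
  qed
qed

lemma (in finite_measure) integrable_iexp_comp:
  "Y \<in> borel_measurable M \<Longrightarrow> integrable M (\<lambda>\<omega>. iexp (Y \<omega>))"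
  by (rule integrable_const_bound[where B=1]) auto

text \<open>The weight 1 + cos is nonnegative, hence defines a measure to which one-dimensional
  uniqueness applies. It is also a sum of exponentials, so the transform of the image under
  \<open>Z\<close> involves only the joint characteristic function at frequencies 0, 1 and -1 in
  \<open>T\<close>.\<close>

lemma (in finite_measure) char_cos_density:
  assumes [measurable]: "T \<in> borel_measurable M" "Z \<in> borel_measurable M"
  shows "(\<integral>x. iexp (t * x) \<partial>distr (density M (\<lambda>\<omega>. ennreal (1 + cos (T \<omega> + c)))) borel Z)
      = (\<integral>\<omega>. iexp (t * Z \<omega> + 0 * T \<omega>) \<partial>M) + iexp c / 2 * (\<integral>\<omega>. iexp (t * Z \<omega> + 1 * T \<omega>) \<partial>M)
        + iexp (-c) / 2 * (\<integral>\<omega>. iexp (t * Z \<omega> + (-1) * T \<omega>) \<partial>M)"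
proof -
  have nonneg: "0 \<le> 1 + cos (x :: real)" for x using cos_ge_minus_one[of x] by linarith
  have i: "integrable M (\<lambda>\<omega>. iexp (t * Z \<omega> + a * T \<omega>))" for a
    by (rule integrable_iexp_comp) simp
  have "(\<integral>x. iexp (t * x) \<partial>distr (density M (\<lambda>\<omega>. ennreal (1 + cos (T \<omega> + c)))) borel Z)
      = (\<integral>\<omega>. (1 + cos (T \<omega> + c)) *\<^sub>R iexp (t * Z \<omega>) \<partial>M)"
    by (subst integral_distr) (auto simp: integral_density nonneg)
  also have "\<dots> = (\<integral>\<omega>. iexp (t * Z \<omega> + 0 * T \<omega>) + (iexp c / 2 * iexp (t * Z \<omega> + 1 * T \<omega>)
      + iexp (-c) / 2 * iexp (t * Z \<omega> + (-1) * T \<omega>)) \<partial>M)"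
  proof (intro Bochner_Integration.integral_cong refl)
    fix \<omega>
    have "complex_of_real (cos (T \<omega> + c)) = (iexp (T \<omega> + c) + iexp (-(T \<omega> + c))) / 2"
      by (simp add: cos_exp_eq cos_of_real[symmetric] del: of_real_add)
         (simp add: exp_add exp_diff exp_minus field_simps)
    also have "iexp (T \<omega> + c) = iexp c * iexp (T \<omega>)"
      by (simp add: exp_add ring_distribs)
    also have "iexp (- (T \<omega> + c)) = iexp (-c) * iexp (- T \<omega>)"
      by (subst exp_add[symmetric]) (simp add: algebra_simps)
    finally have c: "complex_of_real (cos (T \<omega> + c)) = (iexp c * iexp (T \<omega>) + iexp (-c) * iexp (- T \<omega>)) / 2" .
    have p: "iexp (t * Z \<omega> + 1 * T \<omega>) = iexp (t * Z \<omega>) * iexp (T \<omega>)"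
      by (simp add: exp_add ring_distribs)
    have m: "iexp (t * Z \<omega> + (-1) * T \<omega>) = iexp (t * Z \<omega>) * iexp (- T \<omega>)"
      by (subst exp_add[symmetric]) (simp add: algebra_simps)
    have z: "iexp (t * Z \<omega> + 0 * T \<omega>) = iexp (t * Z \<omega>)" by simp
    show "(1 + cos (T \<omega> + c)) *\<^sub>R iexp (t * Z \<omega>) = iexp (t * Z \<omega> + 0 * T \<omega>) + (iexp c / 2 * iexp (t * Z \<omega> + 1 * T \<omega>)
      + iexp (-c) / 2 * iexp (t * Z \<omega> + (-1) * T \<omega>))"
      unfolding p m z scaleR_conv_of_real of_real_add[of 1 "cos (T \<omega> + c)"] c
      by (simp only: of_real_1) (simp add: field_simps)
  qed
  also have "\<dots> = (\<integral>\<omega>. iexp (t * Z \<omega> + 0 * T \<omega>) \<partial>M) + (iexp c / 2 * (\<integral>\<omega>. iexp (t * Z \<omega> + 1 * T \<omega>) \<partial>M)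
      + iexp (-c) / 2 * (\<integral>\<omega>. iexp (t * Z \<omega> + (-1) * T \<omega>) \<partial>M))"
    using i[of 0] i[of 1] i[of "-1"]
    by (simp only: Bochner_Integration.integral_add Bochner_Integration.integrable_add
        integrable_mult_right integral_mult_right_zero)
  finally show ?thesis by (simp add: add.assoc)
qed

lemma (in finite_measure) finite_measure_cos_density:
  assumes [measurable]: "T \<in> borel_measurable M"
  shows "finite_measure (density M (\<lambda>\<omega>. ennreal (1 + cos (T \<omega> + c))))"
proof (rule finite_measureI)
  have "(\<integral>\<^sup>+\<omega>. ennreal (1 + cos (T \<omega> + c)) \<partial>M) \<le> (\<integral>\<^sup>+\<omega>. 2 \<partial>M)"
  proof (rule nn_integral_mono)
    fix \<omega>
    have "ennreal (1 + cos (T \<omega> + c)) \<le> ennreal 2"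
      using cos_le_one[of "T \<omega> + c"] by (intro ennreal_leI) linarith
    then show "ennreal (1 + cos (T \<omega> + c)) \<le> 2" by simp
  qed
  also have "\<dots> < \<infinity>" by (simp add: emeasure_eq_measure ennreal_mult_less_top)
  finally show "emeasure (density M (\<lambda>\<omega>. ennreal (1 + cos (T \<omega> + c))))
      (space (density M (\<lambda>\<omega>. ennreal (1 + cos (T \<omega> + c))))) \<noteq> \<infinity>"
    by (simp add: emeasure_density cong: nn_integral_cong)
qed

lemma (in finite_measure) integral_indicator_cos:
  assumes [measurable]: "T \<in> borel_measurable M" "Z \<in> borel_measurable M" "A \<in> sets borel"
  shows "measure (distr (density M (\<lambda>\<omega>. ennreal (1 + cos (T \<omega> + c)))) borel Z) A
    = (\<integral>\<omega>. indicator A (Z \<omega>) \<partial>M) + (\<integral>\<omega>. indicator A (Z \<omega>) * cos (T \<omega> + c) \<partial>M)"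
proof -
  have nonneg: "0 \<le> 1 + cos (x :: real)" for x using cos_ge_minus_one[of x] by linarith
  let ?D = "density M (\<lambda>\<omega>. ennreal (1 + cos (T \<omega> + c)))"
  interpret D: finite_measure ?D by (rule finite_measure_cos_density) simp
  have "measure (distr ?D borel Z) A = (\<integral>x. indicator A x \<partial>distr ?D borel Z)"
    by simp
  also have "\<dots> = (\<integral>\<omega>. (1 + cos (T \<omega> + c)) * indicator A (Z \<omega>) \<partial>M)"
    by (subst integral_distr) (auto simp: integral_density nonneg)
  also have "\<dots> = (\<integral>\<omega>. indicator A (Z \<omega>) + indicator A (Z \<omega>) * cos (T \<omega> + c) \<partial>M)"
    by (simp add: algebra_simps)
  also have "\<dots> = (\<integral>\<omega>. indicator A (Z \<omega>) \<partial>M) + (\<integral>\<omega>. indicator A (Z \<omega>) * cos (T \<omega> + c) \<partial>M)"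
    by (intro Bochner_Integration.integral_add integrable_const_bound[where B=1])
       (auto simp: indicator_def abs_mult split: if_splits)
  finally show ?thesis .
qed

text \<open>The shift by -pi/2 turns the cosine into a sine, so one family of cosine weights yields
  both real and imaginary part.\<close>

lemma (in finite_measure) integral_indicator_iexp:
  assumes [measurable]: "T \<in> borel_measurable M" "Z \<in> borel_measurable M" "A \<in> sets borel"
  shows "(\<integral>\<omega>. indicator A (Z \<omega>) *\<^sub>R iexp (T \<omega>) \<partial>M)
    = of_real (\<integral>\<omega>. indicator A (Z \<omega>) * cos (T \<omega> + 0) \<partial>M)
      + \<i> * of_real (\<integral>\<omega>. indicator A (Z \<omega>) * cos (T \<omega> + (-(pi/2))) \<partial>M)"
proof -
  have i: "integrable M (\<lambda>\<omega>. complex_of_real (indicator A (Z \<omega>) * cos (T \<omega> + c)))" for c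
    by (intro integrable_of_real integrable_const_bound[where B=1])
       (auto simp: indicator_def abs_mult split: if_splits)
  have "(\<integral>\<omega>. indicator A (Z \<omega>) *\<^sub>R iexp (T \<omega>) \<partial>M)
    = (\<integral>\<omega>. of_real (indicator A (Z \<omega>) * cos (T \<omega> + 0)) + \<i> * of_real (indicator A (Z \<omega>) * cos (T \<omega> + (-(pi/2)))) \<partial>M)"
    by (intro Bochner_Integration.integral_cong refl)
       (simp add: exp_Euler scaleR_conv_of_real cos_diff algebra_simps cos_of_real sin_of_real)
  also have "\<dots> = of_real (\<integral>\<omega>. indicator A (Z \<omega>) * cos (T \<omega> + 0) \<partial>M)
      + \<i> * of_real (\<integral>\<omega>. indicator A (Z \<omega>) * cos (T \<omega> + (-(pi/2))) \<partial>M)"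
    by (subst Bochner_Integration.integral_add[OF i integrable_mult_right[OF i]])
       (simp only: integral_mult_right_zero integral_complex_of_real)
  finally show ?thesis .
qed

text \<open>Exchanges the exponential in one variable for an indicator and keeps the exponential in
  the other. The measures weighted by 1 + cos have images on the line with equal transforms, so
  those images agree on every Borel set.\<close>

lemma integral_indicator_iexp_eqI:
  fixes X \<Theta> :: "'a \<Rightarrow> real" and X' \<Theta>' :: "'b \<Rightarrow> real"
  assumes fin: "finite_measure M" "finite_measure M'"
    and [measurable]: "X \<in> borel_measurable M" "\<Theta> \<in> borel_measurable M"
      "X' \<in> borel_measurable M'" "\<Theta>' \<in> borel_measurable M'" "A \<in> sets borel"
    and char: "\<And>a b. (\<integral>\<omega>. iexp (a * X \<omega> + b * \<Theta> \<omega>) \<partial>M) = (\<integral>\<omega>. iexp (a * X' \<omega> + b * \<Theta>' \<omega>) \<partial>M')"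
  shows "(\<integral>\<omega>. indicator A (X \<omega>) *\<^sub>R iexp (\<Theta> \<omega>) \<partial>M) = (\<integral>\<omega>. indicator A (X' \<omega>) *\<^sub>R iexp (\<Theta>' \<omega>) \<partial>M')"
proof -
  interpret M: finite_measure M by fact
  interpret M': finite_measure M' by fact
  let ?D = "\<lambda>c. distr (density M (\<lambda>\<omega>. ennreal (1 + cos (\<Theta> \<omega> + c)))) borel X"
  let ?D' = "\<lambda>c. distr (density M' (\<lambda>\<omega>. ennreal (1 + cos (\<Theta>' \<omega> + c)))) borel X'"
  have eq: "?D c = ?D' c" for c
  proof (rule finite_measure_eq_of_char_eq)
    show "finite_measure (?D c)" "finite_measure (?D' c)"
      by (auto intro!: finite_measure.finite_measure_distr M.finite_measure_cos_density M'.finite_measure_cos_density)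
    show "(\<integral>x. iexp (t * x) \<partial>?D c) = (\<integral>x. iexp (t * x) \<partial>?D' c)" for t
      by (simp only: M.char_cos_density M'.char_cos_density \<open>\<Theta> \<in> _\<close> \<open>\<Theta>' \<in> _\<close> \<open>X \<in> _\<close> \<open>X' \<in> _\<close> char)
  qed auto
  let ?p = "\<integral>\<omega>. indicator A (X \<omega>) \<partial>M :: real" and ?p' = "\<integral>\<omega>. indicator A (X' \<omega>) \<partial>M' :: real"
  let ?q = "\<lambda>c. \<integral>\<omega>. indicator A (X \<omega>) * cos (\<Theta> \<omega> + c) \<partial>M"
  let ?q' = "\<lambda>c. \<integral>\<omega>. indicator A (X' \<omega>) * cos (\<Theta>' \<omega> + c) \<partial>M'"
  have sum: "?p + ?q c = ?p' + ?q' c" for c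
    using M.integral_indicator_cos[of \<Theta> X A c] M'.integral_indicator_cos[of \<Theta>' X' A c] eq[of c] by simp
  \<comment> \<open>The cosine changes sign between c = 0 and c = pi, so adding the two instances of
    \<open>sum\<close> isolates the unweighted mass.\<close>
  have pi: "?q pi = - ?q 0" "?q' pi = - ?q' 0" by simp_all
  have "?p = ?p'" using sum[of 0] sum[of pi] unfolding pi by linarith
  then have "?q c = ?q' c" for c using sum[of c] by simp
  then show ?thesis
    by (simp only: M.integral_indicator_iexp M'.integral_indicator_iexp \<open>\<Theta> \<in> _\<close> \<open>\<Theta>' \<in> _\<close> \<open>X \<in> _\<close> \<open>X' \<in> _\<close> \<open>A \<in> _\<close>)
qed

lemma (in finite_measure) measure_indicator_density:
  assumes [measurable]: "Z \<in> borel_measurable M" "A \<in> sets borel" "S \<in> sets M"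
  shows "emeasure (density M (\<lambda>\<omega>. ennreal (indicator A (Z \<omega>)))) S
    = emeasure M {\<omega>\<in>space M. Z \<omega> \<in> A \<and> \<omega> \<in> S}"
proof -
  have "emeasure (density M (\<lambda>\<omega>. ennreal (indicator A (Z \<omega>)))) S
      = (\<integral>\<^sup>+\<omega>. ennreal (indicator A (Z \<omega>)) * indicator S \<omega> \<partial>M)"
    by (rule emeasure_density) auto
  also have "\<dots> = (\<integral>\<^sup>+\<omega>. indicator {\<omega>\<in>space M. Z \<omega> \<in> A \<and> \<omega> \<in> S} \<omega> \<partial>M)"
    by (intro nn_integral_cong) (auto simp: indicator_def)
  also have "\<dots> = emeasure M {\<omega>\<in>space M. Z \<omega> \<in> A \<and> \<omega> \<in> S}"
    by (rule nn_integral_indicator) auto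
  finally show ?thesis .
qed

text \<open>Exponentials are replaced by indicators one coordinate at a time: restricting the
  measures to the event for \<open>j\<close> preserves the hypothesis on the other coordinates.
  Restriction loses mass, hence the induction runs over all finite measures.\<close>

lemma measure_rectangle_eq_of_char_eq:
  fixes X :: "'i \<Rightarrow> 'a \<Rightarrow> real" and X' :: "'i \<Rightarrow> 'b \<Rightarrow> real"
  assumes "finite I" "finite_measure M" "finite_measure M'"
    and "\<And>i. i \<in> I \<Longrightarrow> X i \<in> borel_measurable M" "\<And>i. i \<in> I \<Longrightarrow> X' i \<in> borel_measurable M'"
    and "\<And>u. (\<integral>\<omega>. iexp (\<Sum>i\<in>I. u i * X i \<omega>) \<partial>M) = (\<integral>\<omega>. iexp (\<Sum>i\<in>I. u i * X' i \<omega>) \<partial>M')"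
    and "\<And>i. i \<in> I \<Longrightarrow> A i \<in> sets borel"
  shows "measure M {\<omega>\<in>space M. \<forall>i\<in>I. X i \<omega> \<in> A i} = measure M' {\<omega>\<in>space M'. \<forall>i\<in>I. X' i \<omega> \<in> A i}"
  using assms
proof (induction I arbitrary: M M' rule: finite_induct)
  case empty
  from empty.prems(5)[of undefined] show ?case by simp
next
  case (insert j I)
  interpret M: finite_measure M by fact
  interpret M': finite_measure M' by fact
  note [measurable] = insert.prems(3,4,6)
  let ?N = "density M (\<lambda>\<omega>. ennreal (indicator (A j) (X j \<omega>)))"
  let ?N' = "density M' (\<lambda>\<omega>. ennreal (indicator (A j) (X' j \<omega>)))"
  have fin: "finite_measure ?N" "finite_measure ?N'"
    by (auto intro!: finite_measureI simp: M.measure_indicator_density M'.measure_indicator_density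
        M.emeasure_eq_measure M'.emeasure_eq_measure insert.prems)
  have IH: "measure ?N {\<omega>\<in>space ?N. \<forall>i\<in>I. X i \<omega> \<in> A i} = measure ?N' {\<omega>\<in>space ?N'. \<forall>i\<in>I. X' i \<omega> \<in> A i}"
  proof (rule insert.IH)
    fix u :: "'i \<Rightarrow> real"
    have "(\<integral>\<omega>. iexp (\<Sum>i\<in>I. u i * X i \<omega>) \<partial>?N) = (\<integral>\<omega>. indicator (A j) (X j \<omega>) *\<^sub>R iexp (\<Sum>i\<in>I. u i * X i \<omega>) \<partial>M)"
      by (subst integral_density) auto
    also have "\<dots> = (\<integral>\<omega>. indicator (A j) (X' j \<omega>) *\<^sub>R iexp (\<Sum>i\<in>I. u i * X' i \<omega>) \<partial>M')"
    proof (rule integral_indicator_iexp_eqI)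
      fix a b :: real
      let ?u = "\<lambda>i. if i = j then a else b * u i"
      have "(\<Sum>i\<in>insert j I. ?u i * Y i) = a * Y j + b * (\<Sum>i\<in>I. u i * Y i)" for Y
      proof -
        have "(\<Sum>i\<in>I. ?u i * Y i) = (\<Sum>i\<in>I. b * (u i * Y i))"
          using insert.hyps by (intro sum.cong) auto
        then show ?thesis using insert.hyps by (simp add: sum_distrib_left)
      qed
      then show "(\<integral>\<omega>. iexp (a * X j \<omega> + b * (\<Sum>i\<in>I. u i * X i \<omega>)) \<partial>M)
          = (\<integral>\<omega>. iexp (a * X' j \<omega> + b * (\<Sum>i\<in>I. u i * X' i \<omega>)) \<partial>M')"
        using insert.prems(5)[of ?u] by simp
    qed (use insert.prems in auto)
    also have "\<dots> = (\<integral>\<omega>. iexp (\<Sum>i\<in>I. u i * X' i \<omega>) \<partial>?N')"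
      by (subst integral_density) auto
    finally show "(\<integral>\<omega>. iexp (\<Sum>i\<in>I. u i * X i \<omega>) \<partial>?N) = (\<integral>\<omega>. iexp (\<Sum>i\<in>I. u i * X' i \<omega>) \<partial>?N')" .
  qed (use fin in auto)
  have m1: "measure ?N {\<omega>\<in>space ?N. \<forall>i\<in>I. X i \<omega> \<in> A i} = measure M {\<omega>\<in>space M. \<forall>i\<in>insert j I. X i \<omega> \<in> A i}"
    unfolding measure_def space_density
    by (subst M.measure_indicator_density)
       (use insert.hyps insert.prems in \<open>auto intro!: arg_cong[where f="\<lambda>S. enn2real (emeasure M S)"]\<close>)
  have m2: "measure ?N' {\<omega>\<in>space ?N'. \<forall>i\<in>I. X' i \<omega> \<in> A i} = measure M' {\<omega>\<in>space M'. \<forall>i\<in>insert j I. X' i \<omega> \<in> A i}"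
    unfolding measure_def space_density
    by (subst M'.measure_indicator_density)
       (use insert.hyps insert.prems in \<open>auto intro!: arg_cong[where f="\<lambda>S. enn2real (emeasure M' S)"]\<close>)
  show ?case using IH m1 m2 by simp
qed

lemma joint_distr_eq_of_char_eq:
  fixes X :: "'i \<Rightarrow> 'a \<Rightarrow> real" and X' :: "'i \<Rightarrow> 'b \<Rightarrow> real"
  assumes I: "finite I" and fin: "finite_measure M" "finite_measure M'"
    and X: "\<And>i. i \<in> I \<Longrightarrow> X i \<in> borel_measurable M"
    and X': "\<And>i. i \<in> I \<Longrightarrow> X' i \<in> borel_measurable M'"
    and char: "\<And>u. (\<integral>\<omega>. iexp (\<Sum>i\<in>I. u i * X i \<omega>) \<partial>M) = (\<integral>\<omega>. iexp (\<Sum>i\<in>I. u i * X' i \<omega>) \<partial>M')"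
  shows "distr M (PiM I (\<lambda>_. borel)) (\<lambda>\<omega>. \<lambda>i\<in>I. X i \<omega>) = distr M' (PiM I (\<lambda>_. borel)) (\<lambda>\<omega>. \<lambda>i\<in>I. X' i \<omega>)"
proof -
  interpret M: finite_measure M by fact
  interpret M': finite_measure M' by fact
  have [measurable]: "(\<lambda>\<omega>. \<lambda>i\<in>I. X i \<omega>) \<in> measurable M (PiM I (\<lambda>_. borel))"
      "(\<lambda>\<omega>. \<lambda>i\<in>I. X' i \<omega>) \<in> measurable M' (PiM I (\<lambda>_. borel))"
    using X X' by (auto intro!: measurable_restrict)
  show ?thesis
  proof (rule measure_eqI_PiM_finite[OF I, where A="\<lambda>_. Pi\<^sub>E I (\<lambda>_. UNIV)"])
    fix A :: "'i \<Rightarrow> real set" assume A: "\<And>i. i \<in> I \<Longrightarrow> A i \<in> sets borel"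
    have 1: "(\<lambda>\<omega>. \<lambda>i\<in>I. X i \<omega>) -` Pi\<^sub>E I A \<inter> space M = {\<omega>\<in>space M. \<forall>i\<in>I. X i \<omega> \<in> A i}"
         and 2: "(\<lambda>\<omega>. \<lambda>i\<in>I. X' i \<omega>) -` Pi\<^sub>E I A \<inter> space M' = {\<omega>\<in>space M'. \<forall>i\<in>I. X' i \<omega> \<in> A i}"
      by (auto simp: PiE_iff)
    show "emeasure (distr M (PiM I (\<lambda>_. borel)) (\<lambda>\<omega>. \<lambda>i\<in>I. X i \<omega>)) (Pi\<^sub>E I A)
        = emeasure (distr M' (PiM I (\<lambda>_. borel)) (\<lambda>\<omega>. \<lambda>i\<in>I. X' i \<omega>)) (Pi\<^sub>E I A)"
      using A I measure_rectangle_eq_of_char_eq[OF I fin X X' char, of A]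
      by (subst (1 2) emeasure_distr) (auto intro!: sets_PiM_I_finite simp: 1 2 M.emeasure_eq_measure M'.emeasure_eq_measure)
  next
    show "range (\<lambda>_. Pi\<^sub>E I (\<lambda>_. UNIV :: real set)) \<subseteq> prod_algebra I (\<lambda>_. borel)"
      using I by (auto intro!: prod_algebraI_finite)
    show "emeasure (distr M (PiM I (\<lambda>_. borel)) (\<lambda>\<omega>. \<lambda>i\<in>I. X i \<omega>)) (Pi\<^sub>E I (\<lambda>_. UNIV)) \<noteq> \<infinity>"
      unfolding infinity_ennreal_def by (intro finite_measure.emeasure_finite M.finite_measure_distr) measurable
  qed (use I in \<open>auto simp: space_PiM\<close>)
qed

subsection \<open>Gaussian vectors and integration by parts\<close>

text \<open>Arguments are total functions, so that lines \<open>x + e * v\<close> can be written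
  without restriction to \<open>T\<close>; the second clause makes values outside \<open>T\<close>
  irrelevant. Polynomial growth is stable under products and integrable under every Gaussian
  vector.\<close>

definition tame :: "'t set \<Rightarrow> (('t \<Rightarrow> real) \<Rightarrow> real) \<Rightarrow> bool" where
  "tame T f \<longleftrightarrow> f \<in> borel_measurable (PiM T (\<lambda>_. borel)) \<and> (\<forall>x. f (restrict x T) = f x) \<and>
     (\<exists>B p. \<forall>x. \<bar>f x\<bar> \<le> B * (1 + (\<Sum>t\<in>T. \<bar>x t\<bar>)) ^ p)"

lemma tameE:
  assumes "tame T f"
  obtains B p where "B \<ge> 0" "\<And>x. \<bar>f x\<bar> \<le> B * (1 + (\<Sum>t\<in>T. \<bar>x t\<bar>)) ^ p"
proof -
  obtain B p where B: "\<And>x. \<bar>f x\<bar> \<le> B * (1 + (\<Sum>t\<in>T. \<bar>x t\<bar>)) ^ p"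
    using assms unfolding tame_def by blast
  moreover have "B \<ge> 0" using B[of "\<lambda>_. 0"] by simp
  ultimately show ?thesis using that by blast
qed

lemma tame_const [intro, simp]: "tame T (\<lambda>_. c)"
  unfolding tame_def
  by (intro conjI exI[of _ "\<bar>c\<bar>"] exI[of _ 0]) auto

lemma tame_component [intro]:
  assumes "t \<in> T" "finite T"
  shows "tame T (\<lambda>x. x t)"
proof -
  have "\<bar>x t\<bar> \<le> 1 * (1 + (\<Sum>t\<in>T. \<bar>x t\<bar>)) ^ 1" for x :: "'a \<Rightarrow> real"
    using member_le_sum[of t T "\<lambda>t. \<bar>x t\<bar>"] assms by simp
  then show ?thesis using assms unfolding tame_def by (intro conjI exI[of _ 1] allI) auto
qed

lemma tame_mult [intro]:
  assumes "tame T f" "tame T g"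
  shows "tame T (\<lambda>x. f x * g x)"
proof -
  obtain B p where B: "B \<ge> 0" "\<And>x. \<bar>f x\<bar> \<le> B * (1 + (\<Sum>t\<in>T. \<bar>x t\<bar>)) ^ p"
    using tameE[OF assms(1)] by blast
  obtain C q where C: "C \<ge> 0" "\<And>x. \<bar>g x\<bar> \<le> C * (1 + (\<Sum>t\<in>T. \<bar>x t\<bar>)) ^ q"
    using tameE[OF assms(2)] by blast
  have "\<bar>f x * g x\<bar> \<le> (B * C) * (1 + (\<Sum>t\<in>T. \<bar>x t\<bar>)) ^ (p + q)" for x
    using mult_mono[OF B(2)[of x] C(2)[of x]] B(1)
    by (simp add: abs_mult power_add mult_ac sum_nonneg)
  then show ?thesis using assms unfolding tame_def by auto
qed

lemma tame_add [intro]: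
  assumes "tame T f" "tame T g"
  shows "tame T (\<lambda>x. f x + g x)"
proof -
  obtain B p where B: "B \<ge> 0" "\<And>x. \<bar>f x\<bar> \<le> B * (1 + (\<Sum>t\<in>T. \<bar>x t\<bar>)) ^ p"
    using tameE[OF assms(1)] by blast
  obtain C q where C: "C \<ge> 0" "\<And>x. \<bar>g x\<bar> \<le> C * (1 + (\<Sum>t\<in>T. \<bar>x t\<bar>)) ^ q"
    using tameE[OF assms(2)] by blast
  have "\<bar>f x + g x\<bar> \<le> (B + C) * (1 + (\<Sum>t\<in>T. \<bar>x t\<bar>)) ^ (p + q)" for x
  proof -
    let ?S = "1 + (\<Sum>t\<in>T. \<bar>x t\<bar>)"
    have S: "?S \<ge> 1" by (simp add: sum_nonneg)
    have "\<bar>f x + g x\<bar> \<le> B * ?S ^ p + C * ?S ^ q"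
      using B(2)[of x] C(2)[of x] by linarith
    also have "\<dots> \<le> B * ?S ^ (p + q) + C * ?S ^ (p + q)"
      by (intro add_mono mult_left_mono power_increasing S B C) auto
    finally show ?thesis by (simp add: distrib_right)
  qed
  then show ?thesis using assms unfolding tame_def by auto
qed

lemma tame_minus [intro]: "tame T f \<Longrightarrow> tame T (\<lambda>x. - f x)"
  using tame_mult[of T "\<lambda>_. -1" f] by simp

lemma tame_diff [intro]: "tame T f \<Longrightarrow> tame T g \<Longrightarrow> tame T (\<lambda>x. f x - g x)"
  using tame_add[of T f "\<lambda>x. - g x"] by auto

lemma tame_sum [intro]: "(\<And>i. i \<in> I \<Longrightarrow> tame T (f i)) \<Longrightarrow> tame T (\<lambda>x. \<Sum>i\<in>I. f i x)"
  by (induction I rule: infinite_finite_induct) auto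

lemma tame_bounded:
  assumes "f \<in> borel_measurable (PiM T (\<lambda>_. borel))" "\<And>x. f (restrict x T) = f x" "tame T g"
    and "\<And>x. \<bar>f x\<bar> \<le> \<bar>g x\<bar>"
  shows "tame T f"
proof -
  obtain B p where "B \<ge> 0" "\<And>x. \<bar>g x\<bar> \<le> B * (1 + (\<Sum>t\<in>T. \<bar>x t\<bar>)) ^ p"
    using tameE[OF assms(3)] by blast
  then have "\<And>x. \<bar>f x\<bar> \<le> B * (1 + (\<Sum>t\<in>T. \<bar>x t\<bar>)) ^ p"
    using assms(4) order_trans by blast
  then show ?thesis using assms unfolding tame_def by blast
qed

lemma sum_delta_left:
  fixes c :: real and f :: "'t \<Rightarrow> real"
  assumes "finite T" "t \<in> T"
  shows "(\<Sum>s\<in>T. (if s = t then c else 0) * f s) = c * f t"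
  using assms by (simp add: if_distrib[where f="\<lambda>c. c * _"] sum.delta cong: if_cong)

text \<open>Fixing the law by its characteristic function admits singular \<open>K\<close>. That
  \<open>K\<close> is positive semidefinite is then a consequence: a characteristic function has
  modulus at most 1.\<close>

locale gaussian_vector = prob_space P for P :: "'w measure" +
  fixes T :: "'t set" and K :: "'t \<Rightarrow> 't \<Rightarrow> real" and X :: "'t \<Rightarrow> 'w \<Rightarrow> real"
  assumes finite_index: "finite T"
    and measurable_X: "\<And>t. t \<in> T \<Longrightarrow> X t \<in> borel_measurable P"
    and K_sym: "\<And>s t. s \<in> T \<Longrightarrow> t \<in> T \<Longrightarrow> K s t = K t s"
    and char_X: "\<And>u. (\<integral>\<omega>. iexp (\<Sum>t\<in>T. u t * X t \<omega>) \<partial>P)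
                   = of_real (exp (- (\<Sum>s\<in>T. \<Sum>t\<in>T. u s * u t * K s t) / 2))"
begin

lemma measurable_restrict_X [measurable]:
  "(\<lambda>\<omega>. restrict (\<lambda>t. X t \<omega>) T) \<in> measurable P (PiM T (\<lambda>_. borel))"
  using measurable_X by (auto intro!: measurable_restrict)

lemma measurable_tame:
  assumes "tame T f"
  shows "(\<lambda>\<omega>. f (\<lambda>t. X t \<omega>)) \<in> borel_measurable P"
proof -
  have [measurable]: "f \<in> borel_measurable (PiM T (\<lambda>_. borel))" using assms by (simp add: tame_def)
  have "(\<lambda>\<omega>. f (restrict (\<lambda>t. X t \<omega>) T)) \<in> borel_measurable P" by measurable
  moreover have "f (restrict (\<lambda>t. X t \<omega>) T) = f (\<lambda>t. X t \<omega>)" for \<omega>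
    using assms unfolding tame_def by blast
  ultimately show ?thesis by simp
qed

lemma K_nonneg: "0 \<le> (\<Sum>s\<in>T. \<Sum>t\<in>T. u s * u t * K s t)"
proof -
  have "norm (\<integral>\<omega>. iexp (\<Sum>t\<in>T. u t * X t \<omega>) \<partial>P) \<le> (\<integral>\<omega>. norm (iexp (\<Sum>t\<in>T. u t * X t \<omega>)) \<partial>P)"
    by (rule integral_norm_bound)
  then have "exp (- (\<Sum>s\<in>T. \<Sum>t\<in>T. u s * u t * K s t) / 2) \<le> 1"
    unfolding char_X by (simp add: prob_space)
  then show ?thesis by simp
qed

lemma quadratic_single:
  assumes "t \<in> T"
  shows "(\<Sum>r\<in>T. \<Sum>s\<in>T. (if r = t then a else 0) * (if s = t then a else 0) * K r s) = a\<^sup>2 * K t t"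
proof -
  have "(\<Sum>r\<in>T. \<Sum>s\<in>T. (if r = t then a else 0) * (if s = t then a else 0) * K r s)
      = (\<Sum>r\<in>T. (if r = t then a else 0) * (\<Sum>s\<in>T. (if s = t then a else 0) * K r s))"
    by (simp add: sum_distrib_left mult.assoc)
  also have "\<dots> = a\<^sup>2 * K t t"
    using assms finite_index by (simp add: sum_delta_left power2_eq_square)
  finally show ?thesis .
qed

lemma K_diag_nonneg: "t \<in> T \<Longrightarrow> 0 \<le> K t t"
  using K_nonneg[of "\<lambda>s. if s = t then 1 else 0"] by (simp only: quadratic_single) simp

lemma char_single:
  assumes "t \<in> T"
  shows "(\<integral>\<omega>. iexp (a * X t \<omega>) \<partial>P) = of_real (exp (- (a\<^sup>2 * K t t) / 2))"
  using char_X[of "\<lambda>s. if s = t then a else 0"] assms finite_index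
  by (simp only: quadratic_single sum_delta_left)

lemma distr_X:
  assumes t: "t \<in> T"
  shows "distr P borel (X t) = centered_normal (sqrt (K t t))"
proof (rule Levy_uniqueness)
  have [measurable]: "X t \<in> borel_measurable P" by (rule measurable_X[OF t])
  show "real_distribution (distr P borel (X t))" by (rule real_distribution_distr) simp
  interpret N: prob_space std_normal_distribution by (rule prob_space_normal_density) simp
  show "real_distribution (centered_normal (sqrt (K t t)))"
    by (subst centered_normal_eq_distr) (auto intro!: N.real_distribution_distr K_diag_nonneg t)
  show "char (distr P borel (X t)) = char (centered_normal (sqrt (K t t)))"
  proof
    fix a
    have "char (distr P borel (X t)) a = (\<integral>\<omega>. iexp (a * X t \<omega>) \<partial>P)"
      unfolding char_def by (subst integral_distr) auto
    then show "char (distr P borel (X t)) a = char (centered_normal (sqrt (K t t))) a"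
      using K_diag_nonneg[OF t] by (simp only: char_single[OF t] char_centered_normal real_sqrt_ge_zero)
         (simp add: mult_ac flip: exp_of_real)
  qed
qed

lemma integrable_power_abs:
  assumes t: "t \<in> T"
  shows "integrable P (\<lambda>\<omega>. \<bar>X t \<omega>\<bar> ^ p)"
proof -
  have [measurable]: "X t \<in> borel_measurable P" by (rule measurable_X[OF t])
  have "integrable std_normal_distribution (\<lambda>x. \<bar>sqrt (K t t)\<bar> ^ p * \<bar>x\<bar> ^ p)"
    by (intro integrable_mult_right) (auto simp: integrable_density integrable_std_normal_moment_abs)
  then have "integrable (distr std_normal_distribution borel (\<lambda>x. sqrt (K t t) * x)) (\<lambda>x. \<bar>x\<bar> ^ p)"
    by (subst integrable_distr_eq) (auto simp: abs_mult power_mult_distrib)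
  then have "integrable (distr P borel (X t)) (\<lambda>x. \<bar>x\<bar> ^ p)"
    using K_diag_nonneg[OF t] by (simp add: distr_X[OF t] centered_normal_eq_distr)
  then show ?thesis by (subst (asm) integrable_distr_eq) auto
qed

lemma integrable_tame:
  assumes "tame T f"
  shows "integrable P (\<lambda>\<omega>. f (\<lambda>t. X t \<omega>))"
proof -
  obtain B p where B: "B \<ge> 0" "\<And>x. \<bar>f x\<bar> \<le> B * (1 + (\<Sum>t\<in>T. \<bar>x t\<bar>)) ^ p"
    using tameE[OF assms] by blast
  let ?n = "real (card T + 1)"
  have le: "(1 + (\<Sum>t\<in>T. \<bar>x t\<bar>)) ^ p \<le> ?n ^ p * (1 + (\<Sum>t\<in>T. \<bar>x t\<bar> ^ p))" for x :: "'t \<Rightarrow> real"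
  proof -
    \<comment> \<open>Replacing every summand by the largest one turns the power of a sum into a sum
      of powers, whose integrals are one-dimensional moments.\<close>
    define m where "m = Max (insert 1 ((\<lambda>t. \<bar>x t\<bar>) ` T))"
    have m: "\<bar>x t\<bar> \<le> m" if "t \<in> T" for t
      unfolding m_def using that finite_index by auto
    have m1: "1 \<le> m" unfolding m_def using finite_index by auto
    have "m \<in> insert 1 ((\<lambda>t. \<bar>x t\<bar>) ` T)"
      unfolding m_def using finite_index by (intro Max_in) auto
    then have mp: "m ^ p \<le> 1 + (\<Sum>t\<in>T. \<bar>x t\<bar> ^ p)"
    proof
      assume "m = 1" then show ?thesis by (simp add: sum_nonneg)
    next
      assume "m \<in> (\<lambda>t. \<bar>x t\<bar>) ` T"
      then obtain t where "t \<in> T" "m = \<bar>x t\<bar>" by auto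
      then show ?thesis
        using member_le_sum[of t T "\<lambda>t. \<bar>x t\<bar> ^ p"] finite_index by simp
    qed
    have "1 + (\<Sum>t\<in>T. \<bar>x t\<bar>) \<le> m + (\<Sum>t\<in>T. m)"
      by (intro add_mono m1 sum_mono m)
    then have "(1 + (\<Sum>t\<in>T. \<bar>x t\<bar>)) ^ p \<le> (?n * m) ^ p"
      by (intro power_mono) (auto simp: algebra_simps sum_nonneg)
    also have "\<dots> = ?n ^ p * m ^ p" by (rule power_mult_distrib)
    also have "\<dots> \<le> ?n ^ p * (1 + (\<Sum>t\<in>T. \<bar>x t\<bar> ^ p))"
      by (intro mult_left_mono mp) auto
    finally show ?thesis .
  qed
  have "integrable P (\<lambda>\<omega>. B * (?n ^ p * (1 + (\<Sum>t\<in>T. \<bar>X t \<omega>\<bar> ^ p))))"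
    by (intro integrable_mult_right Bochner_Integration.integrable_add
        Bochner_Integration.integrable_sum integrable_power_abs) auto
  then show ?thesis
  proof (rule Bochner_Integration.integrable_bound)
    show "(\<lambda>\<omega>. f (\<lambda>t. X t \<omega>)) \<in> borel_measurable P" by (rule measurable_tame[OF assms])
    show "AE \<omega> in P. norm (f (\<lambda>t. X t \<omega>)) \<le> norm (B * (?n ^ p * (1 + (\<Sum>t\<in>T. \<bar>X t \<omega>\<bar> ^ p))))"
    proof (intro AE_I2)
      fix \<omega>
      have "\<bar>f (\<lambda>t. X t \<omega>)\<bar> \<le> B * (1 + (\<Sum>t\<in>T. \<bar>X t \<omega>\<bar>)) ^ p" by (rule B)
      also have "\<dots> \<le> B * (?n ^ p * (1 + (\<Sum>t\<in>T. \<bar>X t \<omega>\<bar> ^ p)))"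
        by (intro mult_left_mono le B)
      finally show "norm (f (\<lambda>t. X t \<omega>)) \<le> norm (B * (?n ^ p * (1 + (\<Sum>t\<in>T. \<bar>X t \<omega>\<bar> ^ p))))"
        by simp
    qed
  qed
qed

text \<open>The variance of \<open>X s + b * X t\<close> is affine in \<open>b\<close> with slope
  \<open>2 * K t s\<close> when \<open>X t\<close> has variance 0, and it can stay nonnegative only
  if the slope vanishes.\<close>

lemma null_row:
  assumes t: "t \<in> T" "K t t = 0" and s: "s \<in> T"
  shows "K t s = 0"
proof (cases "s = t")
  case False
  have *: "0 \<le> K s s + 2 * b * K t s" for b
  proof -
    let ?u = "\<lambda>r. (if r = s then 1 else 0) + (if r = t then b else 0)"
    have in1: "(\<Sum>q\<in>T. ?u q * K r q) = K r s + b * K r t" for r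
      using s t finite_index by (simp only: distrib_right sum.distrib sum_delta_left mult_1)
    have "(\<Sum>r\<in>T. \<Sum>q\<in>T. ?u r * ?u q * K r q) = (\<Sum>r\<in>T. ?u r * (\<Sum>q\<in>T. ?u q * K r q))"
      by (simp only: sum_distrib_left mult.assoc)
    also have "\<dots> = (K s s + b * K s t) + b * (K t s + b * K t t)"
      unfolding in1 using s t finite_index by (simp only: distrib_right sum.distrib sum_delta_left) simp
    also have "\<dots> = K s s + 2 * b * K t s" using t K_sym[OF s t(1)] by (simp add: algebra_simps)
    finally show ?thesis using K_nonneg[of ?u] by simp
  qed
  show ?thesis
  proof (rule ccontr)
    assume "K t s \<noteq> 0"
    \<comment> \<open>This choice of \<open>b\<close> gives the affine expression the value
      -1.\<close>
    then have "2 * (- (K s s + 1) / (2 * K t s)) * K t s = - (K s s + 1)" by simp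
    then show False using *[of "- (K s s + 1) / (2 * K t s)"] by linarith
  qed
qed (use t in simp)

lemma AE_zero:
  assumes t: "t \<in> T" "K t t = 0"
  shows "AE \<omega> in P. X t \<omega> = 0"
proof -
  have [measurable]: "X t \<in> borel_measurable P" by (rule measurable_X[OF t(1)])
  have "distr P borel (X t) = return borel 0"
    using distr_X[OF t(1)] t(2) by (simp add: centered_normal_def)
  then have "AE x in distr P borel (X t). x = 0" by (simp only:) (simp add: AE_return)
  then show ?thesis by (subst (asm) AE_distr_iff) auto
qed

text \<open>Splitting off the component \<open>X t\<close>: the remainder \<open>X s - K t s / K t t * X t\<close> is
  independent of \<open>X t\<close>, so it may be taken from a second copy of the probability space.\<close>

lemma distr_independent_copy:
  assumes t: "t \<in> T" "K t t \<noteq> 0"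
  defines "v \<equiv> \<lambda>s. K t s / K t t"
  defines "Z \<equiv> \<lambda>\<omega>1 \<omega>2 i. case i of None \<Rightarrow> X t \<omega>1 | Some s \<Rightarrow> X s \<omega>2 - v s * X t \<omega>2"
  defines "I \<equiv> insert None (Some ` T)"
  shows "distr P (PiM I (\<lambda>_. borel)) (\<lambda>\<omega>. \<lambda>i\<in>I. Z \<omega> \<omega> i)
       = distr (P \<Otimes>\<^sub>M P) (PiM I (\<lambda>_. borel)) (\<lambda>\<omega>. \<lambda>i\<in>I. Z (fst \<omega>) (snd \<omega>) i)"
proof (rule joint_distr_eq_of_char_eq)
  interpret PP: pair_prob_space P P ..
  note [measurable] = measurable_X
  have [measurable]: "X t \<in> borel_measurable P" by (rule measurable_X[OF t(1)])
  show "finite I" unfolding I_def using finite_index by simp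
  show "finite_measure P" "finite_measure (P \<Otimes>\<^sub>M P)" by unfold_locales
  show "(\<lambda>\<omega>. Z \<omega> \<omega> i) \<in> borel_measurable P" if "i \<in> I" for i
    using that unfolding I_def Z_def by (auto split: option.split)
  show "(\<lambda>\<omega>. Z (fst \<omega>) (snd \<omega>) i) \<in> borel_measurable (P \<Otimes>\<^sub>M P)" if "i \<in> I" for i
    using that unfolding I_def Z_def by (auto split: option.split)
  fix u :: "'t option \<Rightarrow> real"
  define a where "a = u None"
  \<comment> \<open>The multiples of \<open>X t\<close> subtracted in the remainders are collected
    at index \<open>t\<close>, which leaves a plain combination of the \<open>X s\<close>.\<close>
  define b where "b = (\<lambda>s. u (Some s) - (if s = t then \<Sum>r\<in>T. u (Some r) * v r else 0))"
  have sumI: "(\<Sum>i\<in>I. u i * Z \<omega>1 \<omega>2 i) = a * X t \<omega>1 + (\<Sum>s\<in>T. b s * X s \<omega>2)" for \<omega>1 \<omega>2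
  proof -
    have "(\<Sum>i\<in>I. u i * Z \<omega>1 \<omega>2 i) = a * X t \<omega>1 + (\<Sum>s\<in>T. u (Some s) * (X s \<omega>2 - v s * X t \<omega>2))"
      unfolding I_def using finite_index by (simp add: sum.reindex Z_def a_def)
    also have "(\<Sum>s\<in>T. u (Some s) * (X s \<omega>2 - v s * X t \<omega>2)) = (\<Sum>s\<in>T. b s * X s \<omega>2)"
      unfolding b_def left_diff_distrib sum_subtractf sum_delta_left[OF finite_index t(1)]
      by (simp add: right_diff_distrib sum_subtractf sum_distrib_right mult.assoc)
    finally show ?thesis .
  qed
  define Q where "Q = (\<Sum>s\<in>T. \<Sum>r\<in>T. b s * b r * K s r)"
  \<comment> \<open>The remainders are uncorrelated with \<open>X t\<close>. The mixed terms in the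
    exponent therefore vanish and the characteristic function factors.\<close>
  have orth: "(\<Sum>s\<in>T. b s * K t s) = 0"
    unfolding b_def left_diff_distrib sum_subtractf sum_delta_left[OF finite_index t(1)]
    using t(2) by (simp add: v_def sum_distrib_right)
  have orth': "(\<Sum>s\<in>T. b s * K s t) = 0"
    using orth K_sym[OF _ t(1)] by (simp cong: sum.cong)
  let ?w = "\<lambda>s. (if s = t then a else 0) + b s"
  have "(\<Sum>s\<in>T. \<Sum>r\<in>T. ?w s * ?w r * K s r) = (\<Sum>s\<in>T. ?w s * (\<Sum>r\<in>T. ?w r * K s r))"
    by (simp only: sum_distrib_left mult.assoc)
  also have "\<dots> = (\<Sum>s\<in>T. ?w s * (a * K s t + (\<Sum>r\<in>T. b r * K s r)))"
    by (simp only: distrib_right sum.distrib sum_delta_left[OF finite_index t(1)])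
  also have "\<dots> = a * (a * K t t + (\<Sum>r\<in>T. b r * K t r)) + (\<Sum>s\<in>T. b s * (a * K s t + (\<Sum>r\<in>T. b r * K s r)))"
    by (simp only: distrib_right[of _ "b _"] sum.distrib sum_delta_left[OF finite_index t(1)])
  also have "(\<Sum>s\<in>T. b s * (a * K s t + (\<Sum>r\<in>T. b r * K s r))) = a * (\<Sum>s\<in>T. b s * K s t) + Q"
    by (simp add: distrib_left sum.distrib sum_distrib_left Q_def mult_ac)
  finally have Qw: "(\<Sum>s\<in>T. \<Sum>r\<in>T. ?w s * ?w r * K s r) = a\<^sup>2 * K t t + Q"
    by (simp add: orth orth' power2_eq_square)
  have "(\<integral>\<omega>. iexp (\<Sum>i\<in>I. u i * Z \<omega> \<omega> i) \<partial>P) = (\<integral>\<omega>. iexp (\<Sum>s\<in>T. ?w s * X s \<omega>) \<partial>P)"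
    unfolding sumI distrib_right sum.distrib sum_delta_left[OF finite_index t(1)] ..
  also have "\<dots> = of_real (exp (- (a\<^sup>2 * K t t + Q) / 2))"
    by (simp only: char_X Qw)
  also have "\<dots> = of_real (exp (- (a\<^sup>2 * K t t) / 2)) * of_real (exp (- Q / 2))"
    by (simp add: diff_divide_distrib flip: exp_add of_real_mult)
  also have "\<dots> = (\<integral>\<omega>. iexp (a * X t \<omega>) \<partial>P) * (\<integral>\<omega>. iexp (\<Sum>s\<in>T. b s * X s \<omega>) \<partial>P)"
    by (simp only: char_single[OF t(1)] char_X Q_def)
  also have "\<dots> = (\<integral>\<omega>1. (\<integral>\<omega>2. iexp (a * X t \<omega>1) * iexp (\<Sum>s\<in>T. b s * X s \<omega>2) \<partial>P) \<partial>P)"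
    by (simp only: integral_mult_right_zero integral_mult_left_zero)
  also have "\<dots> = (\<integral>\<omega>1. (\<integral>\<omega>2. iexp (\<Sum>i\<in>I. u i * Z (fst (\<omega>1,\<omega>2)) (snd (\<omega>1,\<omega>2)) i) \<partial>P) \<partial>P)"
    by (intro Bochner_Integration.integral_cong refl)
       (simp only: sumI fst_conv snd_conv of_real_add distrib_left exp_add)
  also have "\<dots> = (\<integral>\<omega>. iexp (\<Sum>i\<in>I. u i * Z (fst \<omega>) (snd \<omega>) i) \<partial>(P \<Otimes>\<^sub>M P))"
  proof (rule PP.integral_fst')
    show "integrable (P \<Otimes>\<^sub>M P) (\<lambda>\<omega>. iexp (\<Sum>i\<in>I. u i * Z (fst \<omega>) (snd \<omega>) i))"
      unfolding sumI by (rule PP.P.integrable_iexp) measurable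
  qed
  finally show "(\<integral>\<omega>. iexp (\<Sum>i\<in>I. u i * Z \<omega> \<omega> i) \<partial>P)
      = (\<integral>\<omega>. iexp (\<Sum>i\<in>I. u i * Z (fst \<omega>) (snd \<omega>) i) \<partial>(P \<Otimes>\<^sub>M P))" .
qed

text \<open>The joint law is unchanged when \<open>X t\<close> and the remainders come from
  different copies, so Fubini leaves an inner integral over a single standard normal variable. The
  cases m = 1 and m = 0 serve the two sides of integration by parts.\<close>

lemma integral_split:
  assumes t: "t \<in> T" "K t t \<noteq> 0"
    and f: "tame T f"
  defines "v \<equiv> \<lambda>s. K t s / K t t"
  shows "(\<integral>\<omega>. X t \<omega> ^ m * f (\<lambda>s. X s \<omega>) \<partial>P)
    = (\<integral>\<omega>2. (\<integral>x. (sqrt (K t t) * x) ^ m * f (\<lambda>s. (X s \<omega>2 - v s * X t \<omega>2) + v s * (sqrt (K t t) * x)) \<partial>std_normal_distribution) \<partial>P)"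
proof -
  interpret PP: pair_prob_space P P ..
  interpret PP: pair_sigma_finite P P ..
  note [measurable] = measurable_X
  have [measurable]: "X t \<in> borel_measurable P" by (rule measurable_X[OF t(1)])
  have [measurable]: "f \<in> borel_measurable (PiM T (\<lambda>_. borel))" using f by (simp add: tame_def)
  have fr: "f (restrict x T) = f x" for x using f by (simp add: tame_def)
  define Z where "Z = (\<lambda>\<omega>1 \<omega>2 i. case i of None \<Rightarrow> X t \<omega>1 | Some s \<Rightarrow> X s \<omega>2 - v s * X t \<omega>2)"
  define I where "I = insert None (Some ` T)"
  define G where "G = (\<lambda>z. z None ^ m * f (\<lambda>s\<in>T. z (Some s) + v s * z None))"
  have eq: "distr P (PiM I (\<lambda>_. borel)) (\<lambda>\<omega>. \<lambda>i\<in>I. Z \<omega> \<omega> i)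
       = distr (P \<Otimes>\<^sub>M P) (PiM I (\<lambda>_. borel)) (\<lambda>\<omega>. \<lambda>i\<in>I. Z (fst \<omega>) (snd \<omega>) i)"
    unfolding Z_def I_def v_def by (rule distr_independent_copy[OF t])
  have Zm: "(\<lambda>\<omega>. Z \<omega> \<omega> i) \<in> borel_measurable P" 
    "(\<lambda>\<omega>. Z (fst \<omega>) (snd \<omega>) i) \<in> borel_measurable (P \<Otimes>\<^sub>M P)" if "i \<in> I" for i
    using that unfolding I_def Z_def by (auto split: option.split)
  have [measurable]: "(\<lambda>\<omega>. \<lambda>i\<in>I. Z \<omega> \<omega> i) \<in> measurable P (PiM I (\<lambda>_. borel))"
    "(\<lambda>\<omega>. \<lambda>i\<in>I. Z (fst \<omega>) (snd \<omega>) i) \<in> measurable (P \<Otimes>\<^sub>M P) (PiM I (\<lambda>_. borel))"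
    using Zm by (auto intro!: measurable_restrict)
  have [measurable]: "G \<in> borel_measurable (PiM I (\<lambda>_. borel))"
    unfolding G_def I_def by measurable
  have Gz: "G (\<lambda>i\<in>I. Z \<omega>1 \<omega>2 i) = X t \<omega>1 ^ m * f (\<lambda>s. (X s \<omega>2 - v s * X t \<omega>2) + v s * X t \<omega>1)" for \<omega>1 \<omega>2
  proof -
    have "(\<lambda>s\<in>T. (\<lambda>i\<in>I. Z \<omega>1 \<omega>2 i) (Some s) + v s * (\<lambda>i\<in>I. Z \<omega>1 \<omega>2 i) None)
        = restrict (\<lambda>s. (X s \<omega>2 - v s * X t \<omega>2) + v s * X t \<omega>1) T"
      by (auto simp: I_def Z_def restrict_def)
    then show ?thesis unfolding G_def by (simp only: fr) (simp add: I_def Z_def)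
  qed
  have intP: "integrable P (\<lambda>\<omega>. X t \<omega> ^ m * f (\<lambda>s. X s \<omega>))"
  proof -
    have "tame T (\<lambda>x. x t ^ m)"
      by (induction m) (auto intro!: tame_mult tame_component t finite_index)
    from integrable_tame[OF tame_mult[OF this f]] show ?thesis .
  qed
  have "integrable P (\<lambda>\<omega>. G (\<lambda>i\<in>I. Z \<omega> \<omega> i))"
    unfolding Gz using intP by simp
  then have "integrable (distr P (PiM I (\<lambda>_. borel)) (\<lambda>\<omega>. \<lambda>i\<in>I. Z \<omega> \<omega> i)) G"
    by (subst integrable_distr_eq) auto
  then have int2: "integrable (P \<Otimes>\<^sub>M P) (\<lambda>\<omega>. G (\<lambda>i\<in>I. Z (fst \<omega>) (snd \<omega>) i))"
    unfolding eq by (subst (asm) integrable_distr_eq) auto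
  have "(\<integral>\<omega>. X t \<omega> ^ m * f (\<lambda>s. X s \<omega>) \<partial>P) = (\<integral>\<omega>. G (\<lambda>i\<in>I. Z \<omega> \<omega> i) \<partial>P)"
    unfolding Gz by simp
  also have "\<dots> = (\<integral>z. G z \<partial>distr P (PiM I (\<lambda>_. borel)) (\<lambda>\<omega>. \<lambda>i\<in>I. Z \<omega> \<omega> i))"
    by (subst integral_distr) auto
  also have "\<dots> = (\<integral>\<omega>. G (\<lambda>i\<in>I. Z (fst \<omega>) (snd \<omega>) i) \<partial>(P \<Otimes>\<^sub>M P))"
    unfolding eq by (subst integral_distr) auto
  also have "\<dots> = (\<integral>\<omega>2. (\<integral>\<omega>1. G (\<lambda>i\<in>I. Z \<omega>1 \<omega>2 i) \<partial>P) \<partial>P)"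
    using PP.integral_snd[of "\<lambda>\<omega>1 \<omega>2. G (\<lambda>i\<in>I. Z \<omega>1 \<omega>2 i)"] int2 by (simp add: case_prod_beta')
  also have "\<dots> = (\<integral>\<omega>2. (\<integral>x. (sqrt (K t t) * x) ^ m * f (\<lambda>s. (X s \<omega>2 - v s * X t \<omega>2) + v s * (sqrt (K t t) * x)) \<partial>std_normal_distribution) \<partial>P)"
  proof (intro Bochner_Integration.integral_cong refl)
    fix \<omega>2
    define y where "y = (\<lambda>s. X s \<omega>2 - v s * X t \<omega>2)"
    have [measurable]: "(\<lambda>x. f (\<lambda>s. y s + v s * x)) \<in> borel_measurable borel"
    proof -
      have "(\<lambda>x. f (\<lambda>s\<in>T. y s + v s * x)) \<in> borel_measurable borel" by measurable
      then show ?thesis by (simp only: fr)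
    qed
    have "(\<integral>\<omega>1. G (\<lambda>i\<in>I. Z \<omega>1 \<omega>2 i) \<partial>P) = (\<integral>x. x ^ m * f (\<lambda>s. y s + v s * x) \<partial>distr P borel (X t))"
    proof -
      have "(\<integral>\<omega>1. G (\<lambda>i\<in>I. Z \<omega>1 \<omega>2 i) \<partial>P) = (\<integral>\<omega>1. X t \<omega>1 ^ m * f (\<lambda>s. y s + v s * X t \<omega>1) \<partial>P)"
        by (simp only: Gz y_def)
      then show ?thesis by (subst integral_distr) simp_all
    qed
    also have "\<dots> = (\<integral>x. (sqrt (K t t) * x) ^ m * f (\<lambda>s. y s + v s * (sqrt (K t t) * x)) \<partial>std_normal_distribution)"
      unfolding distr_X[OF t(1)] using K_diag_nonneg[OF t(1)] 
      by (subst centered_normal_eq_distr, simp, subst integral_distr) auto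
    finally show "(\<integral>\<omega>1. G (\<lambda>i\<in>I. Z \<omega>1 \<omega>2 i) \<partial>P)
        = (\<integral>x. (sqrt (K t t) * x) ^ m * f (\<lambda>s. (X s \<omega>2 - v s * X t \<omega>2) + v s * (sqrt (K t t) * x)) \<partial>std_normal_distribution)"
      by (simp add: y_def)
  qed
  finally show ?thesis .
qed

text \<open>With the remainder frozen, the vector moves along a line in the direction of the row
  \<open>K t\<close> as the standard normal variable varies, and the one-dimensional formula
  applies. Only the derivative of \<open>f\<close> in that direction enters.\<close>

lemma integration_by_parts:
  assumes t: "t \<in> T" and f: "tame T f" and Df: "tame T Df"
    and deriv: "\<And>x. ((\<lambda>e. f (\<lambda>s. x s + e * K t s)) has_real_derivative Df x) (at 0)"
    and cont: "\<And>x. isCont (\<lambda>e. Df (\<lambda>s. x s + e * K t s)) 0"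
  shows "(\<integral>\<omega>. X t \<omega> * f (\<lambda>s. X s \<omega>) \<partial>P) = (\<integral>\<omega>. Df (\<lambda>s. X s \<omega>) \<partial>P)"
proof (cases "K t t = 0")
  case True
  \<comment> \<open>The direction of differentiation, the row \<open>K t\<close>, is zero on
    \<open>T\<close>.\<close>
  have "Df x = 0" for x
  proof -
    have "f (\<lambda>s. x s + e * K t s) = f x" for e
    proof -
      have "restrict (\<lambda>s. x s + e * K t s) T = restrict x T"
        using null_row[OF t True] by auto
      then have "f (restrict (\<lambda>s. x s + e * K t s) T) = f (restrict x T)" by simp
      then show ?thesis using f by (simp add: tame_def)
    qed
    then have "((\<lambda>e. f x) has_real_derivative Df x) (at 0)" using deriv[of x] by simp
    then show ?thesis using DERIV_unique DERIV_const by blast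
  qed
  moreover have "(\<integral>\<omega>. X t \<omega> * f (\<lambda>s. X s \<omega>) \<partial>P) = (\<integral>\<omega>. 0 \<partial>P)"
    using AE_zero[OF t True] measurable_X[OF t] measurable_tame[OF f]
    by (intro integral_cong_AE) auto
  ultimately show ?thesis by simp
next
  case False
  define \<sigma> where "\<sigma> = sqrt (K t t)"
  have \<sigma>: "\<sigma> * \<sigma> = K t t" using K_diag_nonneg[OF t] by (simp add: \<sigma>_def)
  define v where "v = (\<lambda>s. K t s / K t t)"
  \<comment> \<open>A step e of the standard normal variable is a step \<sigma> e / K t t along the
    row. Together with the factor \<sigma> in front of \<open>f\<close> this gives \<sigma>^2 / K t
    t = 1.\<close>
  have shift: "(\<lambda>s. y s + v s * (\<sigma> * (x + e))) = (\<lambda>s. (y s + v s * (\<sigma> * x)) + (\<sigma> * e / K t t) * K t s)" for y x e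
    by (rule ext) (simp add: v_def add_divide_distrib ring_distribs mult_ac)
  have ibp: "(\<integral>x. (\<sigma> * x) ^ 1 * f (\<lambda>s. y s + v s * (\<sigma> * x)) \<partial>std_normal_distribution)
      = (\<integral>x. (\<sigma> * x) ^ 0 * Df (\<lambda>s. y s + v s * (\<sigma> * x)) \<partial>std_normal_distribution)" for y
  proof -
    have bound: "\<exists>B p. \<forall>x. \<bar>g (\<lambda>s. y s + v s * (\<sigma> * x))\<bar> \<le> B * (1 + \<bar>x\<bar>) ^ p" if g: "tame T g" for g
    proof -
      obtain B p where B: "B \<ge> 0" "\<And>x. \<bar>g x\<bar> \<le> B * (1 + (\<Sum>t\<in>T. \<bar>x t\<bar>)) ^ p"
        using tameE[OF g] by blast
      define c where "c = 1 + (\<Sum>s\<in>T. \<bar>y s\<bar> + \<bar>v s * \<sigma>\<bar>)"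
      have "\<bar>g (\<lambda>s. y s + v s * (\<sigma> * x))\<bar> \<le> (B * c ^ p) * (1 + \<bar>x\<bar>) ^ p" for x
      proof -
        have "(\<Sum>s\<in>T. \<bar>y s + v s * (\<sigma> * x)\<bar>) \<le> (\<Sum>s\<in>T. (\<bar>y s\<bar> + \<bar>v s * \<sigma>\<bar>) * (1 + \<bar>x\<bar>))"
        proof (rule sum_mono)
          fix s
          have "\<bar>y s + v s * (\<sigma> * x)\<bar> \<le> \<bar>y s\<bar> + \<bar>v s * \<sigma>\<bar> * \<bar>x\<bar>"
            by (rule order_trans[OF abs_triangle_ineq]) (simp add: abs_mult mult_ac)
          also have "\<dots> \<le> (\<bar>y s\<bar> + \<bar>v s * \<sigma>\<bar>) * (1 + \<bar>x\<bar>)"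
            by (simp add: algebra_simps)
          finally show "\<bar>y s + v s * (\<sigma> * x)\<bar> \<le> (\<bar>y s\<bar> + \<bar>v s * \<sigma>\<bar>) * (1 + \<bar>x\<bar>)" .
        qed
        then have "1 + (\<Sum>s\<in>T. \<bar>y s + v s * (\<sigma> * x)\<bar>) \<le> c * (1 + \<bar>x\<bar>)"
          unfolding c_def by (simp add: distrib_right sum_distrib_right)
        then have "(1 + (\<Sum>s\<in>T. \<bar>y s + v s * (\<sigma> * x)\<bar>)) ^ p \<le> (c * (1 + \<bar>x\<bar>)) ^ p"
          by (intro power_mono) (auto simp: sum_nonneg)
        then have "B * (1 + (\<Sum>s\<in>T. \<bar>y s + v s * (\<sigma> * x)\<bar>)) ^ p \<le> B * (c * (1 + \<bar>x\<bar>)) ^ p"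
          by (intro mult_left_mono B)
        then show ?thesis using B(2)[of "\<lambda>s. y s + v s * (\<sigma> * x)"]
          by (simp add: power_mult_distrib mult.assoc)
      qed
      then show ?thesis by blast
    qed
    obtain B p where B: "\<bar>f (\<lambda>s. y s + v s * (\<sigma> * x))\<bar> \<le> B * (1 + \<bar>x\<bar>) ^ p" for x
      using bound[OF f] by blast
    obtain C q where C: "\<bar>Df (\<lambda>s. y s + v s * (\<sigma> * x))\<bar> \<le> C * (1 + \<bar>x\<bar>) ^ q" for x
      using bound[OF Df] by blast
    have "(\<integral>x. x * (\<sigma> * f (\<lambda>s. y s + v s * (\<sigma> * x))) \<partial>std_normal_distribution)
      = (\<integral>x. Df (\<lambda>s. y s + v s * (\<sigma> * x)) \<partial>std_normal_distribution)"
    proof (rule std_normal_integration_by_parts[where B="\<bar>\<sigma>\<bar> * B" and p=p and B'=C and p'=q])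
      fix x
      have "((\<lambda>e. f (\<lambda>s. (y s + v s * (\<sigma> * x)) + (\<sigma> * e / K t t) * K t s)) has_real_derivative
          Df (\<lambda>s. y s + v s * (\<sigma> * x)) * (\<sigma> / K t t)) (at 0)"
        by (rule DERIV_chain'[where f="\<lambda>e. \<sigma> * e / K t t" and g="\<lambda>e. f (\<lambda>s. (y s + v s * (\<sigma> * x)) + e * K t s)"])
           (use False in \<open>auto intro!: derivative_eq_intros deriv\<close>)
      then have "((\<lambda>e. f (\<lambda>s. y s + v s * (\<sigma> * (x + e)))) has_real_derivative
          Df (\<lambda>s. y s + v s * (\<sigma> * x)) * (\<sigma> / K t t)) (at 0)"
        by (simp only: shift)
      then have "((\<lambda>x. f (\<lambda>s. y s + v s * (\<sigma> * x))) has_real_derivative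
          Df (\<lambda>s. y s + v s * (\<sigma> * x)) * (\<sigma> / K t t)) (at (0 + x))"
        by (subst DERIV_shift) (simp add: add.commute)
      moreover have "\<sigma> * (D * (\<sigma> / K t t)) = D" for D
      proof -
        have "\<sigma> * (D * (\<sigma> / K t t)) = D * ((\<sigma> * \<sigma>) / K t t)" by simp
        then show ?thesis using False by (simp only: \<sigma>) simp
      qed
      ultimately
      show "((\<lambda>x. \<sigma> * f (\<lambda>s. y s + v s * (\<sigma> * x))) has_real_derivative
          Df (\<lambda>s. y s + v s * (\<sigma> * x))) (at x)"
        using DERIV_cmult[of _ _ x UNIV \<sigma>] by fastforce
      have "isCont (\<lambda>e. Df (\<lambda>s. (y s + v s * (\<sigma> * x)) + (\<sigma> * e / K t t) * K t s)) 0"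
        by (rule isCont_o2[where f="\<lambda>e. \<sigma> * e / K t t" and g="\<lambda>e. Df (\<lambda>s. (y s + v s * (\<sigma> * x)) + e * K t s)"])
           (use False in \<open>auto intro!: continuous_intros cont\<close>)
      then have "isCont (\<lambda>e. Df (\<lambda>s. y s + v s * (\<sigma> * (x + e)))) 0"
        by (simp only: shift)
      then show "isCont (\<lambda>x. Df (\<lambda>s. y s + v s * (\<sigma> * x))) x"
        by (simp add: isCont_def LIM_offset_zero_iff[of x])
      show "\<bar>\<sigma> * f (\<lambda>s. y s + v s * (\<sigma> * x))\<bar> \<le> \<bar>\<sigma>\<bar> * B * (1 + \<bar>x\<bar>) ^ p"
        using mult_left_mono[OF B[of x], of "\<bar>\<sigma>\<bar>"] by (simp add: abs_mult mult.assoc)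
      show "\<bar>Df (\<lambda>s. y s + v s * (\<sigma> * x))\<bar> \<le> C * (1 + \<bar>x\<bar>) ^ q" by (rule C)
    qed
    then show ?thesis by (simp add: mult_ac)
  qed
  have "(\<integral>\<omega>. X t \<omega> ^ 1 * f (\<lambda>s. X s \<omega>) \<partial>P) = (\<integral>\<omega>. X t \<omega> ^ 0 * Df (\<lambda>s. X s \<omega>) \<partial>P)"
    unfolding integral_split[OF t False f] integral_split[OF t False Df]
    by (simp only: ibp[unfolded v_def \<sigma>_def])
  then show ?thesis by simp
qed

lemma second_moment:
  assumes "a \<in> T" "b \<in> T"
  shows "(\<integral>\<omega>. X a \<omega> * X b \<omega> \<partial>P) = K a b"
proof -
  have "(\<integral>\<omega>. X a \<omega> * X b \<omega> \<partial>P) = (\<integral>\<omega>. K a b \<partial>P)"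
    by (rule integration_by_parts[where f="\<lambda>x. x b" and Df="\<lambda>_. K a b"])
       (use assms finite_index in \<open>auto intro!: derivative_eq_intros tame_component\<close>)
  then show ?thesis by (simp add: prob_space)
qed

text \<open>Isserlis' formula: one integration by parts in \<open>X a\<close> leaves three second
  moments, one for each partner of \<open>a\<close>.\<close>

lemma fourth_moment:
  assumes "a \<in> T" "b \<in> T" "c \<in> T" "d \<in> T"
  shows "(\<integral>\<omega>. X a \<omega> * X b \<omega> * (X c \<omega> * X d \<omega>) \<partial>P) = K a b * K c d + K a c * K b d + K a d * K b c"
proof -
  note [intro!] = tame_component[OF _ finite_index]
  have int: "integrable P (\<lambda>\<omega>. X r \<omega> * X s \<omega>)" if "r \<in> T" "s \<in> T" for r s
    using integrable_tame[OF tame_mult[OF tame_component tame_component]] that finite_index by blast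
  let ?D = "\<lambda>x. K a b * (x c * x d) + K a c * (x b * x d) + K a d * (x b * x c)"
  have "(\<integral>\<omega>. X a \<omega> * (X b \<omega> * (X c \<omega> * X d \<omega>)) \<partial>P) = (\<integral>\<omega>. ?D (\<lambda>s. X s \<omega>) \<partial>P)"
  proof (rule integration_by_parts[where f="\<lambda>x. x b * (x c * x d)" and Df="?D"])
    show "((\<lambda>e. (x b + e * K a b) * ((x c + e * K a c) * (x d + e * K a d))) has_real_derivative ?D x) (at 0)" for x
      by (auto intro!: derivative_eq_intros simp: algebra_simps)
    show "tame T ?D" using assms by (intro tame_add tame_mult tame_const) auto
  qed (use assms in \<open>auto intro!: continuous_intros\<close>)
  also have "\<dots> = K a b * K c d + K a c * K b d + K a d * K b c"
    using assms by (simp add: int second_moment)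
  finally show ?thesis by (simp only: mult.assoc)
qed

end

subsection \<open>Smoothing Lipschitz functions by soft minima\<close>

text \<open>McShane's formula presents a 1-Lipschitz function as the infimum of cones a_j + |x -
  w_j|. Here the tips are rounded off at scale \<delta> and the infimum over m cones becomes a
  log-sum-exp with sharpness \<beta>. The gradient \<open>h\<close> of \<open>g\<close> is a convex
  combination of the cone gradients \<open>n j\<close>, of norm at most 1, so the Lipschitz constant
  is kept exactly; \<open>H\<close> is the derivative of \<open>h\<close>.\<close>

locale softmin =
  fixes w :: "nat \<Rightarrow> 'a :: euclidean_space" and a :: "nat \<Rightarrow> real" and \<delta> \<beta> :: real and m :: nat
  assumes \<delta>: "\<delta> > 0" and \<beta>: "\<beta> > 0" and m: "m > 0"
begin

definition "\<rho> j x = sqrt (\<delta>\<^sup>2 + (x - w j) \<bullet> (x - w j))"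
definition "E j x = exp (- \<beta> * (a j + \<rho> j x))"
definition "n j x = (1 / \<rho> j x) *\<^sub>R (x - w j)"
definition "S x = (\<Sum>j<m. E j x)"
definition "g x = - ln (S x) / \<beta>"
definition "h x = (1 / S x) *\<^sub>R (\<Sum>j<m. E j x *\<^sub>R n j x)"
definition "dE j x v = - \<beta> * E j x * (n j x \<bullet> v)"
definition "dn j x v = (1 / \<rho> j x) *\<^sub>R v - ((n j x \<bullet> v) / \<rho> j x) *\<^sub>R n j x"
definition "dS x v = (\<Sum>j<m. dE j x v)"
definition "H x v = (1 / S x) *\<^sub>R (\<Sum>j<m. dE j x v *\<^sub>R n j x + E j x *\<^sub>R dn j x v)
    - (dS x v / (S x)\<^sup>2) *\<^sub>R (\<Sum>j<m. E j x *\<^sub>R n j x)"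

lemma \<rho>_arg_pos: "0 < \<delta>\<^sup>2 + (x - w j) \<bullet> (x - w j)"
  using \<delta> by (intro add_pos_nonneg) auto

lemma \<rho>_pos: "0 < \<rho> j x"
  unfolding \<rho>_def using \<rho>_arg_pos by simp

lemma \<rho>_ge_\<delta>: "\<delta> \<le> \<rho> j x"
  unfolding \<rho>_def using \<delta> by (intro real_le_rsqrt) auto

lemma norm_le_\<rho>: "norm (x - w j) \<le> \<rho> j x"
  unfolding \<rho>_def by (intro real_le_rsqrt) (auto simp: power2_norm_eq_inner)

lemma norm_n: "norm (n j x) \<le> 1"
  unfolding n_def using norm_le_\<rho>[of x j] \<rho>_pos[of j x] by (simp add: divide_simps)

lemma E_pos: "0 < E j x" by (simp add: E_def)

lemma S_pos: "0 < S x"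
  unfolding S_def using m by (intro sum_pos) (auto simp: E_pos lessThan_empty_iff)

lemma \<rho>_derivative: "(\<rho> j has_derivative (\<lambda>v. n j x \<bullet> v)) (at x)"
  unfolding \<rho>_def[abs_def]
  by (rule derivative_eq_intros refl \<rho>_arg_pos)+
     (auto simp: n_def \<rho>_def fun_eq_iff divide_simps inner_commute algebra_simps real_sqrt_eq_zero_cancel_iff 
       dest: sym[of _ 0])

lemma E_derivative: "(E j has_derivative dE j x) (at x)"
  unfolding E_def[abs_def] dE_def[abs_def]
  by (rule derivative_eq_intros \<rho>_derivative refl)+ (simp add: fun_eq_iff)

lemma S_derivative: "(S has_derivative dS x) (at x)"
  unfolding S_def[abs_def] dS_def[abs_def] by (intro derivative_intros E_derivative)

lemma n_derivative: "(n j has_derivative dn j x) (at x)"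
proof -
  have "\<rho> j x \<noteq> 0" using \<rho>_pos[of j x] by simp
  have "((\<lambda>x. (1 / \<rho> j x) *\<^sub>R (x - w j)) has_derivative dn j x) (at x)"
    by (rule derivative_eq_intros \<rho>_derivative refl \<open>\<rho> j x \<noteq> 0\<close>)+
       (use \<open>\<rho> j x \<noteq> 0\<close> in \<open>auto simp: dn_def n_def fun_eq_iff field_simps power2_eq_square\<close>)
  then show ?thesis by (simp add: n_def[abs_def])
qed

lemma g_derivative: "(g has_derivative (\<lambda>v. h x \<bullet> v)) (at x)"
proof -
  have "((\<lambda>x. - ln (S x) / \<beta>) has_derivative (\<lambda>v. - (dS x v / S x) / \<beta>)) (at x)"
    using S_pos[of x] \<beta> by (auto intro!: derivative_eq_intros S_derivative simp: fun_eq_iff divide_inverse)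
  moreover have "- (dS x v / S x) / \<beta> = h x \<bullet> v" for v
    using \<beta> by (simp add: dS_def dE_def h_def inner_sum_left sum_negf sum_distrib_left sum_divide_distrib mult_ac)
  ultimately show ?thesis by (simp add: g_def[abs_def])
qed

lemma norm_sum_E_n: "norm (\<Sum>j<m. E j x *\<^sub>R n j x) \<le> S x"
proof -
  have "norm (\<Sum>j<m. E j x *\<^sub>R n j x) \<le> (\<Sum>j<m. E j x * 1)"
    by (rule sum_norm_le) (use E_pos norm_n in \<open>auto simp: less_imp_le intro!: mult_left_le\<close>)
  then show ?thesis by (simp add: S_def)
qed

lemma norm_h: "norm (h x) \<le> 1"
  unfolding h_def using norm_sum_E_n[of x] S_pos[of x] by (simp add: divide_simps)

lemma h_derivative: "(h has_derivative H x) (at x)"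
proof -
  have S: "S x \<noteq> 0" using S_pos[of x] by simp
  have "((\<lambda>x. (1 / S x) *\<^sub>R (\<Sum>j<m. E j x *\<^sub>R n j x)) has_derivative
     (\<lambda>v. (1 / S x) *\<^sub>R (\<Sum>j<m. E j x *\<^sub>R dn j x v + dE j x v *\<^sub>R n j x) +
       (- (dS x v / (S x)\<^sup>2)) *\<^sub>R (\<Sum>j<m. E j x *\<^sub>R n j x))) (at x)"
  proof (rule has_derivative_scaleR)
    show "((\<lambda>x. 1 / S x) has_derivative (\<lambda>v. - (dS x v / (S x)\<^sup>2))) (at x)"
      using S by (auto intro!: derivative_eq_intros S_derivative simp: fun_eq_iff power2_eq_square)
    show "((\<lambda>x. \<Sum>j<m. E j x *\<^sub>R n j x) has_derivative (\<lambda>v. \<Sum>j<m. E j x *\<^sub>R dn j x v + dE j x v *\<^sub>R n j x)) (at x)"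
      by (intro has_derivative_sum has_derivative_scaleR E_derivative n_derivative)
  qed
  moreover have "(1 / S x) *\<^sub>R (\<Sum>j<m. E j x *\<^sub>R dn j x v + dE j x v *\<^sub>R n j x) +
       (- (dS x v / (S x)\<^sup>2)) *\<^sub>R (\<Sum>j<m. E j x *\<^sub>R n j x) = H x v" for v
    by (simp add: H_def add.commute)
  ultimately show ?thesis by (simp add: h_def[abs_def])
qed

lemma continuous_H: "continuous_on UNIV (\<lambda>x. H x v)"
proof -
  have "\<rho> j x \<noteq> 0" "S x \<noteq> 0" for j x using \<rho>_pos[of j x] S_pos[of x] by auto
  moreover have \<rho>: "continuous_on UNIV (\<rho> j)" for j
    unfolding \<rho>_def[abs_def] by (intro continuous_intros)
  moreover from this have E: "continuous_on UNIV (E j)" for j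
    unfolding E_def[abs_def] by (intro continuous_intros)
  moreover from this have "continuous_on UNIV S"
    unfolding S_def[abs_def] by (intro continuous_intros)
  ultimately show ?thesis
    unfolding H_def dS_def dn_def dE_def n_def
    by (intro continuous_intros) auto
qed

text \<open>The two terms with \<beta> come from differentiating the weights and their
  normalisation, those with 1/\<delta> from the curvature of the rounded cones.\<close>

lemma norm_H: "norm (H x v) \<le> (2 * \<beta> + 2 / \<delta>) * norm v"
proof -
  have S: "S x > 0" by (rule S_pos)
  have nv: "\<bar>n j x \<bullet> v\<bar> \<le> norm v" for j
    using Cauchy_Schwarz_ineq2[of "n j x" v] mult_right_mono[OF norm_n[of j x], of "norm v"] by simp
  have dE: "\<bar>dE j x v\<bar> \<le> \<beta> * norm v * E j x" for j
    unfolding dE_def using mult_left_mono[OF nv[of j], of "\<beta> * E j x"] \<beta> E_pos[of j x]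
    by (simp add: abs_mult mult_ac)
  have dn: "norm (dn j x v) \<le> 2 / \<delta> * norm v" for j
  proof -
    have "norm (dn j x v) \<le> norm v / \<rho> j x + \<bar>n j x \<bullet> v\<bar> / \<rho> j x * norm (n j x)"
      unfolding dn_def using \<rho>_pos[of j x] by (intro order_trans[OF norm_triangle_ineq4]) simp
    also have "\<dots> \<le> norm v / \<rho> j x + norm v / \<rho> j x * 1"
      using \<rho>_pos[of j x] norm_n[of j x] by (intro add_mono mult_mono divide_right_mono nv) auto
    also have "\<dots> \<le> norm v / \<delta> + norm v / \<delta>"
      using \<rho>_ge_\<delta>[of j x] \<delta> by (intro add_mono) (auto intro!: divide_left_mono mult_pos_pos \<rho>_pos)
    finally show ?thesis by simp
  qed
  have "norm (\<Sum>j<m. dE j x v *\<^sub>R n j x + E j x *\<^sub>R dn j x v) \<le> (\<Sum>j<m. (\<beta> * norm v + 2 / \<delta> * norm v) * E j x)"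
  proof (rule sum_norm_le)
    fix j
    have "norm (dE j x v *\<^sub>R n j x + E j x *\<^sub>R dn j x v) \<le> \<bar>dE j x v\<bar> * norm (n j x) + E j x * norm (dn j x v)"
      by (rule order_trans[OF norm_triangle_ineq]) (use E_pos[of j x] in simp)
    also have "\<dots> \<le> (\<beta> * norm v * E j x) * 1 + E j x * (2 / \<delta> * norm v)"
      using dE[of j] dn[of j] norm_n[of j x] E_pos[of j x] \<beta> by (intro add_mono mult_mono) auto
    finally show "norm (dE j x v *\<^sub>R n j x + E j x *\<^sub>R dn j x v) \<le> (\<beta> * norm v + 2 / \<delta> * norm v) * E j x"
      by (simp add: algebra_simps)
  qed
  also have "\<dots> = (\<beta> * norm v + 2 / \<delta> * norm v) * S x" by (simp add: S_def sum_distrib_left)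
  finally have 1: "norm (\<Sum>j<m. dE j x v *\<^sub>R n j x + E j x *\<^sub>R dn j x v) \<le> (\<beta> * norm v + 2 / \<delta> * norm v) * S x" .
  have "\<bar>dS x v\<bar> \<le> (\<Sum>j<m. \<beta> * norm v * E j x)"
    unfolding dS_def by (rule order_trans[OF sum_abs sum_mono]) (rule dE)
  then have 2: "\<bar>dS x v\<bar> \<le> \<beta> * norm v * S x" by (simp add: S_def sum_distrib_left)
  have "norm (H x v) \<le> (1 / S x) * norm (\<Sum>j<m. dE j x v *\<^sub>R n j x + E j x *\<^sub>R dn j x v)
      + (\<bar>dS x v\<bar> / (S x)\<^sup>2) * norm (\<Sum>j<m. E j x *\<^sub>R n j x)"
    unfolding H_def by (rule order_trans[OF norm_triangle_ineq4]) (use S in simp)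
  also have "\<dots> \<le> (1 / S x) * ((\<beta> * norm v + 2 / \<delta> * norm v) * S x)
      + (\<beta> * norm v * S x / (S x)\<^sup>2) * S x"
    using S \<beta> by (intro add_mono mult_mono divide_right_mono 1 2 norm_sum_E_n) auto
  also have "\<dots> = (2 * \<beta> + 2 / \<delta>) * norm v"
    using S by (simp add: power2_eq_square algebra_simps)
  finally show ?thesis .
qed

lemma g_le: "j < m \<Longrightarrow> g x \<le> a j + \<rho> j x"
proof -
  assume "j < m"
  then have "E j x \<le> S x" unfolding S_def by (intro member_le_sum) (auto simp: less_imp_le E_pos)
  then have "ln (E j x) \<le> ln (S x)" using E_pos[of j x] S_pos[of x] by simp
  then have "- ln (S x) \<le> \<beta> * (a j + \<rho> j x)" by (simp add: E_def)
  then show ?thesis using \<beta> by (simp add: g_def divide_simps mult_ac)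
qed

text \<open>Each of the m exponentials is at most exp (-\<beta> b), so their logarithm overshoots by
  at most ln m. With \<open>g_le\<close>, the soft minimum lies below the true minimum by at most
  \<open>ln m / \<beta>\<close>.\<close>

lemma g_ge:
  assumes "\<And>j. j < m \<Longrightarrow> b \<le> a j + \<rho> j x"
  shows "b - ln (real m) / \<beta> \<le> g x"
proof -
  have "S x \<le> (\<Sum>j<m. exp (- \<beta> * b))"
    unfolding S_def E_def using assms \<beta> by (intro sum_mono) auto
  then have "S x \<le> real m * exp (- \<beta> * b)" by simp
  then have "ln (S x) \<le> ln (real m * exp (- \<beta> * b))" using S_pos[of x] m by simp
  also have "\<dots> = ln (real m) - \<beta> * b" using m by (simp add: ln_mult)
  finally have "\<beta> * b - ln (real m) \<le> - ln (S x)" by simp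
  then have "(\<beta> * b - ln (real m)) / \<beta> \<le> - ln (S x) / \<beta>" using \<beta> by (intro divide_right_mono) auto
  then show ?thesis using \<beta> by (simp add: g_def diff_divide_distrib)
qed

end

text \<open>\<open>h\<close> is the gradient and \<open>H\<close> the Hessian as a linear map. The
  bound on \<open>H\<close> only secures integrability; its size enters no estimate.\<close>

definition C2_contraction :: "('a::euclidean_space \<Rightarrow> real) \<Rightarrow> ('a \<Rightarrow> 'a) \<Rightarrow> ('a \<Rightarrow> 'a \<Rightarrow> 'a) \<Rightarrow> bool" where
  "C2_contraction g h H \<longleftrightarrow>
     (\<forall>x. (g has_derivative (\<lambda>v. h x \<bullet> v)) (at x)) \<and> (\<forall>x. norm (h x) \<le> 1) \<and>
     (\<forall>x. (h has_derivative H x) (at x)) \<and> (\<forall>v. continuous_on UNIV (\<lambda>x. H x v)) \<and>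
     (\<exists>B. \<forall>x v. norm (H x v) \<le> B * norm v)"

lemma lipschitz_pointwise_limit_of_C2_contractions:
  fixes g :: "'a::euclidean_space \<Rightarrow> real"
  assumes g: "1-lipschitz_on UNIV g"
  obtains G h H where "\<And>m. C2_contraction (G m) (h m) (H m)" "\<And>x. (\<lambda>m. G m x) \<longlonglongrightarrow> g x"
proof -
  obtain D :: "'a set" where D: "countable D" "\<And>X. open X \<Longrightarrow> X \<noteq> {} \<Longrightarrow> \<exists>d\<in>D. d \<in> X"
    using countable_dense_setE by blast
  define w where "w = from_nat_into D"
  have "D \<noteq> {}" using D(2)[of UNIV] by auto
  have dense: "\<exists>j. norm (x - w j) < e" if "e > 0" for x e
  proof -
    obtain d where d: "d \<in> D" "d \<in> ball x e"
      using D(2)[OF open_ball, of x e] centre_in_ball[of x e] \<open>e > 0\<close> by blast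
    then obtain j where "w j = d" using from_nat_into_surj[OF D(1) d(1)] by (auto simp: w_def)
    with d show ?thesis by (auto simp: dist_norm)
  qed
  \<comment> \<open>The cones are centred at the first m + 1 points of the dense sequence; with
    \<delta> = 1/(m+1) and \<beta> = m + 1 both the rounding and the error ln (m+1) / \<beta> tend
    to 0.\<close>
  interpret softmin w "\<lambda>j. g (w j)" "1 / real (Suc m)" "real (Suc m)" "Suc m" for m
    by unfold_locales auto
  show ?thesis
  proof (rule that)
    show "C2_contraction (softmin.g w (\<lambda>j. g (w j)) (1 / real (Suc m)) (real (Suc m)) (Suc m))
       (softmin.h w (\<lambda>j. g (w j)) (1 / real (Suc m)) (real (Suc m)) (Suc m))
       (softmin.H w (\<lambda>j. g (w j)) (1 / real (Suc m)) (real (Suc m)) (Suc m))" for m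
      unfolding C2_contraction_def using g_derivative norm_h h_derivative continuous_H norm_H by blast
    fix x
    let ?G = "\<lambda>m. softmin.g w (\<lambda>j. g (w j)) (1 / real (Suc m)) (real (Suc m)) (Suc m) x"
    have lip: "\<bar>g x - g y\<bar> \<le> norm (x - y)" for x y
      using lipschitz_onD[OF g, of x y] by (simp add: dist_norm)
    \<comment> \<open>By the Lipschitz property all cones lie above \<open>g\<close>, so only the
      error of the soft minimum is lost.\<close>
    have lower: "g x - ln (real (Suc m)) / real (Suc m) \<le> ?G m" for m
    proof (rule g_ge)
      fix j
      show "g x \<le> g (w j) + softmin.\<rho> w (1 / real (Suc m)) j x"
        using lip[of x "w j"] norm_le_\<rho>[of x j m] by linarith
    qed
    have lim0: "(\<lambda>m. ln (real (Suc m)) / real (Suc m)) \<longlonglongrightarrow> 0" by real_asymp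
    show "?G \<longlonglongrightarrow> g x"
    proof (rule LIMSEQ_I)
      fix e :: real assume "e > 0"
      \<comment> \<open>For the upper bound a single nearby cone suffices. Its distance enters twice
        and the rounding once, which makes 3e/4 in total.\<close>
      then obtain j where j: "norm (x - w j) < e / 4" using dense[of "e/4" x] by auto
      obtain N where N: "\<And>m. m \<ge> N \<Longrightarrow> \<bar>ln (real (Suc m)) / real (Suc m)\<bar> < e"
        using LIMSEQ_D[OF lim0 \<open>e > 0\<close>] by auto
      have "(\<lambda>m. 1 / real (Suc m)) \<longlonglongrightarrow> 0" by real_asymp
      from LIMSEQ_D[OF this, of "e/4"] \<open>e > 0\<close>
      obtain N' where N': "\<And>m. m \<ge> N' \<Longrightarrow> 1 / real (Suc m) < e / 4" by auto
      show "\<exists>no. \<forall>m\<ge>no. norm (?G m - g x) < e"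
      proof (intro exI allI impI)
        fix m assume m: "m \<ge> max j (max N N')"
        let ?d = "1 / real (Suc m)"
        have "softmin.\<rho> w ?d j x \<le> ?d + norm (x - w j)"
          unfolding \<rho>_def[of m] by (intro real_le_lsqrt) (auto simp: power2_sum power2_norm_eq_inner add_increasing)
        then have "?G m \<le> g (w j) + (?d + norm (x - w j))"
          using g_le[of j m x] m by linarith
        moreover have "g (w j) \<le> g x + norm (x - w j)" using lip[of x "w j"] by linarith
        moreover have "?d < e / 4" "\<bar>ln (real (Suc m)) / real (Suc m)\<bar> < e"
          using N N' m by auto
        ultimately show "norm (?G m - g x) < e"
          using lower[of m] j unfolding real_norm_def abs_less_iff by linarith
      qed
    qed
  qed
qed

subsection \<open>Sums over cycles and coercive matrices\<close>

text \<open>Positive semidefiniteness is tested on the points 0 and k with coefficients (1, 1) and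
  (1, -1).\<close>

lemma covariance_function_abs_le:
  assumes "covariance_function r"
  shows "\<bar>r k\<bar> \<le> r 0"
proof -
  note cov = assms[unfolded covariance_function_def]
  note even = cov[THEN conjunct1, THEN spec] and pos = cov[THEN conjunct2]
  show ?thesis
  proof (cases "k = 0")
    case True
    then show ?thesis using pos[rule_format, of "{0}" "\<lambda>_. 1"] by simp
  next
    case False
    have "0 \<le> 2 * r 0 + 2 * r k"
      using pos[rule_format, of "{0, k}" "\<lambda>_. 1"] False even by simp
    moreover have "0 \<le> 2 * r 0 - 2 * r k"
      using pos[rule_format, of "{0, k}" "\<lambda>i. if i = 0 then 1 else -1"] False even by simp
    ultimately show ?thesis by (simp add: abs_le_iff)
  qed
qed

text \<open>The trace of the fourth power of the d by d matrix with entries |s(k - l)|.\<close>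

definition cycle_sum :: "(int \<Rightarrow> real) \<Rightarrow> nat \<Rightarrow> real" where
  "cycle_sum s d = (\<Sum>k=1..d. \<Sum>l=1..d. \<Sum>m=1..d. \<Sum>n=1..d.
     \<bar>s (int k - int l)\<bar> * \<bar>s (int l - int m)\<bar> * \<bar>s (int m - int n)\<bar> * \<bar>s (int n - int k)\<bar>)"

lemma sum4_rotate:
  fixes F :: "nat \<Rightarrow> nat \<Rightarrow> nat \<Rightarrow> nat \<Rightarrow> real"
  shows "(\<Sum>k\<in>D. \<Sum>l\<in>D. \<Sum>m\<in>D. \<Sum>n\<in>D. F k l m n) = (\<Sum>k\<in>D. \<Sum>l\<in>D. \<Sum>m\<in>D. \<Sum>n\<in>D. F n k l m)"
proof -
  have "(\<Sum>k\<in>D. \<Sum>l\<in>D. \<Sum>m\<in>D. \<Sum>n\<in>D. F n k l m) = (\<Sum>k\<in>D. \<Sum>l\<in>D. \<Sum>n\<in>D. \<Sum>m\<in>D. F n k l m)"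
    by (intro sum.cong refl sum.swap)
  also have "\<dots> = (\<Sum>k\<in>D. \<Sum>n\<in>D. \<Sum>l\<in>D. \<Sum>m\<in>D. F n k l m)"
    by (intro sum.cong refl sum.swap)
  also have "\<dots> = (\<Sum>n\<in>D. \<Sum>k\<in>D. \<Sum>l\<in>D. \<Sum>m\<in>D. F n k l m)"
    by (rule sum.swap)
  finally show ?thesis ..
qed

text \<open>Summing from the free end inwards, each of the three edges costs at most the total
  weight on [-d, d], because the differences met are distinct and lie there. The first vertex
  contributes the factor d.\<close>

lemma path_sum_le:
  fixes w :: "int \<Rightarrow> real"
  assumes w: "\<And>i. w i \<ge> 0"
  shows "(\<Sum>k=1..d. \<Sum>l=1..d. \<Sum>m=1..d. \<Sum>n=1..d. w (int k - int l) * w (int l - int m) * w (int m - int n))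
    \<le> real d * (\<Sum>i\<in>{- int d..int d}. w i) ^ 3"
proof -
  let ?W = "\<Sum>i\<in>{- int d..int d}. w i"
  have W: "?W \<ge> 0" by (intro sum_nonneg w)
  have row: "(\<Sum>n=1..d. w (int m - int n)) \<le> ?W" if "m \<in> {1..d}" for m
  proof -
    have inj: "inj_on (\<lambda>n. int m - int n) {1..d}" by (auto simp: inj_on_def)
    have "(\<Sum>n=1..d. w (int m - int n)) = (\<Sum>i\<in>(\<lambda>n. int m - int n) ` {1..d}. w i)"
      by (subst sum.reindex[OF inj]) (simp add: comp_def)
    also have "\<dots> \<le> ?W" using that by (intro sum_mono2 w) auto
    finally show ?thesis .
  qed
  have "(\<Sum>k=1..d. \<Sum>l=1..d. \<Sum>m=1..d. \<Sum>n=1..d. w (int k - int l) * w (int l - int m) * w (int m - int n))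
     = (\<Sum>k=1..d. \<Sum>l=1..d. w (int k - int l) * (\<Sum>m=1..d. w (int l - int m) * (\<Sum>n=1..d. w (int m - int n))))"
    by (simp add: sum_distrib_left mult.assoc)
  also have "\<dots> \<le> (\<Sum>k=1..d. \<Sum>l=1..d. w (int k - int l) * (\<Sum>m=1..d. w (int l - int m) * ?W))"
    by (intro sum_mono mult_left_mono row w)
  also have "\<dots> = (\<Sum>k=1..d. \<Sum>l=1..d. w (int k - int l) * ((\<Sum>m=1..d. w (int l - int m)) * ?W))"
    by (simp add: sum_distrib_right)
  also have "\<dots> \<le> (\<Sum>k=1..d. \<Sum>l=1..d. w (int k - int l) * (?W * ?W))"
    by (intro sum_mono mult_left_mono mult_right_mono row w W)
  also have "\<dots> = (\<Sum>k=1..d. (\<Sum>l=1..d. w (int k - int l)) * (?W * ?W))"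
    by (simp add: sum_distrib_right)
  also have "\<dots> \<le> (\<Sum>k=1..d. ?W * (?W * ?W))"
    by (intro sum_mono mult_right_mono row) (use W in auto)
  also have "\<dots> = real d * ?W ^ 3" by (simp add: power3_eq_cube)
  finally show ?thesis .
qed

lemma prod4_le:
  fixes a b c e :: real
  shows "a * b * c * e \<le> (a ^ 4 + b ^ 4 + c ^ 4 + e ^ 4) / 4"
proof -
  have "a * b * c * e \<le> ((a * b)\<^sup>2 + (c * e)\<^sup>2) / 2"
    using sum_squares_bound[of "a * b" "c * e"] by (simp add: mult_ac)
  moreover have "(x * y)\<^sup>2 \<le> (x ^ 4 + y ^ 4) / 2" for x y :: real
    using sum_squares_bound[of "x\<^sup>2" "y\<^sup>2"] by (simp add: power_mult_distrib)
  from this[of a b] this[of c e] have "((a * b)\<^sup>2 + (c * e)\<^sup>2) / 2 \<le> (a ^ 4 + b ^ 4 + c ^ 4 + e ^ 4) / 4"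
    by simp
  ultimately show ?thesis by linarith
qed

text \<open>Young's convolution inequality at exponent \<open>4/3\<close>, by hand: with \<open>q = \<bar>s\<bar>\<^sup>1\<^sup>/\<^sup>3\<close> the product over the
  four edges of the cycle is the product of the four products of \<open>q\<close> over three edges, to which
  AM-GM applies; fourth powers of the latter are path sums.\<close>

lemma cycle_sum_le:
  assumes even: "\<And>k. s (- k) = s k"
  shows "cycle_sum s d \<le> real d * (\<Sum>k\<in>{- int d..int d}. \<bar>s k\<bar> powr (4/3)) ^ 3"
proof -
  define q where "q = (\<lambda>k. \<bar>s k\<bar> powr (1/3))"
  define w where "w = (\<lambda>k. \<bar>s k\<bar> powr (4/3))"
  have q3: "q k ^ 3 = \<bar>s k\<bar>" and q4: "q k ^ 4 = w k" for k
    by (cases "s k = 0"; simp add: q_def w_def powr_powr flip: powr_numeral)+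
  have w: "w k \<ge> 0" for k by (simp add: w_def)
  define F where "F = (\<lambda>k l m n. w (int k - int l) * w (int l - int m) * w (int m - int n))"
  let ?Sum = "\<lambda>F. \<Sum>k=1..d. \<Sum>l=1..d. \<Sum>m=1..d. \<Sum>n=1..d. F k l m n :: real"
  have edge: "\<bar>s (int k - int l)\<bar> * \<bar>s (int l - int m)\<bar> * \<bar>s (int m - int n)\<bar> * \<bar>s (int n - int k)\<bar>
      \<le> (F k l m n + F l m n k + F m n k l + F n k l m) / 4" for k l m n
  proof -
    let ?a = "q (int k - int l)" and ?b = "q (int l - int m)" and ?c = "q (int m - int n)" and ?e = "q (int n - int k)"
    have "\<bar>s (int k - int l)\<bar> * \<bar>s (int l - int m)\<bar> * \<bar>s (int m - int n)\<bar> * \<bar>s (int n - int k)\<bar>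
        = (?a * ?b * ?c) * (?b * ?c * ?e) * (?c * ?e * ?a) * (?e * ?a * ?b)"
      by (simp only: q3[symmetric]) algebra
    also have "\<dots> \<le> ((?a * ?b * ?c) ^ 4 + (?b * ?c * ?e) ^ 4 + (?c * ?e * ?a) ^ 4 + (?e * ?a * ?b) ^ 4) / 4"
      by (rule prod4_le)
    finally show ?thesis by (simp add: power_mult_distrib q4 F_def)
  qed
  have path: "?Sum F \<le> real d * (\<Sum>k\<in>{- int d..int d}. w k) ^ 3"
    unfolding F_def by (rule path_sum_le[OF w])
  \<comment> \<open>Each of the four paths omits one edge of the cycle; they are cyclic relabellings
    of one another and have equal sums.\<close>
  have r1: "?Sum (\<lambda>k l m n. F n k l m) = ?Sum F"
    by (rule sum4_rotate[symmetric])
  have r2: "?Sum (\<lambda>k l m n. F m n k l) = ?Sum F"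
    using sum4_rotate[where D="{1..d}" and F="\<lambda>k l m n. F n k l m"] r1 by simp
  have r3: "?Sum (\<lambda>k l m n. F l m n k) = ?Sum F"
    using sum4_rotate[where D="{1..d}" and F="\<lambda>k l m n. F m n k l"] r2 by simp
  have "cycle_sum s d \<le> ?Sum (\<lambda>k l m n. (F k l m n + F l m n k + F m n k l + F n k l m) / 4)"
    unfolding cycle_sum_def by (intro sum_mono edge)
  also have "\<dots> = (?Sum F + ?Sum (\<lambda>k l m n. F l m n k) + ?Sum (\<lambda>k l m n. F m n k l) + ?Sum (\<lambda>k l m n. F n k l m)) / 4"
    by (simp add: sum.distrib sum_divide_distrib[symmetric])
  also have "\<dots> = ?Sum F" unfolding r1 r2 r3 by simp
  finally show ?thesis using path by (simp add: w_def)
qed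

section \<open>Hilbert-Schmidt norms and inversion of B to R B R for coercive R\<close>

lemma norm_matrix_eq: "(norm (A :: real^'n^'n))\<^sup>2 = (\<Sum>i\<in>UNIV. \<Sum>j\<in>UNIV. (A $ i $ j)\<^sup>2)"
  unfolding power2_norm_eq_inner inner_vec_def by (simp add: power2_eq_square)

lemma norm_matrix_transpose: "norm (transpose (A :: real^'n^'n)) = norm A"
proof -
  have "(norm (transpose A))\<^sup>2 = (norm A)\<^sup>2"
    unfolding norm_matrix_eq by (subst sum.swap) (simp add: transpose_def)
  then show ?thesis by simp
qed

locale coercive_matrix =
  fixes R :: "real^'n^'n" and c :: real
  assumes sym: "transpose R = R" and c: "c > 0"
    and coercive: "\<And>x. c * (x \<bullet> x) \<le> x \<bullet> (R *v x)"
begin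

lemma norm_mult_ge: "c * norm x \<le> norm (R *v x)"
proof (cases "x = 0")
  case False
  have "norm x * (c * norm x) = c * (x \<bullet> x)" by (simp add: dot_square_norm power2_eq_square)
  also have "\<dots> \<le> norm x * norm (R *v x)"
    by (rule order_trans[OF coercive norm_cauchy_schwarz])
  finally show ?thesis using False by simp
qed simp

text \<open>As \<open>R\<close> is symmetric, the rows of \<open>A ** R\<close> are the images under
  \<open>R\<close> of the rows of \<open>A\<close>, and the squared norm is additive over
  rows.\<close>

lemma norm_matrix_mult_right_ge:
  fixes A :: "real^'n^'n"
  shows "c * norm A \<le> norm (A ** R)"
proof -
  have row: "(A ** R) $ i = R *v (A $ i)" for i
  proof -
    have "R $ k $ j = transpose R $ j $ k" for j k by (simp add: transpose_def)
    then have Rs: "R $ k $ j = R $ j $ k" for j k unfolding sym .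
    show ?thesis
      unfolding matrix_matrix_mult_def matrix_vector_mult_def vec_eq_iff
      by (subst Rs) (simp add: mult.commute)
  qed
  have sq: "(norm B)\<^sup>2 = (\<Sum>i\<in>UNIV. (norm (B $ i))\<^sup>2)" for B :: "real^'n^'n"
    unfolding power2_norm_eq_inner by (rule inner_vec_def)
  have "(c * norm A)\<^sup>2 = (\<Sum>i\<in>UNIV. (c * norm (A $ i))\<^sup>2)"
    by (simp add: power_mult_distrib sq sum_distrib_left)
  also have "\<dots> \<le> (\<Sum>i\<in>UNIV. (norm (R *v (A $ i)))\<^sup>2)"
    using c by (intro sum_mono power_mono norm_mult_ge) auto
  also have "\<dots> = (norm (A ** R))\<^sup>2" by (simp add: sq row)
  finally show ?thesis by (rule power2_le_imp_le) simp
qed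

lemma norm_matrix_mult_left_ge:
  fixes A :: "real^'n^'n"
  shows "c * norm A \<le> norm (R ** A)"
proof -
  have "R ** A = transpose (transpose A ** R)"
    by (simp add: matrix_transpose_mul sym transpose_transpose)
  then show ?thesis using norm_matrix_mult_right_ge[of "transpose A"] by (simp add: norm_matrix_transpose)
qed

lemma invertible_R: "invertible R"
proof -
  have "inj ((*v) R)"
  proof (rule injI)
    fix x y assume "R *v x = R *v y"
    then have "R *v (x - y) = 0" by (simp add: matrix_vector_mult_diff_distrib)
    then have "norm (x - y) \<le> 0" using norm_mult_ge[of "x - y"] c by (simp add: mult_le_0_iff)
    then show "x = y" by simp
  qed
  then show ?thesis using invertible_left_inverse matrix_left_invertible_injective by blast
qed

text \<open>Solves R Y R = B for Y. Up to a scalar, this inverts the covariance of the matrix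
  entries on symmetric matrices.\<close>

definition sandwich_inv :: "real^'n^'n \<Rightarrow> real^'n^'n" where
  "sandwich_inv B = matrix_inv R ** B ** matrix_inv R"

lemma sandwich_inv: "R ** sandwich_inv B ** R = B"
proof -
  have inv: "R ** matrix_inv R = mat 1 \<and> matrix_inv R ** R = mat 1"
    unfolding matrix_inv_def
    by (rule someI_ex) (use invertible_R in \<open>simp add: invertible_def\<close>)
  have "R ** sandwich_inv B ** R = (R ** matrix_inv R) ** B ** (matrix_inv R ** R)"
    unfolding sandwich_inv_def by (simp only: matrix_mul_assoc)
  then show ?thesis using inv by simp
qed

lemma norm_sandwich_inv: "norm (sandwich_inv B) \<le> norm B / c\<^sup>2"
proof -
  have "c * (c * norm (sandwich_inv B)) \<le> c * norm (R ** sandwich_inv B)"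
    using c by (intro mult_left_mono norm_matrix_mult_left_ge) auto
  also have "\<dots> \<le> norm (R ** sandwich_inv B ** R)" by (rule norm_matrix_mult_right_ge)
  finally show ?thesis using c by (simp add: sandwich_inv power2_eq_square field_simps)
qed

lemma inner_sandwich_inv_le: "sandwich_inv B \<bullet> B \<le> (norm B)\<^sup>2 / c\<^sup>2"
proof -
  have "sandwich_inv B \<bullet> B \<le> norm (sandwich_inv B) * norm B" by (rule norm_cauchy_schwarz)
  also have "\<dots> \<le> norm B / c\<^sup>2 * norm B" by (intro mult_right_mono norm_sandwich_inv) auto
  finally show ?thesis by (simp add: power2_eq_square)
qed

end

text \<open>A Gershgorin bound: off the diagonal the absolute row sums are at most L - 1, which
  leaves 1 - (L - 1).\<close>

lemma coercive_of_row_sums: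
  fixes R :: "real^'n^'n"
  assumes sym: "\<And>i j. R $ i $ j = R $ j $ i" and diag: "\<And>i. R $ i $ i = 1"
    and rows: "\<And>i. (\<Sum>j\<in>UNIV. \<bar>R $ i $ j\<bar>) \<le> L"
  shows "(2 - L) * (x \<bullet> x) \<le> x \<bullet> (R *v x)"
proof -
  let ?t = "\<lambda>i j. x $ i * (R $ i $ j * x $ j) + \<bar>R $ i $ j\<bar> * ((x $ i)\<^sup>2 + (x $ j)\<^sup>2) / 2"
  have t: "0 \<le> ?t i j" for i j
  proof -
    have "\<bar>x $ i * x $ j\<bar> \<le> ((x $ i)\<^sup>2 + (x $ j)\<^sup>2) / 2"
      using sum_squares_bound[of "\<bar>x $ i\<bar>" "\<bar>x $ j\<bar>"] by (simp add: abs_mult)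
    then have "\<bar>R $ i $ j\<bar> * \<bar>x $ i * x $ j\<bar> \<le> \<bar>R $ i $ j\<bar> * (((x $ i)\<^sup>2 + (x $ j)\<^sup>2) / 2)"
      by (rule mult_left_mono) simp
    moreover have "- (x $ i * (R $ i $ j * x $ j)) \<le> \<bar>R $ i $ j\<bar> * \<bar>x $ i * x $ j\<bar>"
      by (rule order_trans[OF abs_ge_minus_self]) (simp add: abs_mult mult_ac)
    ultimately show ?thesis by simp
  qed
  have xx: "x \<bullet> x = (\<Sum>i\<in>UNIV. (x $ i)\<^sup>2)" by (simp add: inner_vec_def power2_eq_square)
  \<comment> \<open>All \<open>?t i j\<close> are nonnegative by AM-GM, so their sum dominates the
    diagonal part, where \<open>?t i i\<close> is twice the square of \<open>x $ i\<close>.\<close>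
  have "2 * (x \<bullet> x) = (\<Sum>i\<in>UNIV. ?t i i)"
    by (simp add: xx diag sum_distrib_left power2_eq_square)
  also have "\<dots> \<le> (\<Sum>i\<in>UNIV. \<Sum>j\<in>UNIV. ?t i j)"
    by (rule sum_mono) (rule member_le_sum[where f="\<lambda>j. ?t _ j"]; use t in auto)
  also have "\<dots> = x \<bullet> (R *v x) + (\<Sum>i\<in>UNIV. \<Sum>j\<in>UNIV. \<bar>R $ i $ j\<bar> * (x $ i)\<^sup>2) / 2 + (\<Sum>i\<in>UNIV. \<Sum>j\<in>UNIV. \<bar>R $ i $ j\<bar> * (x $ j)\<^sup>2) / 2"
    by (simp add: inner_vec_def matrix_vector_mult_def sum.distrib sum_distrib_left distrib_left add_divide_distrib sum_divide_distrib)
  also have "(\<Sum>i\<in>UNIV. \<Sum>j\<in>UNIV. \<bar>R $ i $ j\<bar> * (x $ j)\<^sup>2) = (\<Sum>i\<in>UNIV. \<Sum>j\<in>UNIV. \<bar>R $ i $ j\<bar> * (x $ i)\<^sup>2)"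
    by (subst sum.swap) (simp add: sym)
  also have "(\<Sum>i\<in>UNIV. \<Sum>j\<in>UNIV. \<bar>R $ i $ j\<bar> * (x $ i)\<^sup>2) \<le> (\<Sum>i\<in>UNIV. L * (x $ i)\<^sup>2)"
    unfolding sum_distrib_right[symmetric] by (intro sum_mono mult_right_mono rows) auto
  also have "\<dots> = L * (x \<bullet> x)" by (simp add: xx sum_distrib_left)
  finally show ?thesis by (simp add: left_diff_distrib)
qed

subsection \<open>The interpolation path\<close>

definition ent :: "real^'n^'n \<Rightarrow> 'n \<times> 'n \<Rightarrow> real" where
  "ent A q = A $ fst q $ snd q"

definition mat_of :: "('n \<times> 'n \<Rightarrow> real) \<Rightarrow> real^'n^'n" where
  "mat_of f = (\<chi> i j. f (i, j))"

definition unit_matrix :: "'n::finite \<times> 'n \<Rightarrow> real^'n^'n" where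
  "unit_matrix q = axis (fst q) (axis (snd q) 1)"

lemma ent_mat_of [simp]: "ent (mat_of f) q = f q"
  by (simp add: ent_def mat_of_def)

lemma ent_linear [simp]:
  "ent (A + B) q = ent A q + ent B q" "ent (A - B) q = ent A q - ent B q" "ent (c *\<^sub>R A) q = c * ent A q"
  by (simp_all add: ent_def)

lemma matrix_eqI: "(\<And>q. ent A q = ent B q) \<Longrightarrow> A = B"
  unfolding ent_def vec_eq_iff by (metis fst_conv snd_conv)

lemma sum_pairs: "(\<Sum>q\<in>(UNIV :: ('n::finite \<times> 'n) set). f q) = (\<Sum>i\<in>UNIV. \<Sum>j\<in>UNIV. f (i, j))"
  by (simp add: UNIV_Times_UNIV[symmetric] sum.cartesian_product del: UNIV_Times_UNIV)

lemma inner_matrix: "A \<bullet> B = (\<Sum>q\<in>UNIV. ent A q * ent B q)"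
  by (simp add: sum_pairs inner_vec_def ent_def)

lemma norm_matrix_ent: "(norm A)\<^sup>2 = (\<Sum>q\<in>UNIV. (ent A q)\<^sup>2)"
  unfolding power2_norm_eq_inner inner_matrix by (simp add: power2_eq_square)

lemma abs_ent_le_norm: "\<bar>ent A q\<bar> \<le> norm A"
  unfolding ent_def using Finite_Cartesian_Product.norm_nth_le[where x="A $ fst q" and i="snd q"] Finite_Cartesian_Product.norm_nth_le[where x=A and i="fst q"] by simp

lemma ent_unit_matrix: "ent (unit_matrix q) p = (if p = q then 1 else 0)"
  by (auto simp: ent_def unit_matrix_def axis_def prod_eq_iff)

lemma matrix_expansion:
  fixes A :: "real^'n^'n"
  shows "A = (\<Sum>q\<in>UNIV. ent A q *\<^sub>R unit_matrix q)"
proof (rule matrix_eqI)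
  fix p :: "'n \<times> 'n"
  have "ent (\<Sum>q\<in>S. f q) p = (\<Sum>q\<in>S. ent (f q) p)" for S :: "('n \<times> 'n) set" and f
    by (induction S rule: infinite_finite_induct) (auto simp: ent_def)
  then show "ent A p = ent (\<Sum>q\<in>UNIV. ent A q *\<^sub>R unit_matrix q) p"
    by (simp add: ent_unit_matrix if_distrib[where f="\<lambda>x. _ * x"] sum.delta cong: if_cong)
qed

lemma ent_continuous [continuous_intros]:
  "continuous F f \<Longrightarrow> continuous F (\<lambda>x. ent (f x) q)"
  "continuous_on S f \<Longrightarrow> continuous_on S (\<lambda>x. ent (f x) q)"
  unfolding ent_def by (auto intro!: continuous_intros)

lemma Basis_matrix:
  assumes "b \<in> (Basis :: (real^'n^'n) set)"
  obtains q where "\<And>A. A \<bullet> b = ent A q"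
proof -
  from assms obtain i j where "b = axis i (axis j 1)"
    by (auto simp: Basis_vec_def)
  then have "A \<bullet> b = ent A (i, j)" for A by (simp add: inner_axis ent_def)
  then show ?thesis using that by blast
qed

lemma borel_measurable_mat_of:
  fixes f :: "'n::finite \<times> 'n \<Rightarrow> 'a \<Rightarrow> real"
  assumes "\<And>q. f q \<in> borel_measurable M"
  shows "(\<lambda>x. mat_of (\<lambda>q. f q x)) \<in> borel_measurable M"
proof (rule borel_measurable_euclidean_space[THEN iffD2], rule ballI)
  fix b :: "real^'n^'n" assume "b \<in> Basis"
  then obtain q where "\<And>A. A \<bullet> b = ent A q" using Basis_matrix by blast
  then show "(\<lambda>x. mat_of (\<lambda>q. f q x) \<bullet> b) \<in> borel_measurable M" using assms by simp
qed

lemma has_derivative_mat_of: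
  fixes f :: "'n::finite \<times> 'n \<Rightarrow> real \<Rightarrow> real"
  assumes "\<And>q. (f q has_real_derivative f' q) (at x)"
  shows "((\<lambda>e. mat_of (\<lambda>q. f q e)) has_derivative (\<lambda>e. e *\<^sub>R mat_of f')) (at x)"
proof (subst has_derivative_componentwise_within, rule ballI)
  fix b :: "real^'n^'n" assume "b \<in> Basis"
  then obtain q where q: "\<And>A. A \<bullet> b = ent A q" using Basis_matrix by blast
  show "((\<lambda>e. mat_of (\<lambda>q. f q e) \<bullet> b) has_derivative (\<lambda>e. (e *\<^sub>R mat_of f') \<bullet> b)) (at x)"
    unfolding q ent_linear ent_mat_of using assms[of q]
    by (simp add: has_field_derivative_def mult.commute[of _ "f' q"])
qed

text \<open>\<open>Inl (i, k)\<close> indexes the variable \<open>X\<^sub>i\<^sub>k\<close>, and \<open>Inr (i, j)\<close> the entry \<open>G\<^sub>i\<^sub>j\<close>.\<close>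

type_synonym 'n index = "('n \<times> nat) + ('n \<times> 'n)"

definition index_set :: "nat \<Rightarrow> 'n index set" where
  "index_set d = Inl ` (UNIV \<times> {1..d}) \<union> range Inr"

text \<open>Covariance of the entries \<open>p\<close> and \<open>q\<close> of the Wishart matrix:
  one summand for each of the two pairings that join the factors of one entry to those of the
  other.\<close>

definition entry_cov :: "real^'n^'n \<Rightarrow> real \<Rightarrow> 'n \<times> 'n \<Rightarrow> 'n \<times> 'n \<Rightarrow> real" where
  "entry_cov R \<kappa> p q = \<kappa> * (ent R (fst p, fst q) * ent R (snd p, snd q) + ent R (fst p, snd q) * ent R (snd p, fst q))"

fun index_cov :: "real^'n^'n \<Rightarrow> (int \<Rightarrow> real) \<Rightarrow> real \<Rightarrow> 'n index \<Rightarrow> 'n index \<Rightarrow> real" where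
  "index_cov R s \<kappa> (Inl u) (Inl v) = ent R (fst u, fst v) * s (int (snd u) - int (snd v))"
| "index_cov R s \<kappa> (Inr p) (Inr q) = entry_cov R \<kappa> p q"
| "index_cov R s \<kappa> (Inl u) (Inr q) = 0"
| "index_cov R s \<kappa> (Inr p) (Inl v) = 0"

definition variance_factor :: "(int \<Rightarrow> real) \<Rightarrow> nat \<Rightarrow> real" where
  "variance_factor s d = (\<Sum>k=1..d. \<Sum>l=1..d. (s (int k - int l))\<^sup>2) / real d"

text \<open>\<open>R\<close> stands for the matrix of the r(i - j). Independence of the X-variables
  and the G-entries is encoded by the vanishing mixed blocks of \<open>index_cov\<close>.\<close>

locale wishart_setting =
  gaussian_vector P "index_set d" "index_cov R s (variance_factor s d)" X
  for P :: "'w measure" and d :: nat and R :: "real^'n^'n" and s :: "int \<Rightarrow> real" and X :: "'n index \<Rightarrow> 'w \<Rightarrow> real" +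
  assumes d: "d \<ge> 1" and s_0: "s 0 = 1" and s_even: "\<And>k. s (- k) = s k"
    and R_sym: "\<And>i j. ent R (i, j) = ent R (j, i)" and R_diag: "\<And>i. ent R (i, i) = 1"
begin

abbreviation "T \<equiv> index_set d :: 'n index set"
abbreviation "\<kappa> \<equiv> variance_factor s d"
abbreviation "K \<equiv> index_cov R s \<kappa>"

definition Wm :: "('n index \<Rightarrow> real) \<Rightarrow> real^'n^'n" where
  "Wm x = mat_of (\<lambda>q. 1 / sqrt (real d) * (\<Sum>k=1..d. x (Inl (fst q, k)) * x (Inl (snd q, k)) - ent R q))"

definition Gm :: "('n index \<Rightarrow> real) \<Rightarrow> real^'n^'n" where
  "Gm x = mat_of (\<lambda>q. x (Inr q))"

definition U :: "real \<Rightarrow> real \<Rightarrow> ('n index \<Rightarrow> real) \<Rightarrow> real^'n^'n" where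
  "U c \<sigma> x = c *\<^sub>R Wm x + \<sigma> *\<^sub>R Gm x"

text \<open>Row \<open>p\<close> of \<Theta>, arranged as a matrix in \<open>q\<close>. It arises by
  integrating by parts only in the first factor of each product in entry \<open>p\<close>, so the
  roles of \<open>p\<close> and \<open>q\<close> differ; it is symmetric in the two components of
  \<open>q\<close>.\<close>

definition stein_kernel :: "'n \<times> 'n \<Rightarrow> ('n index \<Rightarrow> real) \<Rightarrow> real^'n^'n" where
  "stein_kernel p x = mat_of (\<lambda>q. (\<Sum>k=1..d. \<Sum>l=1..d. s (int k - int l) * x (Inl (snd p, k)) *
     (ent R (fst p, fst q) * x (Inl (snd q, l)) + ent R (fst p, snd q) * x (Inl (fst q, l)))) / real d)"

text \<open>The derivative of \<open>U\<close> at \<open>x\<close> in direction \<open>v\<close>,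
  entry \<open>q\<close>: product rule in the X-variables, linear in the G-entries.\<close>

definition dU :: "real \<Rightarrow> real \<Rightarrow> ('n index \<Rightarrow> real) \<Rightarrow> ('n index \<Rightarrow> real) \<Rightarrow> 'n \<times> 'n \<Rightarrow> real" where
  "dU c \<sigma> x v q = c * (1 / sqrt (real d) * (\<Sum>k=1..d. v (Inl (fst q, k)) * x (Inl (snd q, k)) + x (Inl (fst q, k)) * v (Inl (snd q, k))))
     + \<sigma> * v (Inr q)"

lemma Inl_mem [intro]: "k \<in> {1..d} \<Longrightarrow> Inl (i, k) \<in> T"
  by (auto simp: index_set_def)

lemma Inr_mem [intro]: "Inr q \<in> T"
  by (simp add: index_set_def)

lemma tame_x [intro]: "t \<in> T \<Longrightarrow> tame T (\<lambda>x. x t)"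
  by (rule tame_component[OF _ finite_index])

lemma U_eq_mat_of: "U c \<sigma> x = mat_of (\<lambda>q. c * (1 / sqrt (real d) * (\<Sum>k=1..d. x (Inl (fst q, k)) * x (Inl (snd q, k)) - ent R q)) + \<sigma> * x (Inr q))"
  by (rule matrix_eqI) (simp add: U_def Wm_def Gm_def)

lemma tame_ent_U: "tame T (\<lambda>x. ent (U c \<sigma> x) q)"
  unfolding U_eq_mat_of ent_mat_of by (intro tame_add tame_mult tame_const tame_sum tame_diff tame_x) auto

lemma measurable_U: "U c \<sigma> \<in> borel_measurable (PiM T (\<lambda>_. borel))"
proof -
  have "(\<lambda>x. mat_of (\<lambda>q. ent (U c \<sigma> x) q)) \<in> borel_measurable (PiM T (\<lambda>_. borel))"
    using tame_ent_U by (intro borel_measurable_mat_of) (simp add: tame_def)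
  moreover have "(\<lambda>x. mat_of (\<lambda>q. ent (U c \<sigma> x) q)) = U c \<sigma>"
    by (rule ext, rule matrix_eqI) simp
  ultimately show ?thesis by simp
qed

lemma U_restrict: "U c \<sigma> (restrict x T) = U c \<sigma> x"
  using tame_ent_U by (intro matrix_eqI) (simp add: tame_def)

lemma tame_continuous_U:
  fixes f :: "real^'n^'n \<Rightarrow> real"
  assumes f: "continuous_on UNIV f" and b: "\<And>y. \<bar>f y\<bar> \<le> B"
  shows "tame T (\<lambda>x. f (U c \<sigma> x))"
proof (rule tame_bounded[OF _ _ tame_const[of _ B]])
  have "f \<in> borel_measurable borel" using f by (rule borel_measurable_continuous_onI)
  then show "(\<lambda>x. f (U c \<sigma> x)) \<in> borel_measurable (PiM T (\<lambda>_. borel))"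
    using measurable_U by (rule measurable_compose[rotated])
  show "\<bar>f (U c \<sigma> x)\<bar> \<le> \<bar>B\<bar>" for x using b[of "U c \<sigma> x"] by linarith
qed (simp add: U_restrict)

lemma U_derivative:
  "((\<lambda>e. U c \<sigma> (\<lambda>t. x t + e * v t)) has_derivative (\<lambda>e. e *\<^sub>R mat_of (dU c \<sigma> x v))) (at 0)"
  unfolding U_eq_mat_of
proof (rule has_derivative_mat_of)
  fix q
  show "((\<lambda>e. c * (1 / sqrt (real d) * (\<Sum>k=1..d. (x (Inl (fst q, k)) + e * v (Inl (fst q, k))) * (x (Inl (snd q, k)) + e * v (Inl (snd q, k))) - ent R q)) +
          \<sigma> * (x (Inr q) + e * v (Inr q))) has_real_derivative dU c \<sigma> x v q) (at 0)"
    unfolding dU_def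
    by (rule derivative_eq_intros refl | simp)+ (simp add: mult_ac)
qed

lemma U_continuous: "isCont (\<lambda>e. U c \<sigma> (\<lambda>t. x t + e * v t)) 0"
  using U_derivative has_derivative_continuous by blast

end

definition hess_entry :: "(real^'n^'n \<Rightarrow> real^'n^'n \<Rightarrow> real^'n^'n) \<Rightarrow> 'n \<times> 'n \<Rightarrow> 'n::finite \<times> 'n \<Rightarrow> real^'n^'n \<Rightarrow> real" where
  "hess_entry H p q y = ent (H y (unit_matrix q)) p"

lemma ent_sum: "ent (\<Sum>i\<in>I. f i) q = (\<Sum>i\<in>I. ent (f i) q)"
  by (simp add: ent_def)

lemma norm_unit_matrix: "norm (unit_matrix q) = 1"
  by (simp add: unit_matrix_def norm_axis_1)

section \<open>Integration by parts against the gradient of a smooth test function\<close>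

context wishart_setting
begin

definition expect :: "(('n index \<Rightarrow> real) \<Rightarrow> real) \<Rightarrow> real" where
  "expect f = (\<integral>\<omega>. f (\<lambda>t. X t \<omega>) \<partial>P)"

lemma tame_Inl [intro]: "Suc 0 \<le> k \<Longrightarrow> k \<le> d \<Longrightarrow> tame T (\<lambda>x. x (Inl (i, k)))"
  by (intro tame_x Inl_mem) simp

lemma expect_add: "tame T f \<Longrightarrow> tame T g \<Longrightarrow> expect (\<lambda>x. f x + g x) = expect f + expect g"
  unfolding expect_def by (intro Bochner_Integration.integral_add integrable_tame)

lemma expect_diff: "tame T f \<Longrightarrow> tame T g \<Longrightarrow> expect (\<lambda>x. f x - g x) = expect f - expect g"
  unfolding expect_def by (intro Bochner_Integration.integral_diff integrable_tame)

lemma expect_cmult: "expect (\<lambda>x. a * f x) = a * expect f"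
  unfolding expect_def by simp

lemma expect_const: "expect (\<lambda>x. a) = a"
  unfolding expect_def by (simp add: prob_space)

lemma expect_sum: "(\<And>i. i \<in> I \<Longrightarrow> tame T (f i)) \<Longrightarrow> expect (\<lambda>x. \<Sum>i\<in>I. f i x) = (\<Sum>i\<in>I. expect (f i))"
  unfolding expect_def by (intro Bochner_Integration.integral_sum integrable_tame)

lemma expect_mono: "tame T f \<Longrightarrow> tame T g \<Longrightarrow> (\<And>x. f x \<le> g x) \<Longrightarrow> expect f \<le> expect g"
  unfolding expect_def by (intro integral_mono integrable_tame)

lemma expect_ibp:
  assumes t: "t \<in> T" and f: "tame T f" and Df: "tame T Df"
    and deriv: "\<And>x. ((\<lambda>e. f (\<lambda>s. x s + e * K t s)) has_real_derivative Df x) (at 0)"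
    and cont: "\<And>x. isCont (\<lambda>e. Df (\<lambda>s. x s + e * K t s)) 0"
  shows "expect (\<lambda>x. x t * f x) = expect Df"
  unfolding expect_def by (rule integration_by_parts[OF assms])

lemma expect_fourth:
  assumes "a \<in> T" "b \<in> T" "c \<in> T" "e \<in> T"
  shows "expect (\<lambda>x. x a * x b * (x c * x e)) = K a b * K c e + K a c * K b e + K a e * K b c"
  unfolding expect_def by (rule fourth_moment[OF assms])

lemma expect_second: "a \<in> T \<Longrightarrow> b \<in> T \<Longrightarrow> expect (\<lambda>x. x a * x b) = K a b"
  unfolding expect_def by (rule second_moment)

lemma tame_dU:
  assumes "\<And>t. t \<in> T \<Longrightarrow> tame T (\<lambda>x. v x t)"
  shows "tame T (\<lambda>x. dU c \<sigma> x (v x) q)"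
  unfolding dU_def
  by (intro tame_add tame_mult tame_const tame_sum tame_x assms) auto

lemma isCont_dU: "isCont (\<lambda>e. dU c \<sigma> (\<lambda>t. x t + e * v t) w q) 0"
  unfolding dU_def by (intro continuous_intros)

context
  fixes g :: "real^'n^'n \<Rightarrow> real" and h :: "real^'n^'n \<Rightarrow> real^'n^'n"
    and H :: "real^'n^'n \<Rightarrow> real^'n^'n \<Rightarrow> real^'n^'n"
  assumes C2: "C2_contraction g h H"
begin

lemma h_deriv: "(h has_derivative H y) (at y)"
  and norm_h: "norm (h y) \<le> 1"
  and cont_H: "continuous_on UNIV (\<lambda>y. H y v)"
  and g_deriv: "(g has_derivative (\<lambda>v. h y \<bullet> v)) (at y)"
  using C2 by (auto simp: C2_contraction_def)

lemma cont_h: "continuous_on UNIV h"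
  by (intro continuous_at_imp_continuous_on ballI has_derivative_continuous[OF h_deriv])

lemma cont_hess: "continuous_on UNIV (hess_entry H p q)"
  unfolding hess_entry_def[abs_def] by (intro continuous_intros cont_H)

lemma ent_H: "ent (H y A) p = (\<Sum>q\<in>UNIV. ent A q * hess_entry H p q y)"
proof -
  interpret bounded_linear "H y" by (rule has_derivative_bounded_linear[OF h_deriv])
  have "H y A = (\<Sum>q\<in>UNIV. ent A q *\<^sub>R H y (unit_matrix q))"
    by (subst matrix_expansion[of A]) (simp add: sum scaleR)
  then show ?thesis by (simp add: ent_sum hess_entry_def)
qed

lemma tame_h: "tame T (\<lambda>x. ent (h (U c \<sigma> x)) p)"
proof (rule tame_continuous_U)
  show "continuous_on UNIV (\<lambda>y. ent (h y) p)" by (intro continuous_intros cont_h)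
  show "\<bar>ent (h y) p\<bar> \<le> 1" for y using abs_ent_le_norm[of "h y" p] norm_h[of y] by simp
qed

lemma tame_hess: "tame T (\<lambda>x. hess_entry H p q (U c \<sigma> x))"
proof -
  obtain B where B: "\<And>y v. norm (H y v) \<le> B * norm v"
    using C2 by (auto simp: C2_contraction_def)
  show ?thesis
  proof (rule tame_continuous_U[OF cont_hess])
    show "\<bar>hess_entry H p q y\<bar> \<le> B" for y
      unfolding hess_entry_def using abs_ent_le_norm[of "H y (unit_matrix q)" p] B[of y "unit_matrix q"]
      by (simp add: norm_unit_matrix)
  qed
qed

lemma h_path_deriv:
  "((\<lambda>e. ent (h (U c \<sigma> (\<lambda>t. x t + e * v t))) p) has_real_derivative
     (\<Sum>q\<in>UNIV. dU c \<sigma> x v q * hess_entry H p q (U c \<sigma> x))) (at 0)"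
proof -
  let ?y = "U c \<sigma> x"
  have "((\<lambda>e. h (U c \<sigma> (\<lambda>t. x t + e * v t))) has_derivative (\<lambda>e. H ?y (e *\<^sub>R mat_of (dU c \<sigma> x v)))) (at 0)"
    using diff_chain_at[OF U_derivative[of c \<sigma> x v], of h "H ?y"] h_deriv[of ?y] by (simp add: comp_def)
  moreover have "bounded_linear (\<lambda>A :: real^'n^'n. ent A p)"
    unfolding ent_def by (intro bounded_linear_compose[OF bounded_linear_vec_nth] bounded_linear_vec_nth)
  ultimately have "((\<lambda>e. ent (h (U c \<sigma> (\<lambda>t. x t + e * v t))) p) has_derivative
      (\<lambda>e. ent (H ?y (e *\<^sub>R mat_of (dU c \<sigma> x v))) p)) (at 0)"
    by (rule bounded_linear.has_derivative[rotated])
  then show ?thesis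
    unfolding ent_H has_field_derivative_def
    by (rule has_derivative_eq_rhs) (simp add: fun_eq_iff sum_distrib_left sum_distrib_right mult_ac)
qed

lemma isCont_h_path: "isCont (\<lambda>e. ent (h (U c \<sigma> (\<lambda>t. x t + e * v t))) p) 0"
  using h_path_deriv DERIV_isCont by blast

lemma isCont_hess_path: "isCont (\<lambda>e. hess_entry H p q (U c \<sigma> (\<lambda>t. x t + e * v t))) 0"
  by (rule isCont_o2[OF U_continuous])
     (use cont_hess in \<open>auto simp: continuous_on_eq_continuous_at\<close>)

lemma dU_column: "dU c \<sigma> x (K (Inl (i, k))) q = c * (1 / sqrt (real d) * (\<Sum>l=1..d. s (int k - int l) *
    (ent R (i, fst q) * x (Inl (snd q, l)) + ent R (i, snd q) * x (Inl (fst q, l)))))"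
  unfolding dU_def by (simp add: algebra_simps)

lemma dU_entry: "dU c \<sigma> x (K (Inr p)) q = \<sigma> * entry_cov R \<kappa> p q"
  unfolding dU_def by simp

text \<open>Each product X_ik X_jk is integrated by parts in X_ik. What remains after cancellation
  is the derivative of \<open>h\<close> along the path, whose directions are the columns in
  \<open>dU_column\<close>; multiplied by X_jk and summed over k they form \<open>c\<close> times
  the kernel.\<close>

lemma expect_Wm:
  "expect (\<lambda>x. ent (Wm x) p * ent (h (U c \<sigma> x)) p)
   = c * expect (\<lambda>x. \<Sum>q\<in>UNIV. ent (stein_kernel p x) q * hess_entry H p q (U c \<sigma> x))"
proof -
  obtain i j where p: "p = (i, j)" by (cases p)
  let ?h = "\<lambda>x. ent (h (U c \<sigma> x)) p" and ?y = "U c \<sigma>"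
  let ?D = "\<lambda>k x. \<Sum>q\<in>UNIV. dU c \<sigma> x (K (Inl (i, k))) q * hess_entry H p q (?y x)"
  have tD: "tame T (?D k)" for k
    by (intro tame_sum tame_mult tame_dU tame_hess tame_const)
  \<comment> \<open>When the derivative hits the factor X_jk it yields R_ij s(0) = R_ij, exactly the
    term subtracted as centring.\<close>
  have one: "expect (\<lambda>x. x (Inl (i, k)) * (x (Inl (j, k)) * ?h x) - ent R p * ?h x) = expect (\<lambda>x. x (Inl (j, k)) * ?D k x)"
    if k: "k \<in> {1..d}" for k
  proof -
    have tx: "tame T (\<lambda>x. x (Inl (j, k)))" "tame T (\<lambda>x. x (Inl (i, k)))" by (intro tame_x Inl_mem k)+
    have "expect (\<lambda>x. x (Inl (i, k)) * (x (Inl (j, k)) * ?h x)) = expect (\<lambda>x. ent R p * ?h x + x (Inl (j, k)) * ?D k x)"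
    proof (rule expect_ibp)
      show "((\<lambda>e. (x (Inl (j, k)) + e * K (Inl (i, k)) (Inl (j, k))) *
          ?h (\<lambda>t. x t + e * K (Inl (i, k)) t)) has_real_derivative (ent R p * ?h x + x (Inl (j, k)) * ?D k x)) (at 0)" for x
        by (rule derivative_eq_intros h_path_deriv refl)+ (simp add: p s_0)
      show "isCont (\<lambda>e. ent R p * ?h (\<lambda>t. x t + e * K (Inl (i, k)) t) +
          (x (Inl (j, k)) + e * K (Inl (i, k)) (Inl (j, k))) * ?D k (\<lambda>t. x t + e * K (Inl (i, k)) t)) 0" for x
        by (intro continuous_intros isCont_h_path isCont_hess_path isCont_dU)
      show "tame T (\<lambda>x. x (Inl (j, k)) * ?h x)" by (intro tame_mult tx tame_h)
      show "tame T (\<lambda>x. ent R p * ?h x + x (Inl (j, k)) * ?D k x)"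
        by (intro tame_add tame_mult tx tD tame_h tame_const)
    qed (rule Inl_mem[OF k])
    then show ?thesis
      using tx tD tame_h by (simp add: expect_add expect_diff tame_mult expect_cmult)
  qed
  have "expect (\<lambda>x. ent (Wm x) p * ?h x)
      = expect (\<lambda>x. 1 / sqrt (real d) * (\<Sum>k=1..d. x (Inl (i, k)) * (x (Inl (j, k)) * ?h x) - ent R p * ?h x))"
    by (simp add: Wm_def p sum_distrib_right left_diff_distrib mult.assoc)
  also have "\<dots> = 1 / sqrt (real d) * (\<Sum>k=1..d. expect (\<lambda>x. x (Inl (j, k)) * ?D k x))"
    by (subst expect_cmult, subst expect_sum) (auto intro!: tame_mult tame_diff tame_h simp: one)
  also have "\<dots> = expect (\<lambda>x. 1 / sqrt (real d) * (\<Sum>k=1..d. x (Inl (j, k)) * ?D k x))"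
    by (subst expect_cmult, subst expect_sum) (auto intro!: tame_mult tD)
  also have "\<dots> = expect (\<lambda>x. c * (\<Sum>q\<in>UNIV. ent (stein_kernel p x) q * hess_entry H p q (?y x)))"
  proof (rule arg_cong[where f=expect], rule ext)
    fix x
    have "1 / sqrt (real d) * (\<Sum>k=1..d. x (Inl (j, k)) * ?D k x)
      = (\<Sum>q\<in>UNIV. (1 / sqrt (real d) * (\<Sum>k=1..d. x (Inl (j, k)) * dU c \<sigma> x (K (Inl (i, k))) q)) * hess_entry H p q (?y x))"
      by (simp only: sum_distrib_left sum_distrib_right mult.assoc) (subst sum.swap, rule refl)
    moreover have "1 / sqrt (real d) * (\<Sum>k=1..d. x (Inl (j, k)) * dU c \<sigma> x (K (Inl (i, k))) q) = c * ent (stein_kernel p x) q" for q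
    proof -
      \<comment> \<open>One factor 1 / sqrt d stems from the entry of W, the other from
        differentiating \<open>U\<close>; together they make the 1/d of the kernel.\<close>
      have "1 / sqrt (real d) * (\<Sum>k=1..d. x (Inl (j, k)) * dU c \<sigma> x (K (Inl (i, k))) q)
        = (1 / sqrt (real d) * (1 / sqrt (real d))) * (c * (\<Sum>k=1..d. x (Inl (j, k)) * (\<Sum>l=1..d. s (int k - int l) *
    (ent R (i, fst q) * x (Inl (snd q, l)) + ent R (i, snd q) * x (Inl (fst q, l))))))"
        unfolding dU_column by (simp only: sum_distrib_left mult_ac)
      also have "\<dots> = 1 / real d * (c * (\<Sum>k=1..d. x (Inl (j, k)) * (\<Sum>l=1..d. s (int k - int l) *
    (ent R (i, fst q) * x (Inl (snd q, l)) + ent R (i, snd q) * x (Inl (fst q, l))))))"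
        by simp
      also have "\<dots> = c * ent (stein_kernel p x) q"
        by (simp add: stein_kernel_def p sum_distrib_left sum_divide_distrib mult_ac)
      finally show ?thesis .
    qed
    ultimately show "1 / sqrt (real d) * (\<Sum>k=1..d. x (Inl (j, k)) * ?D k x) = c * (\<Sum>q\<in>UNIV. ent (stein_kernel p x) q * hess_entry H p q (?y x))"
      by (simp only: sum_distrib_left mult.assoc)
  qed
  finally show ?thesis by (simp only: expect_cmult)
qed

text \<open>The coefficient \<open>A\<close> may be random as long as it ignores shifts of the
  G-entries. It is 1 for the interpolation itself and an entry of \<open>Am\<close> for the second
  integration by parts.\<close>

lemma expect_Gm:
  assumes A: "tame T A" "\<And>x e. A (\<lambda>t. x t + e * K (Inr r) t) = A x"
  shows "expect (\<lambda>x. x (Inr r) * (A x * ent (h (U c \<sigma> x)) p))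
    = \<sigma> * expect (\<lambda>x. A x * (\<Sum>q\<in>UNIV. entry_cov R \<kappa> r q * hess_entry H p q (U c \<sigma> x)))"
proof -
  have "expect (\<lambda>x. x (Inr r) * (A x * ent (h (U c \<sigma> x)) p))
    = expect (\<lambda>x. A x * (\<Sum>q\<in>UNIV. dU c \<sigma> x (K (Inr r)) q * hess_entry H p q (U c \<sigma> x)))"
  proof (rule expect_ibp)
    show "tame T (\<lambda>x. A x * ent (h (U c \<sigma> x)) p)" by (intro tame_mult A tame_h)
    show "tame T (\<lambda>x. A x * (\<Sum>q\<in>UNIV. dU c \<sigma> x (K (Inr r)) q * hess_entry H p q (U c \<sigma> x)))"
      by (intro tame_mult A tame_sum tame_dU tame_hess tame_const)
    show "((\<lambda>e. A (\<lambda>t. x t + e * K (Inr r) t) * ent (h (U c \<sigma> (\<lambda>t. x t + e * K (Inr r) t))) p) has_real_derivative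
        A x * (\<Sum>q\<in>UNIV. dU c \<sigma> x (K (Inr r)) q * hess_entry H p q (U c \<sigma> x))) (at 0)" for x
      unfolding A(2) by (rule DERIV_cmult[OF h_path_deriv])
    show "isCont (\<lambda>e. A (\<lambda>t. x t + e * K (Inr r) t) * (\<Sum>q\<in>UNIV. dU c \<sigma> (\<lambda>t. x t + e * K (Inr r) t) (K (Inr r)) q *
        hess_entry H p q (U c \<sigma> (\<lambda>t. x t + e * K (Inr r) t)))) 0" for x
      unfolding A(2) by (intro continuous_intros isCont_hess_path isCont_dU)
  qed auto
  also have "\<dots> = expect (\<lambda>x. \<sigma> * (A x * (\<Sum>q\<in>UNIV. entry_cov R \<kappa> r q * hess_entry H p q (U c \<sigma> x))))"
    by (simp add: dU_entry sum_distrib_left mult_ac)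
  finally show ?thesis by (simp only: expect_cmult)
qed

end

end

section \<open>Inverting the covariance, and the second moment of A G\<close>

lemma variance_factor_ge_1:
  fixes s :: "int \<Rightarrow> real"
  assumes "d \<ge> 1" "s 0 = 1"
  shows "1 \<le> variance_factor s d"
proof -
  have "real d = (\<Sum>k=1..d. (s (int k - int k))\<^sup>2)" using assms by simp
  also have "\<dots> \<le> (\<Sum>k=1..d. \<Sum>l=1..d. (s (int k - int l))\<^sup>2)"
    by (rule sum_mono, rule member_le_sum[where f="\<lambda>l. (s (int _ - int l))\<^sup>2"]) auto
  finally show ?thesis using assms unfolding variance_factor_def by (simp add: divide_simps)
qed

lemma sum2_square:
  fixes F :: "'a \<Rightarrow> 'b \<Rightarrow> real"
  shows "(\<Sum>k\<in>A. \<Sum>l\<in>B. F k l)\<^sup>2 = (\<Sum>k\<in>A. \<Sum>l\<in>B. \<Sum>k'\<in>A. \<Sum>l'\<in>B. F k l * F k' l')"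
  by (simp only: power2_eq_square sum_distrib_right) (simp only: sum_distrib_left)

text \<open>\<gamma> bounds \<open>R\<close> from below as an operator and \<open>L\<close> bounds
  its absolute row sums. They will be instantiated by 2 minus the norm of r and by that
  norm.\<close>

locale coercive_wishart = wishart_setting P d R s X
  for P :: "'w measure" and d :: nat and R :: "real^'n^'n" and s :: "int \<Rightarrow> real" and X :: "'n index \<Rightarrow> 'w \<Rightarrow> real" +
  fixes \<gamma> L :: real
  assumes \<gamma>: "\<gamma> > 0" and R_coercive: "\<And>x. \<gamma> * (x \<bullet> x) \<le> x \<bullet> (R *v x)"
    and R_le_1: "\<And>q. \<bar>ent R q\<bar> \<le> 1" and R_rows: "\<And>i. (\<Sum>j\<in>UNIV. \<bar>ent R (i, j)\<bar>) \<le> L"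
begin

sublocale coercive_matrix R \<gamma>
proof
  show "transpose R = R"
    using R_sym by (simp add: transpose_def vec_eq_iff ent_def)
qed (use \<gamma> R_coercive in auto)

lemma \<kappa>_ge_1: "1 \<le> \<kappa>"
  by (rule variance_factor_ge_1) (rule d, rule s_0)

text \<open>Row \<open>p\<close> of C - \<Theta>, arranged as a matrix. Correspondingly
  \<open>Am\<close> is row \<open>p\<close> of A, and \<open>Dm\<close> is the matrix A G.\<close>

definition Bm :: "'n \<times> 'n \<Rightarrow> ('n index \<Rightarrow> real) \<Rightarrow> real^'n^'n" where
  "Bm p x = mat_of (entry_cov R \<kappa> p) - stein_kernel p x"

definition Am :: "'n \<times> 'n \<Rightarrow> ('n index \<Rightarrow> real) \<Rightarrow> real^'n^'n" where
  "Am p x = (1 / (2 * \<kappa>)) *\<^sub>R sandwich_inv (Bm p x)"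

definition Dm :: "('n index \<Rightarrow> real) \<Rightarrow> real^'n^'n" where
  "Dm x = mat_of (\<lambda>p. \<Sum>r\<in>UNIV. x (Inr r) * ent (Am p x) r)"

lemma entry_cov_sym: "entry_cov R \<kappa> p q = entry_cov R \<kappa> q p"
  using R_sym[of "fst p"] R_sym[of "snd p"] by (simp add: entry_cov_def mult.commute)

lemma Bm_sym: "ent (Bm p x) (a, b) = ent (Bm p x) (b, a)"
  by (simp add: Bm_def stein_kernel_def entry_cov_def algebra_simps)

text \<open>The identity A C = C - \<Theta>, although C has no inverse. The two summands of
  \<open>entry_cov\<close> send a matrix S to \<kappa> times R S R and to \<kappa> times its
  transpose; they agree here because \<open>Bm\<close> is symmetric, which accounts for the 2
  \<kappa> in \<open>Am\<close>.\<close>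

lemma Am_cov: "(\<Sum>r\<in>UNIV. ent (Am p x) r * entry_cov R \<kappa> r q) = ent (Bm p x) q"
proof -
  obtain i j where q: "q = (i, j)" by (cases q)
  let ?S = "sandwich_inv (Bm p x)"
  have RSR: "(\<Sum>a\<in>UNIV. \<Sum>b\<in>UNIV. ent ?S (a, b) * (ent R (a, i) * ent R (b, j))) = ent (Bm p x) (i, j)" for i j
  proof -
    have "ent (R ** ?S ** R) (i, j) = (\<Sum>b\<in>UNIV. (\<Sum>a\<in>UNIV. ent R (i, a) * ent ?S (a, b)) * ent R (b, j))"
      by (simp add: ent_def matrix_matrix_mult_def)
    also have "\<dots> = (\<Sum>a\<in>UNIV. \<Sum>b\<in>UNIV. ent R (i, a) * ent ?S (a, b) * ent R (b, j))"
      unfolding sum_distrib_right by (rule sum.swap)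
    also have "\<dots> = (\<Sum>a\<in>UNIV. \<Sum>b\<in>UNIV. ent ?S (a, b) * (ent R (a, i) * ent R (b, j)))"
      by (intro sum.cong refl) (simp add: R_sym[of i] mult_ac)
    finally show ?thesis by (simp add: sandwich_inv)
  qed
  have "(\<Sum>r\<in>UNIV. ent (Am p x) r * entry_cov R \<kappa> r q)
    = 1 / (2 * \<kappa>) * \<kappa> * ((\<Sum>a\<in>UNIV. \<Sum>b\<in>UNIV. ent ?S (a, b) * (ent R (a, i) * ent R (b, j)))
       + (\<Sum>a\<in>UNIV. \<Sum>b\<in>UNIV. ent ?S (a, b) * (ent R (a, j) * ent R (b, i))))"
    unfolding sum_pairs Am_def entry_cov_def q
    by (simp add: sum.distrib[symmetric] sum_distrib_left distrib_left mult_ac)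
  also have "\<dots> = ent (Bm p x) q"
    unfolding RSR using Bm_sym[of p x j i] \<kappa>_ge_1 by (simp add: q)
  finally show ?thesis .
qed

lemma tame_stein_kernel: "tame T (\<lambda>x. ent (stein_kernel p x) q)"
  unfolding stein_kernel_def ent_mat_of divide_inverse
  by (intro tame_mult tame_sum tame_add tame_const) auto

lemma tame_Bm: "tame T (\<lambda>x. ent (Bm p x) q)"
  unfolding Bm_def ent_linear ent_mat_of by (intro tame_diff tame_const tame_stein_kernel)

lemma tame_Am: "tame T (\<lambda>x. ent (Am p x) q)"
proof -
  obtain i j where q: "q = (i, j)" by (cases q)
  have "ent (sandwich_inv B) q
      = (\<Sum>b\<in>UNIV. (\<Sum>a\<in>UNIV. ent (matrix_inv R) (i, a) * ent B (a, b)) * ent (matrix_inv R) (b, j))" for B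
    by (simp add: sandwich_inv_def q ent_def matrix_matrix_mult_def)
  then show ?thesis
    unfolding Am_def ent_linear by (simp only:) (intro tame_mult tame_sum tame_const tame_Bm)
qed

lemma tame_Dm: "tame T (\<lambda>x. ent (Dm x) p)"
  unfolding Dm_def ent_mat_of by (intro tame_sum tame_mult tame_Am tame_x Inr_mem)

lemma tame_norm_Dm: "tame T (\<lambda>x. (norm (Dm x))\<^sup>2)"
  unfolding norm_matrix_ent unfolding power2_eq_square by (intro tame_sum tame_mult tame_Dm)

lemma Am_shift: "Am p (\<lambda>t. x t + e * K (Inr r) t) = Am p x"
  by (simp add: Am_def Bm_def stein_kernel_def)

text \<open>Both sides equal \<open>c * \<sigma>\<close> times the expected pairing of
  \<open>Bm\<close> with the Hessian. On the left, G contributes \<sigma> C and W contributes c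
  \<Theta>; on the right, integrating \<open>Dm\<close> by parts in G returns \<sigma> A C.\<close>

lemma expect_interpolation:
  assumes C2: "C2_contraction g h H"
  shows "expect (\<lambda>x. c * (x (Inr p) * ent (h (U c \<sigma> x)) p) - \<sigma> * (ent (Wm x) p * ent (h (U c \<sigma> x)) p))
    = c * expect (\<lambda>x. ent (Dm x) p * ent (h (U c \<sigma> x)) p)"
proof -
  let ?h = "\<lambda>x. ent (h (U c \<sigma> x)) p" and ?H = "\<lambda>q x. hess_entry H p q (U c \<sigma> x)"
  note th = tame_h[OF C2] and tH = tame_hess[OF C2]
  have tW: "tame T (\<lambda>x. ent (Wm x) p)"
    unfolding Wm_def ent_mat_of by (intro tame_mult tame_const tame_sum tame_diff) auto
  have G: "expect (\<lambda>x. x (Inr p) * ?h x) = \<sigma> * expect (\<lambda>x. \<Sum>q\<in>UNIV. entry_cov R \<kappa> p q * ?H q x)"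
    using expect_Gm[OF C2, of "\<lambda>_. 1" p c \<sigma> p] by simp
  have W: "expect (\<lambda>x. ent (Wm x) p * ?h x) = c * expect (\<lambda>x. \<Sum>q\<in>UNIV. ent (stein_kernel p x) q * ?H q x)"
    by (rule expect_Wm[OF C2])
  have "expect (\<lambda>x. c * (x (Inr p) * ?h x) - \<sigma> * (ent (Wm x) p * ?h x))
    = c * expect (\<lambda>x. x (Inr p) * ?h x) - \<sigma> * expect (\<lambda>x. ent (Wm x) p * ?h x)"
    by (subst expect_diff) (auto intro!: tame_mult tame_const th tW tame_x Inr_mem simp: expect_cmult)
  also have "\<dots> = c * \<sigma> * (expect (\<lambda>x. \<Sum>q\<in>UNIV. entry_cov R \<kappa> p q * ?H q x) - expect (\<lambda>x. \<Sum>q\<in>UNIV. ent (stein_kernel p x) q * ?H q x))"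
    unfolding G W by (simp add: algebra_simps)
  also have "\<dots> = c * \<sigma> * expect (\<lambda>x. \<Sum>q\<in>UNIV. ent (Bm p x) q * ?H q x)"
    by (subst expect_diff[symmetric])
       (auto intro!: tame_sum tame_mult tame_const tH tame_stein_kernel simp: Bm_def left_diff_distrib sum_subtractf)
  finally have lhs: "expect (\<lambda>x. c * (x (Inr p) * ?h x) - \<sigma> * (ent (Wm x) p * ?h x))
    = c * \<sigma> * expect (\<lambda>x. \<Sum>q\<in>UNIV. ent (Bm p x) q * ?H q x)" .
  have "expect (\<lambda>x. ent (Dm x) p * ?h x) = expect (\<lambda>x. \<Sum>r\<in>UNIV. x (Inr r) * (ent (Am p x) r * ?h x))"
    by (simp add: Dm_def sum_distrib_right mult.assoc)
  also have "\<dots> = (\<Sum>r\<in>UNIV. \<sigma> * expect (\<lambda>x. ent (Am p x) r * (\<Sum>q\<in>UNIV. entry_cov R \<kappa> r q * ?H q x)))"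
    by (subst expect_sum; (subst expect_Gm[OF C2])?)
       (auto intro!: tame_mult th tame_Am tame_x Inr_mem simp del: index_cov.simps simp: Am_shift)
  also have "\<dots> = \<sigma> * expect (\<lambda>x. \<Sum>r\<in>UNIV. ent (Am p x) r * (\<Sum>q\<in>UNIV. entry_cov R \<kappa> r q * ?H q x))"
    by (subst expect_sum) (auto intro!: tame_mult tame_sum tame_const tH tame_Am simp: sum_distrib_left)
  also have "(\<lambda>x. \<Sum>r\<in>UNIV. ent (Am p x) r * (\<Sum>q\<in>UNIV. entry_cov R \<kappa> r q * ?H q x))
      = (\<lambda>x. \<Sum>q\<in>UNIV. ent (Bm p x) q * ?H q x)"
  proof
    fix x
    show "(\<Sum>r\<in>UNIV. ent (Am p x) r * (\<Sum>q\<in>UNIV. entry_cov R \<kappa> r q * ?H q x)) = (\<Sum>q\<in>UNIV. ent (Bm p x) q * ?H q x)"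
      unfolding Am_cov[symmetric] sum_distrib_left sum_distrib_right
      by (subst sum.swap) (simp add: mult_ac)
  qed
  finally show ?thesis unfolding lhs by simp
qed

text \<open>\<open>Am\<close> depends on the X-variables alone, so integrating one of the two
  G-factors by parts replaces it by the covariance, and A C A^T has its diagonal given by rows of A
  against rows of C - \<Theta>.\<close>

lemma expect_Dm_square: "expect (\<lambda>x. (ent (Dm x) p)\<^sup>2) = expect (\<lambda>x. Am p x \<bullet> Bm p x)"
proof -
  have one: "expect (\<lambda>x. x (Inr r) * (ent (Am p x) r * ent (Dm x) p)) = expect (\<lambda>x. ent (Am p x) r * ent (Bm p x) r)" for r
  proof (rule expect_ibp)
    fix x
    let ?y = "\<lambda>e t. x t + e * K (Inr r) t"
    have D: "ent (Dm (?y e)) p = ent (Dm x) p + e * ent (Bm p x) r" for e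
    proof -
      have "ent (Dm (?y e)) p = (\<Sum>q\<in>UNIV. (x (Inr q) + e * entry_cov R \<kappa> r q) * ent (Am p x) q)"
        unfolding Dm_def ent_mat_of Am_shift by simp
      also have "\<dots> = ent (Dm x) p + e * (\<Sum>q\<in>UNIV. ent (Am p x) q * entry_cov R \<kappa> q r)"
        by (simp add: Dm_def distrib_left distrib_right sum.distrib sum_distrib_left entry_cov_sym[of r] mult_ac)
      finally show ?thesis by (simp only: Am_cov)
    qed
    have "((\<lambda>e. ent (Am p x) r * (ent (Dm x) p + e * ent (Bm p x) r)) has_real_derivative
        ent (Am p x) r * ent (Bm p x) r) (at 0)"
      by (auto intro!: derivative_eq_intros)
    then show "((\<lambda>e. ent (Am p (?y e)) r * ent (Dm (?y e)) p) has_real_derivative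
        ent (Am p x) r * ent (Bm p x) r) (at 0)"
      unfolding Am_shift D .
    show "isCont (\<lambda>e. ent (Am p (?y e)) r * ent (Bm p (?y e)) r) 0"
      unfolding Am_shift by (simp add: Bm_def stein_kernel_def)
  qed (intro tame_mult tame_Am tame_Dm tame_Bm Inr_mem)+
  have "expect (\<lambda>x. (ent (Dm x) p)\<^sup>2) = expect (\<lambda>x. \<Sum>r\<in>UNIV. x (Inr r) * (ent (Am p x) r * ent (Dm x) p))"
  proof (rule arg_cong[where f=expect], rule ext)
    fix x
    have "(ent (Dm x) p)\<^sup>2 = (\<Sum>r\<in>UNIV. x (Inr r) * ent (Am p x) r) * ent (Dm x) p"
      by (simp add: power2_eq_square Dm_def)
    then show "(ent (Dm x) p)\<^sup>2 = (\<Sum>r\<in>UNIV. x (Inr r) * (ent (Am p x) r * ent (Dm x) p))"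
      by (simp only: sum_distrib_right mult.assoc)
  qed
  also have "\<dots> = (\<Sum>r\<in>UNIV. expect (\<lambda>x. ent (Am p x) r * ent (Bm p x) r))"
    by (subst expect_sum) (auto intro!: tame_mult tame_Am tame_Dm tame_x Inr_mem simp: one)
  also have "\<dots> = expect (\<lambda>x. Am p x \<bullet> Bm p x)"
    unfolding inner_matrix by (subst expect_sum) (auto intro!: tame_mult tame_Am tame_Bm)
  finally show ?thesis .
qed

text \<open>Inverting \<open>R\<close> on both sides costs 1/\<gamma>^2, and the 1/\<kappa> in
  \<open>Am\<close> is dropped because \<kappa> >= 1.\<close>

lemma expect_Dm_square_le: "expect (\<lambda>x. (ent (Dm x) p)\<^sup>2) \<le> expect (\<lambda>x. (norm (Bm p x))\<^sup>2) / (2 * \<gamma>\<^sup>2)"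
proof -
  have "expect (\<lambda>x. Am p x \<bullet> Bm p x) \<le> expect (\<lambda>x. 1 / (2 * \<gamma>\<^sup>2) * (norm (Bm p x))\<^sup>2)"
  proof (rule expect_mono)
    fix x
    have "Am p x \<bullet> Bm p x = (sandwich_inv (Bm p x) \<bullet> Bm p x) / (2 * \<kappa>)" by (simp add: Am_def)
    also have "\<dots> \<le> ((norm (Bm p x))\<^sup>2 / \<gamma>\<^sup>2) / (2 * \<kappa>)"
      using \<kappa>_ge_1 by (intro divide_right_mono inner_sandwich_inv_le) auto
    also have "\<dots> \<le> ((norm (Bm p x))\<^sup>2 / \<gamma>\<^sup>2) / 2"
      using \<kappa>_ge_1 by (intro divide_left_mono) auto
    finally show "Am p x \<bullet> Bm p x \<le> 1 / (2 * \<gamma>\<^sup>2) * (norm (Bm p x))\<^sup>2" by (simp add: mult_ac)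
  next
    show "tame T (\<lambda>x. Am p x \<bullet> Bm p x)"
      unfolding inner_matrix by (intro tame_sum tame_mult tame_Am tame_Bm)
    show "tame T (\<lambda>x. 1 / (2 * \<gamma>\<^sup>2) * (norm (Bm p x))\<^sup>2)"
      unfolding norm_matrix_ent power2_eq_square[of "ent (Bm p _) _"] by (intro tame_sum tame_mult tame_Bm tame_const)
  qed
  then show ?thesis unfolding expect_Dm_square expect_cmult by simp
qed

text \<open>The entries of \<open>stein_kernel\<close> fluctuate about their means through these.\<close>

definition Sm :: "'n \<Rightarrow> 'n \<Rightarrow> ('n index \<Rightarrow> real) \<Rightarrow> real" where
  "Sm j b x = (\<Sum>k=1..d. \<Sum>l=1..d. s (int k - int l) * (x (Inl (j, k)) * x (Inl (b, l)) - ent R (j, b) * s (int k - int l))) / real d"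

lemma tame_Sm: "tame T (Sm j b)"
  unfolding Sm_def[abs_def] divide_inverse
  by (intro tame_mult tame_sum tame_diff tame_const) auto

lemma Bm_eq: "ent (Bm p x) q = - (ent R (fst p, fst q) * Sm (snd p) (snd q) x + ent R (fst p, snd q) * Sm (snd p) (fst q) x)"
proof -
  have "ent R (fst p, fst q) * Sm (snd p) (snd q) x + ent R (fst p, snd q) * Sm (snd p) (fst q) x
    = ent (stein_kernel p x) q - ent (mat_of (entry_cov R \<kappa> p)) q"
    unfolding Sm_def stein_kernel_def entry_cov_def variance_factor_def ent_mat_of
    by (simp add: sum_distrib_left sum_distrib_right sum_subtractf sum.distrib algebra_simps
        add_divide_distrib diff_divide_distrib power2_eq_square sum_divide_distrib)
  then show ?thesis by (simp add: Bm_def)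
qed

text \<open>After the square is expanded, the two surviving pairings close the edges (k,l) and
  (k',l') to the four-cycles k l l' k' and k l k' l'. Each contributes at most one
  \<open>cycle_sum\<close>, as |R| <= 1.\<close>

lemma expect_Sm_square: "expect (\<lambda>x. (Sm j b x)\<^sup>2) \<le> 2 * cycle_sum s d / (real d)\<^sup>2"
proof -
  let ?D = "{1..d}"
  define Y where "Y = (\<lambda>k l (x :: 'n index \<Rightarrow> real). x (Inl (j, k)) * x (Inl (b, l)) - ent R (j, b) * s (int k - int l))"
  define \<delta> where "\<delta> = (\<lambda>k l. s (int k - int l))"
  have \<delta>_sym: "\<delta> k l = \<delta> l k" for k l unfolding \<delta>_def using s_even[of "int k - int l"] by simp
  have tY: "tame T (Y k l)" if "k \<in> ?D" "l \<in> ?D" for k l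
    using that unfolding Y_def by (intro tame_diff tame_mult tame_const) auto
  \<comment> \<open>Of the three pairings in the fourth moment, the one that joins the factors
    within each \<open>Y\<close> is removed by the centring.\<close>
  have EY: "expect (\<lambda>x. Y k l x * Y k' l' x) = \<delta> k k' * \<delta> l l' + (ent R (j, b))\<^sup>2 * (\<delta> k l' * \<delta> l k')"
    if "k \<in> ?D" "l \<in> ?D" "k' \<in> ?D" "l' \<in> ?D" for k l k' l'
  proof -
    note m = that[THEN Inl_mem]
    note tx = tame_x[OF m(1)[of j]] tame_x[OF m(2)[of b]] tame_x[OF m(3)[of j]] tame_x[OF m(4)[of b]]
    have "expect (\<lambda>x. Y k l x * Y k' l' x) = expect (\<lambda>x. (x (Inl (j, k)) * x (Inl (b, l)) * (x (Inl (j, k')) * x (Inl (b, l')))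
      - (ent R (j, b) * \<delta> k' l') * (x (Inl (j, k)) * x (Inl (b, l))))
      - ((ent R (j, b) * \<delta> k l) * (x (Inl (j, k')) * x (Inl (b, l')))
      - ent R (j, b) * \<delta> k l * (ent R (j, b) * \<delta> k' l')))"
      by (simp add: Y_def \<delta>_def algebra_simps)
    also have "\<dots> = (K (Inl (j, k)) (Inl (b, l)) * K (Inl (j, k')) (Inl (b, l')) + K (Inl (j, k)) (Inl (j, k')) * K (Inl (b, l)) (Inl (b, l'))
        + K (Inl (j, k)) (Inl (b, l')) * K (Inl (b, l)) (Inl (j, k')) - (ent R (j, b) * \<delta> k' l') * K (Inl (j, k)) (Inl (b, l)))
      - ((ent R (j, b) * \<delta> k l) * K (Inl (j, k')) (Inl (b, l')) - ent R (j, b) * \<delta> k l * (ent R (j, b) * \<delta> k' l'))"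
      by (subst expect_diff expect_fourth[OF m(1) m(2) m(3) m(4)] expect_cmult expect_second[OF m(1) m(2)] expect_second[OF m(3) m(4)] expect_const
          | (intro tame_diff tame_mult tame_const tx; fail))+ (rule refl)
    also have "\<dots> = \<delta> k k' * \<delta> l l' + (ent R (j, b))\<^sup>2 * (\<delta> k l' * \<delta> l k')"
      using R_sym[of b j] by (simp add: R_diag \<delta>_def power2_eq_square algebra_simps)
    finally show ?thesis .
  qed
  have R2: "(ent R (j, b))\<^sup>2 \<le> 1" using R_le_1[of "(j, b)"] by (simp add: abs_square_le_1)
  have cyc: "cycle_sum s d = (\<Sum>k\<in>?D. \<Sum>l\<in>?D. \<Sum>m\<in>?D. \<Sum>n\<in>?D. \<bar>\<delta> k l\<bar> * \<bar>\<delta> l m\<bar> * \<bar>\<delta> m n\<bar> * \<bar>\<delta> n k\<bar>)"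
    by (simp add: cycle_sum_def \<delta>_def)
  have "expect (\<lambda>x. (\<Sum>k\<in>?D. \<Sum>l\<in>?D. \<delta> k l * Y k l x)\<^sup>2)
     = expect (\<lambda>x. \<Sum>k\<in>?D. \<Sum>l\<in>?D. \<Sum>k'\<in>?D. \<Sum>l'\<in>?D. (\<delta> k l * \<delta> k' l') * (Y k l x * Y k' l' x))"
    by (simp only: sum2_square mult_ac)
  also have "\<dots> = (\<Sum>k\<in>?D. \<Sum>l\<in>?D. \<Sum>k'\<in>?D. \<Sum>l'\<in>?D. (\<delta> k l * \<delta> k' l') * (\<delta> k k' * \<delta> l l' + (ent R (j, b))\<^sup>2 * (\<delta> k l' * \<delta> l k')))"
    by (subst expect_sum, (intro tame_sum tame_mult tame_const tY; assumption), rule sum.cong[OF refl])+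
       (simp only: expect_cmult EY)
  also have "\<dots> \<le> (\<Sum>k\<in>?D. \<Sum>l\<in>?D. \<Sum>k'\<in>?D. \<Sum>l'\<in>?D. \<bar>\<delta> k l\<bar> * \<bar>\<delta> l l'\<bar> * \<bar>\<delta> l' k'\<bar> * \<bar>\<delta> k' k\<bar> + \<bar>\<delta> k l\<bar> * \<bar>\<delta> l k'\<bar> * \<bar>\<delta> k' l'\<bar> * \<bar>\<delta> l' k\<bar>)"
  proof (intro sum_mono)
    fix k l k' l'
    have "(\<delta> k l * \<delta> k' l') * (\<delta> k k' * \<delta> l l' + (ent R (j, b))\<^sup>2 * (\<delta> k l' * \<delta> l k'))
      \<le> \<bar>\<delta> k l * \<delta> k' l' * (\<delta> k k' * \<delta> l l')\<bar> + (ent R (j, b))\<^sup>2 * \<bar>\<delta> k l * \<delta> k' l' * (\<delta> k l' * \<delta> l k')\<bar>"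
    proof -
      have "(ent R (j, b))\<^sup>2 * (\<delta> k l * \<delta> k' l' * (\<delta> k l' * \<delta> l k')) \<le> (ent R (j, b))\<^sup>2 * \<bar>\<delta> k l * \<delta> k' l' * (\<delta> k l' * \<delta> l k')\<bar>"
        by (intro mult_left_mono) auto
      then show ?thesis by (simp add: distrib_left mult_ac add_mono)
    qed
    also have "\<dots> \<le> \<bar>\<delta> k l * \<delta> k' l' * (\<delta> k k' * \<delta> l l')\<bar> + 1 * \<bar>\<delta> k l * \<delta> k' l' * (\<delta> k l' * \<delta> l k')\<bar>"
      by (intro add_left_mono mult_right_mono R2) auto
    also have "\<dots> = \<bar>\<delta> k l\<bar> * \<bar>\<delta> l l'\<bar> * \<bar>\<delta> l' k'\<bar> * \<bar>\<delta> k' k\<bar> + \<bar>\<delta> k l\<bar> * \<bar>\<delta> l k'\<bar> * \<bar>\<delta> k' l'\<bar> * \<bar>\<delta> l' k\<bar>"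
      by (simp add: abs_mult \<delta>_sym[of l' k'] \<delta>_sym[of k' k] \<delta>_sym[of l' k] mult_ac)
    finally show "(\<delta> k l * \<delta> k' l') * (\<delta> k k' * \<delta> l l' + (ent R (j, b))\<^sup>2 * (\<delta> k l' * \<delta> l k'))
      \<le> \<bar>\<delta> k l\<bar> * \<bar>\<delta> l l'\<bar> * \<bar>\<delta> l' k'\<bar> * \<bar>\<delta> k' k\<bar> + \<bar>\<delta> k l\<bar> * \<bar>\<delta> l k'\<bar> * \<bar>\<delta> k' l'\<bar> * \<bar>\<delta> l' k\<bar>" .
  qed
  also have "\<dots> = (\<Sum>k\<in>?D. \<Sum>l\<in>?D. \<Sum>k'\<in>?D. \<Sum>l'\<in>?D. \<bar>\<delta> k l\<bar> * \<bar>\<delta> l l'\<bar> * \<bar>\<delta> l' k'\<bar> * \<bar>\<delta> k' k\<bar>) + cycle_sum s d"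
    by (simp only: sum.distrib cyc)
  also have "(\<Sum>k\<in>?D. \<Sum>l\<in>?D. \<Sum>k'\<in>?D. \<Sum>l'\<in>?D. \<bar>\<delta> k l\<bar> * \<bar>\<delta> l l'\<bar> * \<bar>\<delta> l' k'\<bar> * \<bar>\<delta> k' k\<bar>) = cycle_sum s d"
    unfolding cyc by (intro sum.cong refl sum.swap)
  finally have "expect (\<lambda>x. (\<Sum>k\<in>?D. \<Sum>l\<in>?D. \<delta> k l * Y k l x)\<^sup>2) \<le> 2 * cycle_sum s d" by simp
  moreover have "expect (\<lambda>x. (Sm j b x)\<^sup>2) = expect (\<lambda>x. 1 / (real d)\<^sup>2 * (\<Sum>k\<in>?D. \<Sum>l\<in>?D. \<delta> k l * Y k l x)\<^sup>2)"
    by (simp add: Sm_def \<delta>_def Y_def power_divide)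
  ultimately show ?thesis unfolding expect_cmult by (simp add: divide_right_mono)
qed

end

section \<open>Second-moment bounds and integration along the path\<close>

context coercive_wishart
begin

lemma cycle_sum_nonneg: "0 \<le> cycle_sum s d"
  unfolding cycle_sum_def by (intro sum_nonneg) auto

text \<open>The 8 collects a 2 from the square of a sum, a 2 from \<open>expect_Sm_square\<close>,
  and a 2 for the two terms of \<open>Bm_eq\<close>. In each term one component of \<open>q\<close>
  is free, giving n; the sum over the other is at most \<open>L\<close>, because entries of modulus
  at most 1 have squares below their moduli.\<close>

lemma expect_Bm_norm_le: "expect (\<lambda>x. (norm (Bm p x))\<^sup>2) \<le> 8 * real CARD('n) * L * cycle_sum s d / (real d)\<^sup>2"
proof -
  let ?V = "2 * cycle_sum s d / (real d)\<^sup>2" and ?n = "real CARD('n)"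
  let ?r = "\<lambda>a. (ent R (fst p, a))\<^sup>2"
  have V: "0 \<le> ?V" using cycle_sum_nonneg by simp
  have tS: "tame T (\<lambda>x. (Sm j b x)\<^sup>2)" for j b
    unfolding power2_eq_square by (intro tame_mult tame_Sm)
  have entry: "expect (\<lambda>x. (ent (Bm p x) q)\<^sup>2) \<le> 2 * ?V * (?r (fst q) + ?r (snd q))" for q
  proof -
    let ?a = "ent R (fst p, fst q)" and ?b = "ent R (fst p, snd q)"
    have "expect (\<lambda>x. (ent (Bm p x) q)\<^sup>2)
      \<le> expect (\<lambda>x. (2 * ?a\<^sup>2) * (Sm (snd p) (snd q) x)\<^sup>2 + (2 * ?b\<^sup>2) * (Sm (snd p) (fst q) x)\<^sup>2)"
    proof (rule expect_mono)
      fix x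
      have "(ent (Bm p x) q)\<^sup>2 = (?a * Sm (snd p) (snd q) x + ?b * Sm (snd p) (fst q) x)\<^sup>2"
        unfolding Bm_eq by (simp only: power2_minus)
      also have "\<dots> \<le> 2 * (?a * Sm (snd p) (snd q) x)\<^sup>2 + 2 * (?b * Sm (snd p) (fst q) x)\<^sup>2"
        using sum_squares_bound[of "?a * Sm (snd p) (snd q) x" "?b * Sm (snd p) (fst q) x"]
        by (simp add: power2_sum)
      finally show "(ent (Bm p x) q)\<^sup>2 \<le> (2 * ?a\<^sup>2) * (Sm (snd p) (snd q) x)\<^sup>2 + (2 * ?b\<^sup>2) * (Sm (snd p) (fst q) x)\<^sup>2"
        by (simp add: power_mult_distrib)
    next
      show "tame T (\<lambda>x. (ent (Bm p x) q)\<^sup>2)" unfolding power2_eq_square by (intro tame_mult tame_Bm)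
    qed (intro tame_add tame_mult tame_const tS)
    also have "\<dots> = (2 * ?a\<^sup>2) * expect (\<lambda>x. (Sm (snd p) (snd q) x)\<^sup>2) + (2 * ?b\<^sup>2) * expect (\<lambda>x. (Sm (snd p) (fst q) x)\<^sup>2)"
      by (subst expect_add) (auto intro!: tame_mult tS simp: expect_cmult)
    also have "\<dots> \<le> (2 * ?a\<^sup>2) * ?V + (2 * ?b\<^sup>2) * ?V"
      by (intro add_mono mult_left_mono expect_Sm_square) auto
    finally show ?thesis by (simp add: algebra_simps)
  qed
  have rows: "(\<Sum>a\<in>UNIV. ?r a) \<le> L"
  proof -
    have "?r a \<le> \<bar>ent R (fst p, a)\<bar>" for a
      using mult_left_le[of "\<bar>ent R (fst p, a)\<bar>" "\<bar>ent R (fst p, a)\<bar>"] R_le_1[of "(fst p, a)"]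
      by (simp add: power2_eq_square)
    then have "(\<Sum>a\<in>UNIV. ?r a) \<le> (\<Sum>a\<in>UNIV. \<bar>ent R (fst p, a)\<bar>)" by (intro sum_mono)
    also have "\<dots> \<le> L" by (rule R_rows)
    finally show ?thesis .
  qed
  have "expect (\<lambda>x. (norm (Bm p x))\<^sup>2) = (\<Sum>q\<in>UNIV. expect (\<lambda>x. (ent (Bm p x) q)\<^sup>2))"
    unfolding norm_matrix_ent by (subst expect_sum) (auto intro!: tame_mult tame_Bm simp: power2_eq_square)
  also have "\<dots> \<le> (\<Sum>q\<in>UNIV. 2 * ?V * (?r (fst q) + ?r (snd q)))"
    by (intro sum_mono entry)
  also have "\<dots> = 2 * ?V * (2 * ?n * (\<Sum>a\<in>UNIV. ?r a))"
    by (simp only: sum_pairs sum.distrib fst_conv snd_conv sum_distrib_left[symmetric])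
       (simp add: sum_distrib_left)
  also have "\<dots> \<le> 2 * ?V * (2 * ?n * L)"
    using V by (intro mult_left_mono rows) auto
  finally show ?thesis by (simp add: mult_ac)
qed

lemma expect_Dm_norm_le:
  "expect (\<lambda>x. (norm (Dm x))\<^sup>2) \<le> 4 * real CARD('n) ^ 3 * L * cycle_sum s d / ((real d)\<^sup>2 * \<gamma>\<^sup>2)"
proof -
  let ?n = "real CARD('n)"
  have "expect (\<lambda>x. (norm (Dm x))\<^sup>2) = (\<Sum>p\<in>UNIV. expect (\<lambda>x. (ent (Dm x) p)\<^sup>2))"
    unfolding norm_matrix_ent by (subst expect_sum) (auto intro!: tame_mult tame_Dm simp: power2_eq_square)
  also have "\<dots> \<le> (\<Sum>p\<in>(UNIV :: ('n \<times> 'n) set). (8 * ?n * L * cycle_sum s d / (real d)\<^sup>2) / (2 * \<gamma>\<^sup>2))"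
    by (intro sum_mono order_trans[OF expect_Dm_square_le] divide_right_mono expect_Bm_norm_le) auto
  also have "\<dots> = 4 * ?n ^ 3 * L * cycle_sum s d / ((real d)\<^sup>2 * \<gamma>\<^sup>2)"
    by (simp add: card_prod power3_eq_cube mult_ac)
  finally show ?thesis .
qed

text \<open>The Hessian has been integrated away: only \<open>Dm\<close> paired with a gradient of
  norm at most 1 remains.\<close>

lemma expect_inner_path_le:
  assumes C2: "C2_contraction g h H" and V: "0 < V" "expect (\<lambda>x. (norm (Dm x))\<^sup>2) \<le> V" and c: "0 \<le> c"
  shows "expect (\<lambda>x. h (U c \<sigma> x) \<bullet> (c *\<^sub>R Gm x - \<sigma> *\<^sub>R Wm x)) \<le> c * sqrt V"
proof -
  let ?h = "\<lambda>p x. ent (h (U c \<sigma> x)) p"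
  note th = tame_h[OF C2]
  have tW: "tame T (\<lambda>x. ent (Wm x) p)" for p
    unfolding Wm_def ent_mat_of by (intro tame_mult tame_const tame_sum tame_diff) auto
  have "expect (\<lambda>x. h (U c \<sigma> x) \<bullet> (c *\<^sub>R Gm x - \<sigma> *\<^sub>R Wm x))
    = expect (\<lambda>x. \<Sum>p\<in>UNIV. c * (x (Inr p) * ?h p x) - \<sigma> * (ent (Wm x) p * ?h p x))"
    by (rule arg_cong[where f=expect], rule ext) (simp add: inner_matrix Gm_def right_diff_distrib mult_ac)
  also have "\<dots> = (\<Sum>p\<in>UNIV. c * expect (\<lambda>x. ent (Dm x) p * ?h p x))"
    by (subst expect_sum) (auto intro!: tame_diff tame_mult tame_const th tW tame_x Inr_mem simp: expect_interpolation[OF C2])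
  also have "\<dots> = c * expect (\<lambda>x. Dm x \<bullet> h (U c \<sigma> x))"
    unfolding inner_matrix by (subst expect_sum) (auto intro!: tame_mult tame_Dm th simp: sum_distrib_left)
  also have "\<dots> \<le> c * sqrt V"
  proof (rule mult_left_mono[OF _ c])
    \<comment> \<open>AM-GM with weight \<open>sqrt V\<close> stands in for Cauchy-Schwarz on the
      probability space and gives the same bound; it needs V > 0.\<close>
    have "expect (\<lambda>x. Dm x \<bullet> h (U c \<sigma> x)) \<le> expect (\<lambda>x. sqrt V / 2 + 1 / (2 * sqrt V) * (norm (Dm x))\<^sup>2)"
    proof (rule expect_mono)
      show "tame T (\<lambda>x. Dm x \<bullet> h (U c \<sigma> x))"
        unfolding inner_matrix by (intro tame_sum tame_mult tame_Dm th)
      show "tame T (\<lambda>x. sqrt V / 2 + 1 / (2 * sqrt V) * (norm (Dm x))\<^sup>2)"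
        by (intro tame_add tame_mult tame_const tame_norm_Dm)
      fix x
      have "Dm x \<bullet> h (U c \<sigma> x) \<le> norm (Dm x) * norm (h (U c \<sigma> x))" by (rule norm_cauchy_schwarz)
      also have "\<dots> \<le> norm (Dm x)" using norm_h[OF C2] by (intro mult_left_le) auto
      also have "\<dots> \<le> sqrt V / 2 + 1 / (2 * sqrt V) * (norm (Dm x))\<^sup>2"
        using V(1) sum_squares_bound[of "sqrt V" "norm (Dm x)"] by (simp add: field_simps power2_eq_square)
      finally show "Dm x \<bullet> h (U c \<sigma> x) \<le> sqrt V / 2 + 1 / (2 * sqrt V) * (norm (Dm x))\<^sup>2" .
    qed
    also have "\<dots> = sqrt V / 2 + 1 / (2 * sqrt V) * expect (\<lambda>x. (norm (Dm x))\<^sup>2)"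
      by (subst expect_add) (auto intro!: tame_const tame_mult tame_norm_Dm simp: expect_const expect_cmult simp del: times_divide_eq_left)
    also have "\<dots> \<le> sqrt V / 2 + 1 / (2 * sqrt V) * V"
      using V by (intro add_left_mono mult_left_mono) auto
    also have "\<dots> = sqrt V" using V(1) by (simp add: real_div_sqrt field_simps)
    finally show "expect (\<lambda>x. Dm x \<bullet> h (U c \<sigma> x)) \<le> sqrt V" .
  qed
  finally show ?thesis .
qed

lemma tame_norm_U: "tame T (\<lambda>x. norm (U c \<sigma> x))"
proof (rule tame_bounded)
  show "(\<lambda>x. norm (U c \<sigma> x)) \<in> borel_measurable (PiM T (\<lambda>_. borel))"
    using measurable_U by simp
  show "tame T (\<lambda>x. 1 + (\<Sum>p\<in>UNIV. ent (U c \<sigma> x) p * ent (U c \<sigma> x) p))"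
    by (intro tame_add tame_sum tame_mult tame_const tame_ent_U)
  fix x
  have "norm (U c \<sigma> x) \<le> 1 + (norm (U c \<sigma> x))\<^sup>2"
    using sum_squares_bound[of 1 "norm (U c \<sigma> x)"] norm_ge_zero[of "U c \<sigma> x"] by (simp del: norm_ge_zero)
  then show "\<bar>norm (U c \<sigma> x)\<bar> \<le> \<bar>1 + (\<Sum>p\<in>UNIV. ent (U c \<sigma> x) p * ent (U c \<sigma> x) p)\<bar>"
    unfolding norm_matrix_ent by (simp add: power2_eq_square)
qed (simp add: U_restrict)

lemma U_1_0: "U 1 0 x = Wm x" and U_0_1: "U 0 1 x = Gm x"
  by (simp_all add: U_def)

lemma tame_norm_Wm: "tame T (\<lambda>x. norm (Wm x))" and tame_norm_Gm: "tame T (\<lambda>x. norm (Gm x))"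
  using tame_norm_U[of 1 0] tame_norm_U[of 0 1] by (simp_all only: U_1_0 U_0_1)

text \<open>The path \<open>cos t *\<^sub>R Wm + sin t *\<^sub>R Gm\<close> leads from \<open>Wm\<close> to \<open>Gm\<close>, and \<open>cos\<close> has integral \<open>1\<close> over it.\<close>

lemma expect_contraction_diff_le:
  assumes C2: "C2_contraction g h H" and V: "0 < V" "expect (\<lambda>x. (norm (Dm x))\<^sup>2) \<le> V"
  shows "expect (\<lambda>x. g (Gm x) - g (Wm x)) \<le> sqrt V"
proof -
  let ?X = "\<lambda>\<omega> t. X t \<omega>"
  define F where "F = (\<lambda>t \<omega>. h (U (cos t) (sin t) (?X \<omega>)) \<bullet> (cos t *\<^sub>R Gm (?X \<omega>) - sin t *\<^sub>R Wm (?X \<omega>)))"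
  let ?I = "{0..pi/2}"
  interpret PL: pair_sigma_finite P lborel ..
  have meas_ent: "(\<lambda>\<omega>. f (?X \<omega>)) \<in> borel_measurable P" if "f \<in> borel_measurable (PiM T (\<lambda>_. borel))" "\<And>x. f (restrict x T) = f x" for f :: "_ \<Rightarrow> real^'n^'n"
  proof -
    note [measurable] = that(1)
    have "(\<lambda>\<omega>. f (restrict (?X \<omega>) T)) \<in> borel_measurable P" by measurable
    then show ?thesis by (simp only: that(2))
  qed
  have [measurable]: "(\<lambda>\<omega>. Wm (?X \<omega>)) \<in> borel_measurable P" "(\<lambda>\<omega>. Gm (?X \<omega>)) \<in> borel_measurable P"
    using meas_ent[OF measurable_U[of 1 0] U_restrict] meas_ent[OF measurable_U[of 0 1] U_restrict]
    by (simp_all only: U_1_0 U_0_1)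
  have [measurable]: "h \<in> borel_measurable borel"
    by (rule borel_measurable_continuous_onI[OF cont_h[OF C2]])
  have [measurable]: "(\<lambda>(\<omega>, t). F t \<omega>) \<in> borel_measurable (P \<Otimes>\<^sub>M lborel)"
    unfolding F_def U_def by measurable
  have F_le: "\<bar>F t \<omega>\<bar> \<le> norm (Gm (?X \<omega>)) + norm (Wm (?X \<omega>))" for t \<omega>
  proof -
    have "\<bar>F t \<omega>\<bar> \<le> norm (h (U (cos t) (sin t) (?X \<omega>))) * norm (cos t *\<^sub>R Gm (?X \<omega>) - sin t *\<^sub>R Wm (?X \<omega>))"
      unfolding F_def by (rule Cauchy_Schwarz_ineq2)
    also have "\<dots> \<le> 1 * norm (cos t *\<^sub>R Gm (?X \<omega>) - sin t *\<^sub>R Wm (?X \<omega>))"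
      by (intro mult_right_mono norm_h[OF C2]) auto
    also have "\<dots> \<le> \<bar>cos t\<bar> * norm (Gm (?X \<omega>)) + \<bar>sin t\<bar> * norm (Wm (?X \<omega>))"
      using norm_triangle_ineq4[of "cos t *\<^sub>R Gm (?X \<omega>)" "sin t *\<^sub>R Wm (?X \<omega>)"] by simp
    also have "\<dots> \<le> 1 * norm (Gm (?X \<omega>)) + 1 * norm (Wm (?X \<omega>))"
      by (intro add_mono mult_right_mono) auto
    finally show ?thesis by simp
  qed
  have FTC: "has_bochner_integral lborel (\<lambda>t. indicator ?I t *\<^sub>R F t \<omega>) (g (Gm (?X \<omega>)) - g (Wm (?X \<omega>)))" for \<omega>
  proof -
    let ?u = "\<lambda>t. U (cos t) (sin t) (?X \<omega>)"
    have du: "(?u has_derivative (\<lambda>e. e *\<^sub>R (cos t *\<^sub>R Gm (?X \<omega>) - sin t *\<^sub>R Wm (?X \<omega>)))) (at t)" for t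
      unfolding U_def by (auto intro!: derivative_eq_intros simp: fun_eq_iff scaleR_diff_right mult.commute)
    have dg: "((\<lambda>t. g (?u t)) has_vector_derivative F t \<omega>) (at t)" for t
    proof -
      have "((\<lambda>t. g (?u t)) has_derivative (\<lambda>e. h (?u t) \<bullet> (e *\<^sub>R (cos t *\<^sub>R Gm (?X \<omega>) - sin t *\<^sub>R Wm (?X \<omega>))))) (at t)"
        using diff_chain_at[OF du[of t], of g "\<lambda>v. h (?u t) \<bullet> v"] g_deriv[OF C2] by (simp add: comp_def)
      then show ?thesis
        unfolding has_vector_derivative_def F_def by (rule has_derivative_eq_rhs) (simp add: fun_eq_iff)
    qed
    have "has_bochner_integral lborel (\<lambda>t. indicator ?I t *\<^sub>R F t \<omega>) (g (?u (pi/2)) - g (?u 0))"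
    proof (rule has_bochner_integral_FTC_Icc)
      show "((\<lambda>t. g (?u t)) has_vector_derivative F t \<omega>) (at t within ?I)" for t
        by (rule has_vector_derivative_at_within[OF dg])
      have "continuous_on UNIV ?u" unfolding U_def by (intro continuous_intros)
      then have "continuous_on UNIV (\<lambda>t. h (?u t))"
        by (rule continuous_on_compose2[OF cont_h[OF C2]]) auto
      then have "continuous_on UNIV (\<lambda>t. F t \<omega>)"
        unfolding F_def by (intro continuous_intros)
      then show "continuous_on ?I (\<lambda>t. F t \<omega>)" by (rule continuous_on_subset) auto
    qed auto
    then show ?thesis by (simp add: U_1_0 U_0_1)
  qed
  have intb: "integrable P (\<lambda>\<omega>. norm (Gm (?X \<omega>)) + norm (Wm (?X \<omega>)))"
    using integrable_tame[OF tame_add[OF tame_norm_Gm tame_norm_Wm]] by simp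
  \<comment> \<open>On the bounded time interval the integrand is dominated by a sum of norms that
    does not depend on t, which permits Fubini.\<close>
  have int2: "integrable (P \<Otimes>\<^sub>M lborel) (\<lambda>(\<omega>, t). indicator ?I t *\<^sub>R F t \<omega>)"
  proof (rule Bochner_Integration.integrable_bound)
    show "integrable (P \<Otimes>\<^sub>M lborel) (\<lambda>(\<omega>, t). indicator ?I t * (norm (Gm (?X \<omega>)) + norm (Wm (?X \<omega>))))"
    proof (rule PL.Fubini_integrable)
      show "integrable P (\<lambda>\<omega>. \<integral>t. norm (case (\<omega>, t) of (\<omega>, t) \<Rightarrow> indicator ?I t * (norm (Gm (?X \<omega>)) + norm (Wm (?X \<omega>)))) \<partial>lborel)"
        using intb by (simp add: abs_mult)
    qed auto
    show "AE z in P \<Otimes>\<^sub>M lborel. norm (case z of (\<omega>, t) \<Rightarrow> indicator ?I t *\<^sub>R F t \<omega>)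
        \<le> norm (case z of (\<omega>, t) \<Rightarrow> indicator ?I t * (norm (Gm (?X \<omega>)) + norm (Wm (?X \<omega>))))"
      using F_le by (intro AE_I2) (auto simp: indicator_def split: prod.split)
  qed measurable
  have "expect (\<lambda>x. g (Gm x) - g (Wm x)) = (\<integral>\<omega>. (\<integral>t. indicator ?I t *\<^sub>R F t \<omega> \<partial>lborel) \<partial>P)"
    unfolding expect_def using FTC by (simp add: has_bochner_integral_iff)
  also have "\<dots> = (\<integral>t. (\<integral>\<omega>. indicator ?I t *\<^sub>R F t \<omega> \<partial>P) \<partial>lborel)"
    using PL.Fubini_integral[OF int2] by simp
  also have "\<dots> \<le> (\<integral>t. indicator ?I t *\<^sub>R (cos t * sqrt V) \<partial>lborel)"
  proof (rule integral_mono)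
    show "integrable lborel (\<lambda>t. \<integral>\<omega>. indicator ?I t *\<^sub>R F t \<omega> \<partial>P)"
      using PL.integrable_snd[OF int2] by simp
    show "integrable lborel (\<lambda>t. indicator ?I t *\<^sub>R (cos t * sqrt V))"
      by (rule borel_integrable_compact) (auto intro!: continuous_intros)
    fix t
    show "(\<integral>\<omega>. indicator ?I t *\<^sub>R F t \<omega> \<partial>P) \<le> indicator ?I t *\<^sub>R (cos t * sqrt V)"
    proof (cases "t \<in> ?I")
      case True
      \<comment> \<open>The estimate at a fixed time requires a nonnegative coefficient of G; this
        is why the path stops at pi/2.\<close>
      then have "0 \<le> cos t" by (intro cos_ge_zero) auto
      from expect_inner_path_le[OF C2 V this, of "sin t"] True
      show ?thesis by (simp add: expect_def F_def)
    qed simp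
  qed
  also have "\<dots> = sqrt V"
  proof -
    have "has_bochner_integral lborel (\<lambda>t. indicator ?I t *\<^sub>R (cos t * sqrt V)) (sin (pi/2) * sqrt V - sin 0 * sqrt V)"
      by (rule has_bochner_integral_FTC_Icc)
         (auto intro!: derivative_eq_intros continuous_intros simp flip: has_real_derivative_iff_has_vector_derivative)
    then show ?thesis by (simp add: has_bochner_integral_iff)
  qed
  finally show ?thesis .
qed

end

subsection \<open>Lipschitz test functions\<close>

lemma C2_contraction_lipschitz:
  assumes "C2_contraction g h H"
  shows "\<bar>g a - g b\<bar> \<le> norm (a - b)"
proof -
  have "norm (g a - g b) \<le> 1 * norm (a - b)"
  proof (rule differentiable_bound)
    fix x
    show "(g has_derivative (\<lambda>v. h x \<bullet> v)) (at x within UNIV)"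
      using assms by (simp add: C2_contraction_def)
    have "norm (h x) \<le> 1" using assms by (simp add: C2_contraction_def)
    then have "norm (h x) * norm v \<le> 1 * norm v" for v by (intro mult_right_mono) auto
    then have "norm (h x \<bullet> v) \<le> 1 * norm v" for v
      using Cauchy_Schwarz_ineq2[of "h x" v] order_trans by (simp, blast)
    then show "onorm (\<lambda>v. h x \<bullet> v) \<le> 1" by (intro onorm_bound) auto
  qed auto
  then show ?thesis by simp
qed

context coercive_wishart
begin

lemma tame_lipschitz_U:
  assumes g: "1-lipschitz_on UNIV g"
  shows "tame T (\<lambda>x. g (U c \<sigma> x) :: real)"
proof (rule tame_bounded)
  have "continuous_on UNIV g" using g by (rule lipschitz_on_continuous_on)
  then have "g \<in> borel_measurable borel" by (rule borel_measurable_continuous_onI)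
  then show "(\<lambda>x. g (U c \<sigma> x)) \<in> borel_measurable (PiM T (\<lambda>_. borel))"
    using measurable_U by (rule measurable_compose[rotated])
  show "tame T (\<lambda>x. \<bar>g 0\<bar> + norm (U c \<sigma> x))" by (intro tame_add tame_const tame_norm_U)
  show "\<bar>g (U c \<sigma> x)\<bar> \<le> \<bar>\<bar>g 0\<bar> + norm (U c \<sigma> x)\<bar>" for x
    using lipschitz_onD[OF g, of "U c \<sigma> x" 0] by (simp add: dist_norm)
qed (simp add: U_restrict)

lemma tame_lipschitz_Wm: "1-lipschitz_on UNIV g \<Longrightarrow> tame T (\<lambda>x. g (Wm x) :: real)"
  and tame_lipschitz_Gm: "1-lipschitz_on UNIV g \<Longrightarrow> tame T (\<lambda>x. g (Gm x) :: real)"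
  using tame_lipschitz_U[of g 1 0] tame_lipschitz_U[of g 0 1] by (simp_all only: U_1_0 U_0_1)

text \<open>The bound for smooth contractions does not see their Hessians, so it passes to the
  pointwise limit; the common Lipschitz constant 1 supplies the dominating function.\<close>

lemma expect_lipschitz_diff_le:
  assumes g: "1-lipschitz_on UNIV g" and V: "0 < V" "expect (\<lambda>x. (norm (Dm x))\<^sup>2) \<le> V"
  shows "expect (\<lambda>x. g (Gm x) - g (Wm x)) \<le> sqrt V"
proof -
  obtain G h H where C2: "\<And>m. C2_contraction (G m) (h m) (H m)" and lim: "\<And>x. (\<lambda>m. G m x) \<longlonglongrightarrow> g x"
    using lipschitz_pointwise_limit_of_C2_contractions[OF g] by blast
  have G: "1-lipschitz_on UNIV (G m)" for m
    by (rule lipschitz_onI) (use C2_contraction_lipschitz[OF C2] in \<open>auto simp: dist_norm\<close>)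
  have "(\<lambda>m. expect (\<lambda>x. G m (Gm x) - G m (Wm x))) \<longlonglongrightarrow> expect (\<lambda>x. g (Gm x) - g (Wm x))"
    unfolding expect_def
  proof (rule integral_dominated_convergence)
    show "integrable P (\<lambda>\<omega>. norm (Gm (\<lambda>t. X t \<omega>)) + norm (Wm (\<lambda>t. X t \<omega>)))"
      using integrable_tame[OF tame_add[OF tame_norm_Gm tame_norm_Wm]] by simp
    show "(\<lambda>\<omega>. g (Gm (\<lambda>t. X t \<omega>)) - g (Wm (\<lambda>t. X t \<omega>))) \<in> borel_measurable P"
      using measurable_tame[OF tame_diff[OF tame_lipschitz_Gm[OF g] tame_lipschitz_Wm[OF g]]] .
    show "(\<lambda>\<omega>. G m (Gm (\<lambda>t. X t \<omega>)) - G m (Wm (\<lambda>t. X t \<omega>))) \<in> borel_measurable P" for m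
      using measurable_tame[OF tame_diff[OF tame_lipschitz_Gm[OF G] tame_lipschitz_Wm[OF G]]] .
    show "AE \<omega> in P. (\<lambda>m. G m (Gm (\<lambda>t. X t \<omega>)) - G m (Wm (\<lambda>t. X t \<omega>)))
        \<longlonglongrightarrow> g (Gm (\<lambda>t. X t \<omega>)) - g (Wm (\<lambda>t. X t \<omega>))"
      by (intro AE_I2 tendsto_diff lim)
    show "AE \<omega> in P. norm (G m (Gm (\<lambda>t. X t \<omega>)) - G m (Wm (\<lambda>t. X t \<omega>)))
        \<le> norm (Gm (\<lambda>t. X t \<omega>)) + norm (Wm (\<lambda>t. X t \<omega>))" for m
      using C2_contraction_lipschitz[OF C2] norm_triangle_ineq4 order_trans by (intro AE_I2) (simp, blast)
  qed
  then show ?thesis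
    by (rule LIMSEQ_le_const2) (use expect_contraction_diff_le[OF C2 V] in blast)
qed

text \<open>The path runs from W to G, while the distance takes W minus G; the class of test
  functions is closed under negation.\<close>

lemma expect_lipschitz_diff_le_swapped:
  assumes g: "1-lipschitz_on UNIV g" and V: "0 < V" "expect (\<lambda>x. (norm (Dm x))\<^sup>2) \<le> V"
  shows "expect (\<lambda>x. g (Wm x)) - expect (\<lambda>x. g (Gm x)) \<le> sqrt V"
proof -
  have "1-lipschitz_on UNIV (\<lambda>x. - g x)"
    using g unfolding lipschitz_on_def by (simp add: dist_norm abs_minus_commute)
  from expect_lipschitz_diff_le[OF this V] show ?thesis
    by (simp add: expect_diff tame_lipschitz_Wm tame_lipschitz_Gm g flip: expect_diff)
qed

end

subsection \<open>From Gaussian families to Gaussian vectors\<close>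

lemma std_normal_moments:
  "(\<integral>x. x \<partial>std_normal_distribution) = 0" "(\<integral>x. x\<^sup>2 \<partial>std_normal_distribution) = 1"
  "integrable std_normal_distribution (\<lambda>x. x\<^sup>2)"
proof -
  show "integrable std_normal_distribution (\<lambda>x. x\<^sup>2)"
    by (rule integrable_std_normal_distribution_moment)
  interpret prob_space std_normal_distribution by (rule prob_space_normal_density) simp
  have "(\<integral>x. x * x \<partial>std_normal_distribution) = (\<integral>x. 1 \<partial>std_normal_distribution)"
    by (rule std_normal_integration_by_parts[where B=1 and p=1 and B'=1 and p'=0]) auto
  then show "(\<integral>x. x\<^sup>2 \<partial>std_normal_distribution) = 1" using prob_space by (simp add: power2_eq_square)
  have "(\<integral>x. x * 1 \<partial>std_normal_distribution) = (\<integral>x. 0 \<partial>std_normal_distribution)"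
    by (rule std_normal_integration_by_parts[where B=1 and p=0 and B'=1 and p'=0]) auto
  then show "(\<integral>x. x \<partial>std_normal_distribution) = 0" by simp
qed

text \<open>The unspecified \<sigma> in the definition is identified as the root of the second
  moment, so the characteristic function can be written through moments alone.\<close>

lemma centered_gaussian_family_combination:
  fixes c :: "'t \<Rightarrow> real"
  assumes X: "centered_gaussian_family M X" and S: "finite S"
  defines "Y \<equiv> \<lambda>\<omega>. \<Sum>t\<in>S. c t * X t \<omega>"
  shows "integrable M (\<lambda>\<omega>. (Y \<omega>)\<^sup>2)" "(\<integral>\<omega>. Y \<omega> \<partial>M) = 0"
    "(\<integral>\<omega>. iexp (Y \<omega>) \<partial>M) = of_real (exp (- (\<integral>\<omega>. (Y \<omega>)\<^sup>2 \<partial>M) / 2))"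
proof -
  have [measurable]: "Y \<in> borel_measurable M"
    using X unfolding Y_def centered_gaussian_family_def by (intro borel_measurable_sum borel_measurable_times) auto
  obtain \<sigma> where \<sigma>: "\<sigma> \<ge> 0" "distr M borel Y = centered_normal \<sigma>"
    using X S unfolding centered_gaussian_family_def Y_def by blast
  note law = \<sigma>(2)[unfolded centered_normal_eq_distr[OF \<sigma>(1)]]
  have "integrable (distr M borel Y) (\<lambda>x. x\<^sup>2)"
    unfolding law by (subst integrable_distr_eq) (auto simp: power_mult_distrib std_normal_moments)
  then show "integrable M (\<lambda>\<omega>. (Y \<omega>)\<^sup>2)" by (subst (asm) integrable_distr_eq) auto
  have "(\<integral>\<omega>. Y \<omega> \<partial>M) = (\<integral>x. x \<partial>distr M borel Y)" by (subst integral_distr) auto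
  also have "\<dots> = 0" unfolding law by (subst integral_distr) (auto simp: std_normal_moments)
  finally show "(\<integral>\<omega>. Y \<omega> \<partial>M) = 0" .
  have "(\<integral>\<omega>. (Y \<omega>)\<^sup>2 \<partial>M) = (\<integral>x. x\<^sup>2 \<partial>distr M borel Y)" by (subst integral_distr) auto
  also have "\<dots> = \<sigma>\<^sup>2" unfolding law by (subst integral_distr) (auto simp: power_mult_distrib std_normal_moments)
  finally have var: "(\<integral>\<omega>. (Y \<omega>)\<^sup>2 \<partial>M) = \<sigma>\<^sup>2" .
  have "(\<integral>\<omega>. iexp (Y \<omega>) \<partial>M) = char (distr M borel Y) 1"
    unfolding char_def by (subst integral_distr) auto
  also have "\<dots> = exp (of_real (- (\<sigma>\<^sup>2 * 1\<^sup>2) / 2))"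
    unfolding \<sigma>(2) by (rule char_centered_normal[OF \<sigma>(1)])
  finally show "(\<integral>\<omega>. iexp (Y \<omega>) \<partial>M) = of_real (exp (- (\<integral>\<omega>. (Y \<omega>)\<^sup>2 \<partial>M) / 2))"
    unfolding var by (simp only: exp_of_real power_one mult_1_right)
qed

text \<open>Indices with the same image have their coefficients added up; \<open>f\<close> may fail
  to be injective, as different e_ij can be the same vector.\<close>

lemma centered_gaussian_family_comp:
  fixes f :: "'s \<Rightarrow> 't"
  assumes X: "centered_gaussian_family M X"
  shows "centered_gaussian_family M (\<lambda>t. X (f t))"
  unfolding centered_gaussian_family_def
proof (intro conjI allI impI)
  show "X (f t) \<in> borel_measurable M" for t using X by (simp add: centered_gaussian_family_def)
  fix S :: "'s set" and c :: "'s \<Rightarrow> real" assume S: "finite S"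
  have "(\<Sum>t\<in>S. c t * X (f t) \<omega>) = (\<Sum>h\<in>f ` S. (\<Sum>t\<in>{t\<in>S. f t = h}. c t) * X h \<omega>)" for \<omega>
    by (subst sum.image_gen[OF S, of _ f]) (auto simp: sum_distrib_right intro!: sum.cong)
  then show "\<exists>\<sigma>\<ge>0. distr M borel (\<lambda>\<omega>. \<Sum>t\<in>S. c t * X (f t) \<omega>) = centered_normal \<sigma>"
    using X S unfolding centered_gaussian_family_def by simp
qed

lemma gaussian_vectorI:
  fixes T :: "'t set"
  assumes "prob_space M" and X: "centered_gaussian_family M X" and T: "finite T"
    and K: "\<And>s t. s \<in> T \<Longrightarrow> t \<in> T \<Longrightarrow> (\<integral>\<omega>. X s \<omega> * X t \<omega> \<partial>M) = K s t"
  shows "gaussian_vector M T K X"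
proof -
  interpret prob_space M by fact
  show ?thesis
  proof
    show "finite T" by fact
    show [measurable]: "X t \<in> borel_measurable M" for t using X by (simp add: centered_gaussian_family_def)
    show "K s t = K t s" if "s \<in> T" "t \<in> T" for s t
      using K[OF that] K[OF that(2) that(1)] by (simp add: mult.commute)
    fix u :: "'t \<Rightarrow> real"
    have sq: "integrable M (\<lambda>\<omega>. (X t \<omega>)\<^sup>2)" for t
      using centered_gaussian_family_combination(1)[OF X, of "{t}" "\<lambda>_. 1"] by simp
    have int: "integrable M (\<lambda>\<omega>. X s \<omega> * X t \<omega>)" for s t
    proof (rule Bochner_Integration.integrable_bound)
      show "integrable M (\<lambda>\<omega>. (X s \<omega>)\<^sup>2 + (X t \<omega>)\<^sup>2)" by (intro Bochner_Integration.integrable_add sq)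
      have "\<bar>a * b\<bar> \<le> \<bar>a\<^sup>2 + b\<^sup>2\<bar>" for a b :: real
        using sum_squares_bound[of "\<bar>a\<bar>" "\<bar>b\<bar>"] abs_ge_zero[of "a * b"]
        unfolding abs_mult power2_abs mult.assoc by linarith
      then show "AE \<omega> in M. norm (X s \<omega> * X t \<omega>) \<le> norm ((X s \<omega>)\<^sup>2 + (X t \<omega>)\<^sup>2)" by simp
    qed simp
    have "(\<integral>\<omega>. (\<Sum>t\<in>T. u t * X t \<omega>)\<^sup>2 \<partial>M) = (\<integral>\<omega>. (\<Sum>s\<in>T. \<Sum>t\<in>T. (u s * u t) * (X s \<omega> * X t \<omega>)) \<partial>M)"
      by (simp add: power2_eq_square sum_product mult_ac)
    also have "\<dots> = (\<Sum>s\<in>T. \<Sum>t\<in>T. u s * u t * K s t)"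
      by (simp add: Bochner_Integration.integral_sum Bochner_Integration.integrable_sum int K)
    finally show "(\<integral>\<omega>. iexp (\<Sum>t\<in>T. u t * X t \<omega>) \<partial>M)
        = of_real (exp (- (\<Sum>s\<in>T. \<Sum>t\<in>T. u s * u t * K s t) / 2))"
      using centered_gaussian_family_combination(3)[OF X T, of u] by simp
  qed
qed

text \<open>Independence on the product space makes the characteristic function factor, which
  matches a block diagonal covariance. Both matrices thus become functions of one Gaussian
  vector.\<close>

lemma gaussian_vector_pair:
  fixes A :: "'s set" and B :: "'t set"
  assumes M: "gaussian_vector M A K1 X" and N: "gaussian_vector N B K2 Y"
    and K: "\<And>s t. K (Inl s) (Inl t) = K1 s t" "\<And>s t. K (Inr s) (Inr t) = K2 s t"
      "\<And>s t. K (Inl s) (Inr t) = 0" "\<And>s t. K (Inr s) (Inl t) = 0"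
  shows "gaussian_vector (M \<Otimes>\<^sub>M N) (Inl ` A \<union> Inr ` B) K (\<lambda>t \<omega>. case t of Inl s \<Rightarrow> X s (fst \<omega>) | Inr s \<Rightarrow> Y s (snd \<omega>))"
proof -
  interpret M: gaussian_vector M A K1 X by fact
  interpret N: gaussian_vector N B K2 Y by fact
  interpret pair_prob_space M N ..
  let ?Z = "\<lambda>t \<omega>. case t of Inl s \<Rightarrow> X s (fst \<omega>) | Inr s \<Rightarrow> Y s (snd \<omega>)"
  let ?I = "Inl ` A \<union> Inr ` B"
  have [measurable]: "?Z t \<in> borel_measurable (M \<Otimes>\<^sub>M N)" if "t \<in> ?I" for t
    using that M.measurable_X N.measurable_X by auto
  have sumI: "(\<Sum>t\<in>?I. f t) = (\<Sum>s\<in>A. f (Inl s)) + (\<Sum>s\<in>B. f (Inr s))" for f :: "_ \<Rightarrow> real"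
    using M.finite_index N.finite_index by (subst sum.union_disjoint) (auto simp: sum.reindex)
  show ?thesis
  proof
    show "finite ?I" using M.finite_index N.finite_index by simp
    show "?Z t \<in> borel_measurable (M \<Otimes>\<^sub>M N)" if "t \<in> ?I" for t using that by simp
    show "K s t = K t s" if "s \<in> ?I" "t \<in> ?I" for s t
      using that M.K_sym N.K_sym by (auto simp: K)
    fix u :: "'s + 't \<Rightarrow> real"
    let ?x = "\<lambda>\<omega>. iexp (\<Sum>s\<in>A. u (Inl s) * X s \<omega>)" and ?y = "\<lambda>\<omega>. iexp (\<Sum>s\<in>B. u (Inr s) * Y s \<omega>)"
    have split: "iexp (\<Sum>t\<in>?I. u t * ?Z t (a, b)) = ?x a * ?y b" for a b
      unfolding sumI by (simp add: exp_add distrib_left)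
    have "(\<integral>\<omega>. iexp (\<Sum>t\<in>?I. u t * ?Z t \<omega>) \<partial>(M \<Otimes>\<^sub>M N)) = (\<integral>a. (\<integral>b. iexp (\<Sum>t\<in>?I. u t * ?Z t (a, b)) \<partial>N) \<partial>M)"
      by (rule integral_fst'[symmetric], rule P.integrable_iexp) measurable
    also have "\<dots> = (\<integral>a. ?x a \<partial>M) * (\<integral>b. ?y b \<partial>N)"
      unfolding split by simp
    also have "\<dots> = of_real (exp (- (\<Sum>s\<in>?I. \<Sum>t\<in>?I. u s * u t * K s t) / 2))"
      unfolding M.char_X N.char_X sumI by (simp add: K exp_add[symmetric] add_divide_distrib flip: of_real_mult)
    finally show "(\<integral>\<omega>. iexp (\<Sum>t\<in>?I. u t * ?Z t \<omega>) \<partial>(M \<Otimes>\<^sub>M N))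
        = of_real (exp (- (\<Sum>s\<in>?I. \<Sum>t\<in>?I. u s * u t * K s t) / 2))" .
  qed
qed

text \<open>Centring removes the pairing within each product. The two remaining pairings carry the
  same factor s(k - l)^2, so the sum over k and l separates as
  \<open>variance_factor\<close>.\<close>

lemma wishart_entry_covariance:
  fixes R :: "real^'n^'n" and x :: "'n \<times> nat \<Rightarrow> 'w \<Rightarrow> real"
  assumes gv: "gaussian_vector M (UNIV \<times> {1..d}) (\<lambda>u v. ent R (fst u, fst v) * s (int (snd u) - int (snd v))) x"
    and s0: "s 0 = 1"
  defines "W \<equiv> \<lambda>i j \<omega>. 1 / sqrt (real d) * (\<Sum>k=1..d. x (i, k) \<omega> * x (j, k) \<omega> - ent R (i, j))"
  shows "covariance M (W i j) (W a b) = entry_cov R (variance_factor s d) (i, j) (a, b)"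
proof -
  interpret gaussian_vector M "UNIV \<times> {1..d}" "\<lambda>u v. ent R (fst u, fst v) * s (int (snd u) - int (snd v))" x
    by fact
  let ?T = "(UNIV :: 'n set) \<times> {1..d}"
  define Y where "Y = (\<lambda>i j k \<omega>. x (i, k) \<omega> * x (j, k) \<omega> - ent R (i, j))"
  have tY: "tame ?T (\<lambda>z. z (i, k) * z (j, k) - ent R (i, j))" if "k \<in> {1..d}" for i j k
    using that finite_index by (intro tame_diff tame_mult tame_const tame_component) auto
  have int_prod: "integrable M (\<lambda>\<omega>. x u \<omega> * x v \<omega>)" if "u \<in> ?T" "v \<in> ?T" for u v
    using integrable_tame[OF tame_mult[OF tame_component[OF that(1) finite_index] tame_component[OF that(2) finite_index]]] .
  have int_prod4: "integrable M (\<lambda>\<omega>. x u \<omega> * x v \<omega> * (x w \<omega> * x z \<omega>))" if "u \<in> ?T" "v \<in> ?T" "w \<in> ?T" "z \<in> ?T" for u v w z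
    using integrable_tame[OF tame_mult[OF
        tame_mult[OF tame_component[OF that(1) finite_index] tame_component[OF that(2) finite_index]]
        tame_mult[OF tame_component[OF that(3) finite_index] tame_component[OF that(4) finite_index]]]] .
  have intY: "integrable M (Y i j k)" if "k \<in> {1..d}" for i j k
    using integrable_tame[OF tY[OF that]] by (simp add: Y_def)
  have intYY: "integrable M (\<lambda>\<omega>. Y i j k \<omega> * Y a b l \<omega>)" if "k \<in> {1..d}" "l \<in> {1..d}" for i j k a b l
    using integrable_tame[OF tame_mult[OF tY[OF that(1)] tY[OF that(2)]]] by (simp add: Y_def)
  have meanY: "(\<integral>\<omega>. Y i j k \<omega> \<partial>M) = 0" if "k \<in> {1..d}" for i j k
    unfolding Y_def using that by (subst Bochner_Integration.integral_diff) (auto simp: int_prod second_moment prob_space s0)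
  have covY: "(\<integral>\<omega>. Y i j k \<omega> * Y a b l \<omega> \<partial>M)
      = (ent R (i, a) * ent R (j, b) + ent R (i, b) * ent R (j, a)) * (s (int k - int l))\<^sup>2"
    if k: "k \<in> {1..d}" and l: "l \<in> {1..d}" for i j k a b l
  proof -
    have m: "(i, k) \<in> ?T" "(j, k) \<in> ?T" "(a, l) \<in> ?T" "(b, l) \<in> ?T" using k l by auto
    have "(\<integral>\<omega>. Y i j k \<omega> * Y a b l \<omega> \<partial>M)
      = (\<integral>\<omega>. (x (i, k) \<omega> * x (j, k) \<omega> * (x (a, l) \<omega> * x (b, l) \<omega>) - ent R (i, j) * Y a b l \<omega>) - ent R (a, b) * (x (i, k) \<omega> * x (j, k) \<omega>) \<partial>M)"
      by (simp add: Y_def algebra_simps)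
    also have "\<dots> = (\<integral>\<omega>. x (i, k) \<omega> * x (j, k) \<omega> * (x (a, l) \<omega> * x (b, l) \<omega>) \<partial>M) - ent R (i, j) * (\<integral>\<omega>. Y a b l \<omega> \<partial>M) - ent R (a, b) * (\<integral>\<omega>. x (i, k) \<omega> * x (j, k) \<omega> \<partial>M)"
      using int_prod4[OF m] int_prod[OF m(1,2)] intY[OF l] by simp
    also have "\<dots> = (ent R (i, a) * ent R (j, b) + ent R (i, b) * ent R (j, a)) * (s (int k - int l))\<^sup>2"
      unfolding fourth_moment[OF m] second_moment[OF m(1,2)] meanY[OF l]
      by (simp add: s0 power2_eq_square algebra_simps)
    finally show ?thesis .
  qed
  have W: "W i j = (\<lambda>\<omega>. 1 / sqrt (real d) * (\<Sum>k=1..d. Y i j k \<omega>))" for i j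
    by (simp add: W_def Y_def)
  have mean: "(\<integral>\<omega>. W i j \<omega> \<partial>M) = 0" for i j
    unfolding W by (subst integral_mult_right_zero, subst Bochner_Integration.integral_sum) (auto simp: intY meanY)
  have "covariance M (W i j) (W a b) = (\<integral>\<omega>. 1 / real d * (\<Sum>k=1..d. \<Sum>l=1..d. Y i j k \<omega> * Y a b l \<omega>) \<partial>M)"
    unfolding covariance_def mean unfolding W by (simp add: sum_product)
  also have "\<dots> = 1 / real d * (\<Sum>k=1..d. \<Sum>l=1..d. (ent R (i, a) * ent R (j, b) + ent R (i, b) * ent R (j, a)) * (s (int k - int l))\<^sup>2)"
  proof -
    have "(\<integral>\<omega>. (\<Sum>k=1..d. \<Sum>l=1..d. Y i j k \<omega> * Y a b l \<omega>) \<partial>M) = (\<Sum>k=1..d. \<integral>\<omega>. (\<Sum>l=1..d. Y i j k \<omega> * Y a b l \<omega>) \<partial>M)"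
      by (intro Bochner_Integration.integral_sum Bochner_Integration.integrable_sum intYY)
    also have "\<dots> = (\<Sum>k=1..d. \<Sum>l=1..d. \<integral>\<omega>. Y i j k \<omega> * Y a b l \<omega> \<partial>M)"
      by (intro sum.cong refl Bochner_Integration.integral_sum intYY)
    finally show ?thesis by (simp only: integral_mult_right_zero) (simp add: covY)
  qed
  also have "\<dots> = entry_cov R (variance_factor s d) (i, j) (a, b)"
    unfolding sum_distrib_left[symmetric] entry_cov_def variance_factor_def by simp
  finally show ?thesis .
qed

text \<open>Replaces the constant obtained with \<gamma> = 2 - L by the stated one; besides the
  comparison of denominators this uses 4 L <= 32 L^3, valid for L >= 1.\<close>

lemma constant_le:
  fixes L n D Q S \<gamma> :: real
  assumes L: "1 \<le> L" "L < sqrt 6 / 2" and D: "1 \<le> D" and n: "0 \<le> n" and Q: "Q \<le> D * S ^ 3" and S: "0 < S"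
  shows "4 * n ^ 3 * L * Q / (D\<^sup>2 * (2 - L)\<^sup>2) \<le> (L powr (3/2) / (3 - 2 * L\<^sup>2) * sqrt (32 * n ^ 3 / D * S ^ 3))\<^sup>2"
    and "0 < 3 - 2 * L\<^sup>2"
proof -
  have "L\<^sup>2 < (sqrt 6 / 2)\<^sup>2" using L by (intro power_strict_mono) auto
  then show pos: "0 < 3 - 2 * L\<^sup>2" by (simp add: power_divide)
  \<comment> \<open>The difference of the two denominators factors, with a sign determined by L >=
    1.\<close>
  have "(3 - 2 * L\<^sup>2) + (2 * L + 1) * (L - 1) = 2 - L" by (simp add: power2_eq_square algebra_simps)
  moreover have "0 \<le> (2 * L + 1) * (L - 1)" using L by (intro mult_nonneg_nonneg) auto
  ultimately have le: "3 - 2 * L\<^sup>2 \<le> 2 - L" by linarith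
  have sq: "(L powr (3/2))\<^sup>2 = L ^ 3"
  proof -
    have "(L powr (3/2))\<^sup>2 = L powr 3" using L by (simp add: powr_powr flip: powr_numeral)
    then show ?thesis using L by simp
  qed
  have S3: "0 < S ^ 3" using S by simp
  have "4 * n ^ 3 * L * Q / (D\<^sup>2 * (2 - L)\<^sup>2) \<le> 4 * n ^ 3 * L * (D * S ^ 3) / (D\<^sup>2 * (2 - L)\<^sup>2)"
    using L n Q by (intro divide_right_mono mult_left_mono) auto
  also have "\<dots> = 4 * n ^ 3 * L * S ^ 3 / D / (2 - L)\<^sup>2" using D by (simp add: power2_eq_square)
  also have "\<dots> \<le> 4 * n ^ 3 * L * S ^ 3 / D / (3 - 2 * L\<^sup>2)\<^sup>2"
    using L n D S pos le by (intro divide_left_mono power_mono mult_pos_pos divide_nonneg_nonneg mult_nonneg_nonneg) auto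
  also have "\<dots> \<le> 32 * n ^ 3 * L ^ 3 * S ^ 3 / D / (3 - 2 * L\<^sup>2)\<^sup>2"
  proof -
    have "L \<le> L ^ 3" using L by (simp add: self_le_power)
    then have "4 * n ^ 3 * L \<le> 32 * n ^ 3 * L ^ 3" using L n by (intro mult_mono) auto
    then show ?thesis using D S3 by (intro divide_right_mono mult_right_mono) auto
  qed
  also have "\<dots> = (L powr (3/2) / (3 - 2 * L\<^sup>2) * sqrt (32 * n ^ 3 / D * S ^ 3))\<^sup>2"
    using n D S3 by (simp add: power_mult_distrib power_divide sq mult_ac)
  finally show "4 * n ^ 3 * L * Q / (D\<^sup>2 * (2 - L)\<^sup>2) \<le> (L powr (3/2) / (3 - 2 * L\<^sup>2) * sqrt (32 * n ^ 3 / D * S ^ 3))\<^sup>2" .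
qed

theorem theorem1p1:
  fixes r s :: "int \<Rightarrow> real"
    and e :: "nat \<Rightarrow> nat \<Rightarrow> 'h :: {real_inner, polish_space}"
    and M :: "'w measure" and X :: "'h \<Rightarrow> 'w \<Rightarrow> real"
    and pos :: "'n::finite \<Rightarrow> nat"
    and d :: nat
    and N :: "'v measure" and G :: "'v \<Rightarrow> real^'n^'n"
  assumes r: "covariance_function r" "r 0 = 1"
    and s: "covariance_function s" "s 0 = 1"
    and e: "\<And>i j i' j'. i \<ge> 1 \<Longrightarrow> j \<ge> 1 \<Longrightarrow> i' \<ge> 1 \<Longrightarrow> j' \<ge> 1 \<Longrightarrow>
              e i j \<bullet> e i' j' = r (int i - int i') * s (int j - int j')"
    and M: "prob_space M"
    and X: "isonormal M X"
    and pos: "bij_betw pos UNIV {1..CARD('n)}"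
    and d: "d \<ge> 1"
    and N: "prob_space N"
    and G_symmetric: "\<And>\<omega>. \<omega> \<in> space N \<Longrightarrow> transpose (G \<omega>) = G \<omega>"
    and G_gaussian: "centered_gaussian_family N (\<lambda>(i, j) \<omega>. G \<omega> $ i $ j)"
    and G_covariance: "\<And>i j k l.
          covariance N (\<lambda>\<omega>. G \<omega> $ i $ j) (\<lambda>\<omega>. G \<omega> $ k $ l) =
          covariance M (\<lambda>\<omega>. wishart_matrix r (\<lambda>i j. X (e i j)) pos d \<omega> $ i $ j)
                       (\<lambda>\<omega>. wishart_matrix r (\<lambda>i j. X (e i j)) pos d \<omega> $ k $ l)"
    and r_summable: "(\<lambda>k. \<bar>r k\<bar>) summable_on UNIV"
    and r_small: "l1_norm r < sqrt 6 / 2"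
  shows "wasserstein_dist M (wishart_matrix r (\<lambda>i j. X (e i j)) pos d) N G
         \<le> ereal (l1_norm r powr (3/2) / (3 - 2 * (l1_norm r)^2) *
              sqrt (32 * real CARD('n) ^ 3 / real d *
                (\<Sum>k\<in>{- int d..int d}. \<bar>s k\<bar> powr (4/3)) ^ 3))"
proof -
  interpret M: prob_space M by fact
  interpret N: prob_space N by fact
  interpret MN: pair_prob_space M N ..
  let ?L = "l1_norm r"
  define R :: "real^'n^'n" where "R = (\<chi> i j. r (int (pos i) - int (pos j)))"
  have entR: "ent R q = r (int (pos (fst q)) - int (pos (snd q)))" for q by (simp add: R_def ent_def)
  have r_even: "r (- k) = r k" and s_even: "s (- k) = s k" for k
    using r(1) s(1) by (auto simp: covariance_function_def)
  have pos_inj: "inj pos" and pos_ge: "pos i \<ge> 1" for i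
    using pos bij_betwE[OF pos] by (auto simp: bij_betw_def)
  have L_sum: "(\<Sum>k\<in>B. \<bar>r k\<bar>) \<le> ?L" if "finite B" for B
    unfolding l1_norm_def using that by (intro finite_sum_le_infsum r_summable) auto
  have L1: "1 \<le> ?L" using L_sum[of "{0}"] r(2) by simp

  define x where "x = (\<lambda>u \<omega>. X (e (pos (fst u)) (snd u)) \<omega>)"
  define g :: "'n \<times> 'n \<Rightarrow> 'v \<Rightarrow> real" where "g = (\<lambda>q \<omega>. G \<omega> $ fst q $ snd q)"
  have X_gauss: "centered_gaussian_family M X" using X by (simp add: isonormal_def)
  have x_gauss: "centered_gaussian_family M x"
    unfolding x_def by (rule centered_gaussian_family_comp[OF X_gauss])
  have x_gv: "gaussian_vector M (UNIV \<times> {1..d}) (\<lambda>u v. ent R (fst u, fst v) * s (int (snd u) - int (snd v))) x"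
  proof (rule gaussian_vectorI[OF M x_gauss])
    fix u v :: "'n \<times> nat" assume "u \<in> UNIV \<times> {1..d}" "v \<in> UNIV \<times> {1..d}"
    then have "1 \<le> snd u" "1 \<le> snd v" by auto
    then show "(\<integral>\<omega>. x u \<omega> * x v \<omega> \<partial>M) = ent R (fst u, fst v) * s (int (snd u) - int (snd v))"
      using X e pos_ge unfolding x_def isonormal_def by (simp add: entR)
  qed simp
  have g_gauss: "centered_gaussian_family N g"
    using G_gaussian by (simp add: g_def case_prod_beta')
  have g_mean: "(\<integral>\<omega>. g q \<omega> \<partial>N) = 0" for q
    using centered_gaussian_family_combination(2)[OF g_gauss, of "{q}" "\<lambda>_. 1"] by simp
  have W_entry: "wishart_matrix r (\<lambda>i j. X (e i j)) pos d \<omega> $ i $ j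
      = 1 / sqrt (real d) * (\<Sum>k=1..d. x (i, k) \<omega> * x (j, k) \<omega> - ent R (i, j))" for \<omega> i j
    by (simp add: wishart_matrix_def x_def entR)
  have g_gv: "gaussian_vector N UNIV (entry_cov R (variance_factor s d)) g"
  proof (rule gaussian_vectorI[OF N g_gauss])
    fix p q :: "'n \<times> 'n"
    \<comment> \<open>The mean of \<open>g\<close> is zero, so the prescribed covariances are second
      moments.\<close>
    have "(\<integral>\<omega>. g p \<omega> * g q \<omega> \<partial>N) = covariance N (g p) (g q)"
      by (simp add: covariance_def g_mean)
    also have "\<dots> = entry_cov R (variance_factor s d) (fst p, snd p) (fst q, snd q)"
      unfolding g_def G_covariance W_entry
      by (rule wishart_entry_covariance[OF x_gv s(2)])
    finally show "(\<integral>\<omega>. g p \<omega> * g q \<omega> \<partial>N) = entry_cov R (variance_factor s d) p q" by simp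
  qed simp
  define Z where "Z = (\<lambda>t \<omega>. case t of Inl u \<Rightarrow> x u (fst \<omega>) | Inr q \<Rightarrow> g q (snd \<omega>))"
  have "gaussian_vector (M \<Otimes>\<^sub>M N) (Inl ` (UNIV \<times> {1..d}) \<union> Inr ` UNIV) (index_cov R s (variance_factor s d)) Z"
    unfolding Z_def by (rule gaussian_vector_pair[OF x_gv g_gv]) auto
  then interpret gaussian_vector "M \<Otimes>\<^sub>M N" "index_set d" "index_cov R s (variance_factor s d)" Z
    by (simp add: index_set_def)
  interpret coercive_wishart "M \<Otimes>\<^sub>M N" d R s Z "2 - ?L" ?L
  proof
    show "1 \<le> d" "s 0 = 1" "\<And>k. s (- k) = s k" by fact+
    show "ent R (i, j) = ent R (j, i)" for i j
      using r_even[of "int (pos i) - int (pos j)"] by (simp add: entR)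
    then have R_sym: "R $ i $ j = R $ j $ i" for i j by (simp add: ent_def)
    show "ent R (i, i) = 1" for i by (simp add: entR r)
    then have R_diag: "R $ i $ i = 1" for i by (simp add: ent_def)
    \<comment> \<open>Hence the norm of r is below 2, which makes \<open>R\<close> coercive.\<close>
    have "sqrt 6 < 4" by (rule real_less_lsqrt) simp_all
    then show "0 < 2 - ?L" using r_small by simp
    show "\<bar>ent R q\<bar> \<le> 1" for q using covariance_function_abs_le[OF r(1)] r(2) by (simp add: entR)
    show rows: "(\<Sum>j\<in>UNIV. \<bar>ent R (i, j)\<bar>) \<le> ?L" for i
    proof -
      \<comment> \<open>Distinct columns give distinct differences, so a row sum is a partial sum of
        the norm of r.\<close>
      have inj: "inj (\<lambda>j. int (pos i) - int (pos j))" using pos_inj by (auto simp: inj_on_def)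
      have "(\<Sum>j\<in>UNIV. \<bar>ent R (i, j)\<bar>) = (\<Sum>k\<in>range (\<lambda>j. int (pos i) - int (pos j)). \<bar>r k\<bar>)"
        by (subst sum.reindex[OF inj]) (simp add: entR comp_def)
      also have "\<dots> \<le> ?L" by (rule L_sum) simp
      finally show ?thesis .
    qed
    show "(2 - ?L) * (y \<bullet> y) \<le> y \<bullet> (R *v y)" for y
      using coercive_of_row_sums[OF R_sym R_diag, of ?L] rows by (simp add: ent_def)
  qed
  let ?S = "\<Sum>k\<in>{- int d..int d}. \<bar>s k\<bar> powr (4/3)"
  define b where "b = ?L powr (3/2) / (3 - 2 * ?L\<^sup>2) * sqrt (32 * real CARD('n) ^ 3 / real d * ?S ^ 3)"
  have S: "0 < ?S"
  proof -
    have "\<bar>s 0\<bar> powr (4/3) \<le> ?S" by (rule member_le_sum[where f="\<lambda>k. \<bar>s k\<bar> powr (4/3)"]) auto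
    then show ?thesis using s(2) by simp
  qed
  note const = constant_le[where n="real CARD('n)", OF L1 r_small _ _ cycle_sum_le[where s=s and d=d, OF s_even] S]
  \<comment> \<open>Strict positivity, due to s(0) = 1 and L >= 1, makes \<open>b\<^sup>2\<close>
    admissible as the bound \<open>V\<close>.\<close>
  have "0 < b" unfolding b_def using const(2) S d L1 by simp
  have V: "expect (\<lambda>x. (norm (Dm x))\<^sup>2) \<le> b\<^sup>2"
    unfolding b_def using const(1) d by (intro order_trans[OF expect_Dm_norm_le]) simp
  have W_eq: "Wm (\<lambda>t. Z t \<omega>) = wishart_matrix r (\<lambda>i j. X (e i j)) pos d (fst \<omega>)" for \<omega>
    by (rule matrix_eqI) (simp only: Wm_def ent_mat_of, simp only: ent_def W_entry Z_def sum.case prod.collapse)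
  have G_eq: "Gm (\<lambda>t. Z t \<omega>) = G (snd \<omega>)" for \<omega>
    by (rule matrix_eqI) (simp only: Gm_def ent_mat_of, simp add: Z_def g_def ent_def)
  have "(\<integral>\<omega>. f (wishart_matrix r (\<lambda>i j. X (e i j)) pos d \<omega>) \<partial>M) - (\<integral>\<omega>. f (G \<omega>) \<partial>N) \<le> b"
    if f: "1-lipschitz_on UNIV f" for f :: "real^'n^'n \<Rightarrow> real"
  proof -
    have intW: "integrable (M \<Otimes>\<^sub>M N) (\<lambda>\<omega>. f (Wm (\<lambda>t. Z t \<omega>)))"
      and intG: "integrable (M \<Otimes>\<^sub>M N) (\<lambda>\<omega>. f (Gm (\<lambda>t. Z t \<omega>)))"
      using integrable_tame[OF tame_lipschitz_Wm[OF f]] integrable_tame[OF tame_lipschitz_Gm[OF f]] .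
    \<comment> \<open>The distance only involves the two marginal laws; the other coordinate of the
      product space integrates to 1.\<close>
    have "(\<integral>\<omega>. f (wishart_matrix r (\<lambda>i j. X (e i j)) pos d \<omega>) \<partial>M) = expect (\<lambda>x. f (Wm x))"
      using MN.integral_fst'[OF intW] unfolding expect_def W_eq by (simp add: N.prob_space)
    moreover have "(\<integral>\<omega>. f (G \<omega>) \<partial>N) = expect (\<lambda>x. f (Gm x))"
      using MN.integral_fst'[OF intG] unfolding expect_def G_eq by (simp add: M.prob_space)
    moreover have "expect (\<lambda>x. f (Wm x)) - expect (\<lambda>x. f (Gm x)) \<le> sqrt (b\<^sup>2)"
      using \<open>0 < b\<close> by (intro expect_lipschitz_diff_le_swapped f V) simp
    ultimately show ?thesis using \<open>0 < b\<close> by simp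
  qed
  then show ?thesis
    unfolding wasserstein_dist_def b_def by (intro SUP_least) simp
qed

end
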